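(* Let $t$ be transcendental over $\mathbb{Q}$ and define the rational functions \[ b(t)=\frac{16t(t+1)(t+2)(2t^2+4t+1)}{16t^4+64t^3+76t^2+24t-1}, \] \[ d(t)=\frac{256t^8+2048t^7+6272t^6+8960t^5+5424t^4+192t^3-888t^2-112t+33}{16(16t^4+64t^3+76t^2+24t-1)(2t^2+4t+1)(t+1)}, \] \[ e(t)=\frac{N(t)}{16(16t^4+64t^3+76t^2+24t-1)(2t^2+4t+1)(t+1)}, \] where \[ N(t)=4096t^{12}+49152t^{11}+262144t^{10}+819200t^9+1665024t^8+2310144t^7+2233728t^6+1507584t^5+697856t^4+211968t^3+38624t^2+3520t+105. \] Then the elliptic curve \[ E:\quad y^2=(b(t)x+1)(d(t)x+1)(e(t)x+1) \] over $\mathbb{Q}(t)$ has torsion group $E(\mathbb{Q}(t))_{\rm tors}$ isomorphic to $\mathbb{Z}/2\mathbb{Z}\times\mathbb{Z}/2\mathbb{Z}$, and the rank of $E(\mathbb{Q}(t))$ is at least $4$.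
   Context: $\mathbb{Q}(t)$ denotes the field of rational functions in one variable $t$ over $\mathbb{Q}$; $E(\mathbb{Q}(t))$ is the group of $\mathbb{Q}(t)$-rational points of $E$ (a finitely generated abelian group), its rank being the rank of its free part. *)

theory Defs
  imports
    "HOL-Computational_Algebra.Computational_Algebra"
    "HOL-Algebra.Elementary_Groups"
    "HOL-Algebra.Free_Abelian_Groups"
    "HOL-Library.Extended_Nat"
begin

section \<open>Elliptic curves \<open>y\<^sup>2 = f(x)\<close>\<close>

text \<open>
  The cubic \<open>f\<close> is not assumed monic. Away from characteristic 2 the projective closure of
  \<open>y\<^sup>2 = f(x)\<close> with \<open>deg f = 3\<close> is a smooth curve of genus 1 iff \<open>f\<close> has no multiple root
  over an algebraic closure, that is, iff \<open>f\<close> is coprime to its derivative.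
\<close>

definition elliptic_cubic :: "'a::field_char_0 poly \<Rightarrow> bool" where
  "elliptic_cubic f \<longleftrightarrow> degree f = 3 \<and> coprime f (pderiv f)"

text \<open>\<open>Infinity\<close> is the only point of the projective closure on the line at infinity.\<close>

datatype 'a ec_point = Infinity | Affine 'a 'a

definition ec_points :: "'a::field_char_0 poly \<Rightarrow> 'a ec_point set" where
  "ec_points f = insert Infinity {Affine x y | x y. y ^ 2 = poly f x}"

text \<open>
  The chord-tangent law. If the line through \<open>P\<close> and \<open>Q\<close> (the tangent, if \<open>P = Q\<close>) has
  slope \<open>m\<close>, comparing the coefficients of \<open>x\<^sup>2\<close> in \<open>f(x) - (m x + c)\<^sup>2\<close> shows that the
  abscissae of its three intersections with the curve add up to
  \<open>(m\<^sup>2 - coeff f 2) / coeff f 3\<close>. Two points of the curve with \<open>x\<^sub>1 = x\<^sub>2\<close> and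
  \<open>y\<^sub>1 \<noteq> - y\<^sub>2\<close> are equal and have \<open>y\<^sub>1 \<noteq> 0\<close>.
\<close>

fun ec_add :: "'a::field_char_0 poly \<Rightarrow> 'a ec_point \<Rightarrow> 'a ec_point \<Rightarrow> 'a ec_point" where
  "ec_add f Infinity Q = Q"
| "ec_add f P Infinity = P"
| "ec_add f (Affine x\<^sub>1 y\<^sub>1) (Affine x\<^sub>2 y\<^sub>2) =
    (if x\<^sub>1 = x\<^sub>2 \<and> y\<^sub>1 = - y\<^sub>2 then Infinity
     else
       let m = (if x\<^sub>1 = x\<^sub>2 then poly (pderiv f) x\<^sub>1 / (2 * y\<^sub>1) else (y\<^sub>2 - y\<^sub>1) / (x\<^sub>2 - x\<^sub>1));
           x\<^sub>3 = (m ^ 2 - coeff f 2) / coeff f 3 - x\<^sub>1 - x\<^sub>2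
       in Affine x\<^sub>3 (m * (x\<^sub>1 - x\<^sub>3) - y\<^sub>1))"

definition ec_group :: "'a::field_char_0 poly \<Rightarrow> 'a ec_point monoid" where
  "ec_group f = \<lparr>carrier = ec_points f, monoid.mult = ec_add f, one = Infinity\<rparr>"


section \<open>Torsion and rank of an abelian group\<close>

definition torsion_part :: "('a, 'b) monoid_scheme \<Rightarrow> ('a, 'b) monoid_scheme" where
  "torsion_part G =
     G\<lparr>carrier := {x \<in> carrier G. \<exists>n::nat. n > 0 \<and> x [^]\<^bsub>G\<^esub> n = \<one>\<^bsub>G\<^esub>}\<rparr>"

text \<open>
  The rank is the supremum of the ranks of the free abelian subgroups, so that it is defined
  without knowing that the group is finitely generated. The theorem \<open>abelian_rank_eqI\<close> below
  shows that it is the rank of the free part whenever the group splits as a torsion group times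
  a free abelian group of finite rank.
\<close>

definition abelian_rank :: "('a, 'b) monoid_scheme \<Rightarrow> enat" where
  "abelian_rank G =
     (SUP n \<in> {n. \<exists>H. subgroup H G \<and> free_Abelian_group {..<n::nat} \<cong> G\<lparr>carrier := H\<rparr>}. enat n)"

lemma integer_relation:
  fixes v :: "'i \<Rightarrow> nat \<Rightarrow> int"
  assumes "finite I" "card I > r"
  shows "\<exists>c. (\<exists>i\<in>I. c i \<noteq> 0) \<and> (\<forall>j<r. (\<Sum>i\<in>I. c i * v i j) = 0)"
  using assms
proof (induction r arbitrary: I v)
  case 0
  then have "I \<noteq> {}" by auto
  then show ?case by (intro exI[of _ "\<lambda>_. 1"]) auto
next
  case (Suc r)
  show ?case
  proof (cases "\<forall>i\<in>I. v i r = 0")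
    case True
    obtain c where "\<exists>i\<in>I. c i \<noteq> 0" "\<forall>j<r. (\<Sum>i\<in>I. c i * v i j) = 0"
      using Suc.IH[of I v] Suc.prems by auto
    with True show ?thesis by (intro exI[of _ c]) (auto simp: less_Suc_eq)
  next
    case False
    then obtain p where p: "p \<in> I" "v p r \<noteq> 0" by auto
    let ?J = "I - {p}"
    have fin: "finite ?J" and card: "card ?J > r"
      using Suc.prems p by auto
    obtain c where c: "\<exists>i\<in>?J. c i \<noteq> 0"
      and rel: "\<And>j. j < r \<Longrightarrow> (\<Sum>i\<in>?J. c i * (v p r * v i j - v i r * v p j)) = 0"
      using Suc.IH[OF fin card, of "\<lambda>i j. v p r * v i j - v i r * v p j"] by auto
    define c' where "c' i = (if i = p then - (\<Sum>i\<in>?J. c i * v i r) else c i * v p r)" for i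
    have split: "(\<Sum>i\<in>I. c' i * v i j) = (\<Sum>i\<in>?J. c i * (v p r * v i j - v i r * v p j))" for j
    proof -
      have "(\<Sum>i\<in>I. c' i * v i j) = c' p * v p j + (\<Sum>i\<in>?J. c' i * v i j)"
        using Suc.prems p by (simp add: sum.remove)
      also have "(\<Sum>i\<in>?J. c' i * v i j) = (\<Sum>i\<in>?J. c i * v p r * v i j)"
        by (rule sum.cong) (auto simp: c'_def)
      also have "c' p * v p j = - (\<Sum>i\<in>?J. c i * v i r * v p j)"
        by (simp add: c'_def sum_distrib_right)
      finally show ?thesis
        by (simp add: sum_subtractf right_diff_distrib mult.assoc)
    qed
    have "(\<Sum>i\<in>I. c' i * v i j) = 0" if "j < Suc r" for j
      using that rel by (cases "j = r") (auto simp: split algebra_simps less_Suc_eq)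
    moreover have "\<exists>i\<in>I. c' i \<noteq> 0"
      using c p by (auto simp: c'_def)
    ultimately show ?thesis by blast
  qed
qed

lemma free_Abelian_group_inj_hom_le:
  assumes h: "h \<in> hom (free_Abelian_group {..<n::nat}) (free_Abelian_group {..<r::nat})"
    and inj: "\<And>x. x \<in> carrier (free_Abelian_group {..<n}) \<Longrightarrow> h x = 0 \<Longrightarrow> x = 0"
  shows "n \<le> r"
proof (rule ccontr)
  assume "\<not> n \<le> r"
  let ?Z = "free_Abelian_group {..<n}" and ?Y = "free_Abelian_group {..<r}"
  interpret gh: group_hom ?Z ?Y h
    using h by (simp add: group_hom_def group_hom_axioms_def)
  obtain c where c: "\<exists>i<n. c i \<noteq> 0"
    and rel: "\<forall>j<r. (\<Sum>i<n. c i * poly_mapping.lookup (h (frag_of i)) j) = 0"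
    using integer_relation[of "{..<n}" r "\<lambda>i. poly_mapping.lookup (h (frag_of i))"]
      \<open>\<not> n \<le> r\<close> by auto
  have keys: "Poly_Mapping.keys (\<Sum>i\<in>A. frag_cmul (c i) (frag_of i)) \<subseteq> {..<n}"
    if "A \<subseteq> {..<n}" for A
  proof -
    have "(\<Sum>i\<in>A. frag_cmul (c i) (frag_of i)) \<in> carrier ?Z"
      by (rule sum_closed_free_Abelian_group) (use that in \<open>auto simp: keys_frag_of dest!: subsetD[OF keys_cmul]\<close>)
    then show ?thesis by simp
  qed
  have hsum: "h (\<Sum>i\<in>A. frag_cmul (c i) (frag_of i)) = (\<Sum>i\<in>A. frag_cmul (c i) (h (frag_of i)))"
    if "finite A" "A \<subseteq> {..<n}" for A
    using that
  proof (induction A)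
    case empty
    show ?case using gh.hom_one by simp
  next
    case (insert a A)
    have 1: "Poly_Mapping.keys (h (frag_of a)) \<subseteq> {..<r}"
      using gh.hom_closed[of "frag_of a"] insert by simp
    have "h (frag_cmul (c a) (frag_of a)) = frag_cmul (c a) (h (frag_of a))"
      using gh.hom_int_pow[of "frag_of a" "c a"] insert 1 by simp
    moreover have "h (frag_cmul (c a) (frag_of a) + (\<Sum>i\<in>A. frag_cmul (c i) (frag_of i)))
        = h (frag_cmul (c a) (frag_of a)) + h (\<Sum>i\<in>A. frag_cmul (c i) (frag_of i))"
      using gh.hom_mult[of "frag_cmul (c a) (frag_of a)" "\<Sum>i\<in>A. frag_cmul (c i) (frag_of i)"]
        keys[of A] keys[of "{a}"] insert by simp
    ultimately show ?case using insert by simp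
  qed
  let ?x = "\<Sum>i<n. frag_cmul (c i) (frag_of i)"
  have "h ?x = 0"
  proof (rule poly_mapping_eqI)
    fix j
    have "Poly_Mapping.keys (h ?x) \<subseteq> {..<r}"
      using gh.hom_closed[of ?x] keys[of "{..<n}"] by simp
    then show "poly_mapping.lookup (h ?x) j = poly_mapping.lookup 0 j"
      using rel hsum[of "{..<n}"]
      by (cases "j < r") (auto simp: lookup_sum in_keys_iff)
  qed
  then have "?x = 0"
    using inj[of ?x] keys[of "{..<n}"] by simp
  moreover have "poly_mapping.lookup ?x i = c i" if "i < n" for i
    using that by (simp add: lookup_sum lookup_frag_of if_distrib cong: if_cong)
  ultimately show False using c by auto
qed

theorem abelian_rank_eqI:
  fixes r :: nat
  assumes G: "comm_group G" and T: "group T"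
    and tors: "\<And>x. x \<in> carrier T \<Longrightarrow> \<exists>n::nat. n > 0 \<and> x [^]\<^bsub>T\<^esub> n = \<one>\<^bsub>T\<^esub>"
    and iso: "G \<cong> T \<times>\<times> free_Abelian_group {..<r}"
  shows "abelian_rank G = enat r"
proof -
  let ?Y = "free_Abelian_group {..<r}"
  interpret G: comm_group G by (rule G)
  interpret T: group T by (rule T)
  have TY: "group (T \<times>\<times> ?Y)"
    by (simp add: DirProd_group T)
  obtain f where f: "f \<in> iso G (T \<times>\<times> ?Y)" using iso by (auto simp: is_iso_def)
  have "n \<le> r" if H: "subgroup H G" and i: "free_Abelian_group {..<n} \<cong> G\<lparr>carrier := H\<rparr>"
    for n :: nat and H
  proof -
    let ?Z = "free_Abelian_group {..<n}"
    obtain g where g: "g \<in> iso ?Z (G\<lparr>carrier := H\<rparr>)" using i by (auto simp: is_iso_def)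
    have gG: "g \<in> hom ?Z G"
      using g H by (auto simp: iso_def hom_def Pi_iff dest: subgroup.mem_carrier)
    define k where "k = f \<circ> g"
    have k: "k \<in> hom ?Z (T \<times>\<times> ?Y)"
      using gG f unfolding k_def by (auto intro: hom_compose simp: iso_def)
    have kinj: "inj_on k (carrier ?Z)"
      unfolding k_def
    proof (rule comp_inj_on)
      show "inj_on g (carrier ?Z)" using g by (auto simp: iso_def bij_betw_def)
      show "inj_on f (g ` carrier ?Z)"
        using f gG by (auto simp: iso_def bij_betw_def hom_def intro: inj_on_subset)
    qed
    interpret k: group_hom ?Z "T \<times>\<times> ?Y" k
      using k TY by (simp add: group_hom_def group_hom_axioms_def)
    have "snd \<circ> k \<in> hom ?Z ?Y"
    proof (rule homI)
      fix x y
      assume "x \<in> carrier ?Z" "y \<in> carrier ?Z"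
      then show "(snd \<circ> k) (x \<otimes>\<^bsub>?Z\<^esub> y) = (snd \<circ> k) x \<otimes>\<^bsub>?Y\<^esub> (snd \<circ> k) y"
        using k.hom_mult[of x y] by (simp add: DirProd_def split: prod.splits)
    next
      fix x
      assume "x \<in> carrier ?Z"
      then show "(snd \<circ> k) x \<in> carrier ?Y"
        using k.hom_closed[of x] by (auto simp: DirProd_def mem_Times_iff)
    qed
    moreover have "x = 0" if x: "x \<in> carrier ?Z" and 0: "(snd \<circ> k) x = 0" for x
    proof -
      obtain a where a: "k x = (a, 0)" "a \<in> carrier T"
        using 0 k.hom_closed[OF x] by (cases "k x") (auto simp: DirProd_def)
      then obtain m :: nat where m: "m > 0" "a [^]\<^bsub>T\<^esub> m = \<one>\<^bsub>T\<^esub>" using tors by blast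
      have pow: "(a, 0) [^]\<^bsub>T \<times>\<times> ?Y\<^esub> l = (a [^]\<^bsub>T\<^esub> l, 0)" for l :: nat
        by (induction l) (auto simp: DirProd_def nat_pow_def)
      have "k (x [^]\<^bsub>?Z\<^esub> m) = k \<one>\<^bsub>?Z\<^esub>"
        using k.hom_nat_pow[OF x, of m] k.hom_one m by (simp add: a pow)
      moreover have "x [^]\<^bsub>?Z\<^esub> m \<in> carrier ?Z"
        using x by (simp only: monoid.nat_pow_closed[OF group.is_monoid[OF group_free_Abelian_group]])
      ultimately have "x [^]\<^bsub>?Z\<^esub> m = \<one>\<^bsub>?Z\<^esub>"
        using kinj by (auto dest!: inj_onD)
      then have "frag_cmul (int m) x = 0" by simp
      then have "int m * poly_mapping.lookup x i = 0" for i
        by (metis lookup_frag_cmul lookup_zero)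
      then show "x = 0" using m by (intro poly_mapping_eqI) auto
    qed
    ultimately show ?thesis by (rule free_Abelian_group_inj_hom_le)
  qed
  moreover have "\<exists>H. subgroup H G \<and> ?Y \<cong> G\<lparr>carrier := H\<rparr>"
  proof -
    have "inv_into (carrier G) f \<in> iso (T \<times>\<times> ?Y) G"
      using f by (rule G.iso_set_sym)
    moreover have "(\<lambda>y. (\<one>\<^bsub>T\<^esub>, y)) \<in> hom ?Y (T \<times>\<times> ?Y)"
      by (auto simp: hom_def DirProd_def)
    ultimately obtain s where s: "s \<in> hom ?Y G" and inj: "inj_on s (carrier ?Y)"
    proof -
      assume inv: "inv_into (carrier G) f \<in> iso (T \<times>\<times> ?Y) G"
        and j: "(\<lambda>y. (\<one>\<^bsub>T\<^esub>, y)) \<in> hom ?Y (T \<times>\<times> ?Y)"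
      let ?s = "inv_into (carrier G) f \<circ> (\<lambda>y. (\<one>\<^bsub>T\<^esub>, y))"
      have "?s \<in> hom ?Y G" using inv j by (auto intro: hom_compose simp: iso_def)
      moreover have "inj_on ?s (carrier ?Y)"
      proof (rule comp_inj_on)
        show "inj_on (inv_into (carrier G) f) ((\<lambda>y. (\<one>\<^bsub>T\<^esub>, y)) ` carrier ?Y)"
          using inv by (auto simp: iso_def bij_betw_def intro: inj_on_subset)
      qed (auto intro: inj_onI)
      ultimately show ?thesis using that by blast
    qed
    interpret s: group_hom ?Y G s
      using s G.group_axioms by (simp add: group_hom_def group_hom_axioms_def)
    have "subgroup (s ` carrier ?Y) G" by (rule s.img_is_subgroup)
    moreover have "s \<in> iso ?Y (G\<lparr>carrier := s ` carrier ?Y\<rparr>)"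
      using s inj by (auto simp: iso_def hom_def bij_betw_def)
    ultimately show ?thesis by (auto simp: is_iso_def)
  qed
  ultimately show ?thesis
    unfolding abelian_rank_def by (intro antisym SUP_least SUP_upper) auto
qed

end

theory Submission
  imports "HOL-Algebra.Algebraic_Closure_Type" Defs
begin

text \<open>
  The map \<open>\<delta>(x, y) = de (1 + b x)\<close> is a homomorphism from the curve to square classes of \<open>\<rat>(t)\<close>, so it
  kills doubles. A product of values of \<open>\<delta>\<close> that is a square is nonnegative wherever it is defined.
  Four points are used: \<open>(0, 1)\<close>, a half of the point with abscissa \<open>1 / (bde)\<close>, and halves of \<open>Q - (0, 1)\<close>
  for two points \<open>Q\<close> at which \<open>1 + b x\<close>, \<open>1 + d x\<close>, \<open>1 + e x\<close> are all squares. The signs of \<open>\<delta>\<close> at six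
  rational values of \<open>t\<close> show that these points and the 2-torsion are independent modulo
  doubles; hence the rank is at least 4 and there is no point of order 4.

  A point of odd order lies on a periodic orbit of doubling, along which \<open>de (1 + b x)\<close>, \<open>be (1 + d x)\<close> and
  \<open>bd (1 + e x)\<close> are squares of rational functions \<open>A\<close>, \<open>B\<close>, \<open>C\<close>. After clearing the denominators of the
  coefficients, doubling acts on \<open>A\<close> by
  \<open>A' = (B\<^sup>2C\<^sup>2 - A\<^sup>2C\<^sup>2 - A\<^sup>2B\<^sup>2) / (2ABC)\<close>. Periodicity forces \<open>A\<close> to be a polynomial, and then a constant, since
  \<open>B\<^sup>2 - A\<^sup>2\<close> and \<open>C\<^sup>2 - A\<^sup>2\<close> are squarefree. The leading coefficient of \<open>C\<^sup>2 - A\<^sup>2\<close> is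
  negative, so \<open>C\<close> cannot exist.
\<close>

section \<open>The chord-tangent group\<close>

text \<open>The coefficients \<open>b, d, e\<close> form a Diophantine triple:
  \<open>bd + 1\<close>, \<open>be + 1\<close>, \<open>de + 1\<close> are squares, so the point with
  abscissa \<open>1 / (bde)\<close> can be halved. The abscissae of the two points \<open>Q\<close>
  extend the triple to quadruples. At such a \<open>Q\<close> all three components of the descent
  map have the same square classes as at \<open>(0, 1)\<close>, which is why
  \<open>Q - (0, 1)\<close> can be halved.

  Independence is read off from one component of that map, by exhibiting values that are not
  squares. Four points and the 2-torsion contribute six binary exponents, and each argument gives
  one linear condition on them; hence six arguments.

  Square classes cannot detect odd order, since a point of odd order is itself a double. This is the
  reason for the separate integrality argument, in the style of Nagell-Lutz over \<rat>[t]; being a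
  double is also what provides the three square roots.

  The group law is built from explicit polynomial identities, which require general position. A
  field with few points on the curve offers no room for that, so associativity is borrowed from the
  algebraic closure.\<close>

fun ec_neg :: "'a::field_char_0 ec_point \<Rightarrow> 'a ec_point" where
  "ec_neg Infinity = Infinity"
| "ec_neg (Affine x y) = Affine x (- y)"

lemma ec_neg_neg [simp]: "ec_neg (ec_neg P) = P"
  by (cases P) auto

lemma Affine_in_ec_points [simp]: "Affine x y \<in> ec_points f \<longleftrightarrow> y ^ 2 = poly f x"
  by (auto simp: ec_points_def)

lemma Infinity_in_ec_points [simp]: "Infinity \<in> ec_points f"
  by (auto simp: ec_points_def)

lemma ec_add_Infinity_right [simp]: "ec_add f P Infinity = P"
  by (cases P) auto

lemma ec_neg_in_ec_points [simp]: "P \<in> ec_points f \<Longrightarrow> ec_neg P \<in> ec_points f"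
  by (cases P) auto

lemma eq_uminus_iff_zero: "y = - y \<longleftrightarrow> y = 0" for y :: "'a::field_char_0"
  by (simp add: eq_neg_iff_add_eq_0 flip: mult_2)

text \<open>Smoothness is asked at the roots of \<open>f\<close> in the field itself: this excludes
  a singular point \<open>(x, 0)\<close>, as the cancellation law requires.\<close>

locale smooth_cubic =
  fixes f :: "'a::field_char_0 poly" and f0 f1 f2 f3
  assumes f_eq: "f = [:f0, f1, f2, f3:]" and f3_nz: "f3 \<noteq> 0"
    and smooth: "poly f x = 0 \<Longrightarrow> poly (pderiv f) x \<noteq> 0"
begin

lemma coeff_f: "coeff f 2 = f2" "coeff f 3 = f3"
  by (simp_all add: f_eq numeral_eq_Suc)

lemma poly_f: "poly f x = f0 + f1 * x + f2 * x ^ 2 + f3 * x ^ 3"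
  by (simp add: f_eq algebra_simps power2_eq_square power3_eq_cube)

lemma poly_pderiv_f: "poly (pderiv f) x = f1 + 2 * f2 * x + 3 * f3 * x ^ 2"
  by (simp add: f_eq pderiv_pCons algebra_simps power2_eq_square)

text \<open>The coefficients of \<open>f - (m X + c)\<^sup>2 = f\<^sub>3 (X - x\<^sub>1) (X - x\<^sub>2) (X - x\<^sub>3)\<close>.\<close>

definition line_meets :: "'a \<Rightarrow> 'a \<Rightarrow> 'a \<Rightarrow> 'a \<Rightarrow> 'a \<Rightarrow> bool" where
  "line_meets m c x1 x2 x3 \<longleftrightarrow>
     f2 - m ^ 2 = - f3 * (x1 + x2 + x3) \<and>
     f1 - 2 * m * c = f3 * (x1 * x2 + x1 * x3 + x2 * x3) \<and>
     f0 - c ^ 2 = - f3 * (x1 * x2 * x3)"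

lemma line_meets_eqs:
  assumes "line_meets m c x1 x2 x3"
  shows "f2 - m ^ 2 = - f3 * (x1 + x2 + x3)"
    "f1 - 2 * m * c = f3 * (x1 * x2 + x1 * x3 + x2 * x3)"
    "f0 - c ^ 2 = - f3 * (x1 * x2 * x3)"
  using assms by (auto simp: line_meets_def)

lemma line_meets_poly:
  assumes "line_meets m c x1 x2 x3"
  shows "poly f x - (c + m * x) ^ 2 = f3 * ((x - x1) * (x - x2) * (x - x3))"
  using line_meets_eqs[OF assms] unfolding poly_f by Groebner_Basis.algebra

lemma line_meets_perm:
  "line_meets m c x1 x2 x3 \<Longrightarrow> line_meets m c x2 x1 x3"
  "line_meets m c x1 x2 x3 \<Longrightarrow> line_meets m c x1 x3 x2"
  unfolding line_meets_def by (auto simp: algebra_simps)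

lemma line_meets_uminus: "line_meets (- m) (- c) = line_meets m c"
  by (intro ext) (simp add: line_meets_def)

text \<open>A double root of \<open>f - (m X + c)^2\<close> is also a root of its
  derivative.\<close>

lemma line_meets_double:
  assumes "line_meets m c x x z"
  shows "poly (pderiv f) x = 2 * m * (c + m * x)"
  using line_meets_eqs[OF assms] unfolding poly_pderiv_f by Groebner_Basis.algebra

text \<open>Replaces the rational formulas of \<open>ec_add\<close> by the line itself, so that sums
  can be handled through the coefficient equations of \<open>line_meets\<close>. The excluded case
  is the vertical line.\<close>

lemma add_affineE:
  assumes "y1 ^ 2 = poly f x1" "y2 ^ 2 = poly f x2" "\<not> (x1 = x2 \<and> y1 = - y2)"
  obtains m c x3 where "ec_add f (Affine x1 y1) (Affine x2 y2) = Affine x3 (- (c + m * x3))"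
    "line_meets m c x1 x2 x3" "y1 = c + m * x1" "y2 = c + m * x2"
proof -
  define m where "m = (if x1 = x2 then poly (pderiv f) x1 / (2 * y1) else (y2 - y1) / (x2 - x1))"
  define c where "c = y1 - m * x1"
  define x3 where "x3 = (m ^ 2 - f2) / f3 - x1 - x2"
  have y1: "y1 = c + m * x1" by (simp add: c_def)
  have yy: "x1 = x2 \<Longrightarrow> y1 = y2"
    using assms by (metis power2_eq_iff)
  have y2: "y2 = c + m * x2"
  proof (cases "x1 = x2")
    case True
    with yy show ?thesis by (simp add: c_def)
  next
    case False
    then have "m * (x2 - x1) = y2 - y1" by (simp add: m_def)
    then show ?thesis unfolding c_def by Groebner_Basis.algebra
  qed
  have add: "ec_add f (Affine x1 y1) (Affine x2 y2) = Affine x3 (- (c + m * x3))"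
  proof -
    have "ec_add f (Affine x1 y1) (Affine x2 y2) = Affine x3 (m * (x1 - x3) - y1)"
      using assms(3) by (simp add: Let_def coeff_f m_def x3_def)
    then show ?thesis by (simp add: c_def algebra_simps)
  qed
  have E1: "f2 - m ^ 2 = - f3 * (x1 + x2 + x3)"
    using f3_nz by (simp add: x3_def field_simps)
  have a1: "(c + m * x1) ^ 2 = f0 + f1 * x1 + f2 * x1 ^ 2 + f3 * x1 ^ 3"
    using assms(1) by (simp add: y1 poly_f)
  have a2: "(c + m * x2) ^ 2 = f0 + f1 * x2 + f2 * x2 ^ 2 + f3 * x2 ^ 3"
    using assms(2) by (simp add: y2 poly_f)
  have E2: "f1 - 2 * m * c = f3 * (x1 * x2 + x1 * x3 + x2 * x3)"
  proof (cases "x1 = x2")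
    case True
    then have "y1 \<noteq> 0" using yy assms(3) by auto
    then have "m * (2 * y1) = poly (pderiv f) x1" using True by (simp add: m_def)
    then have "2 * m * (c + m * x1) = f1 + 2 * f2 * x1 + 3 * f3 * x1 ^ 2"
      by (simp add: y1[symmetric] poly_pderiv_f mult_ac)
    with E1 show ?thesis unfolding True by Groebner_Basis.algebra
  next
    case False
    have "(x1 - x2) * (f1 - 2 * m * c) = (x1 - x2) * (f3 * (x1 * x2 + x1 * x3 + x2 * x3))"
      using E1 a1 a2 by Groebner_Basis.algebra
    with False show ?thesis by simp
  qed
  have E3: "f0 - c ^ 2 = - f3 * (x1 * x2 * x3)"
    using E1 E2 a1 by Groebner_Basis.algebra
  show ?thesis
    by (rule that[OF add _ y1 y2]) (use E1 E2 E3 in \<open>simp add: line_meets_def\<close>)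
qed

text \<open>The chord, or the tangent at a repeated point, is unique; hence any line with the right
  contacts computes the sum.\<close>

lemma add_affineI:
  assumes l: "line_meets m c x1 x2 x3" and y: "y1 = c + m * x1" "y2 = c + m * x2"
    and n: "\<not> (x1 = x2 \<and> y1 = - y2)"
  shows "ec_add f (Affine x1 y1) (Affine x2 y2) = Affine x3 (- (c + m * x3))"
proof -
  have "y1 ^ 2 = poly f x1" "y2 ^ 2 = poly f x2"
    using line_meets_poly[OF l, of x1] line_meets_poly[OF l, of x2] by (simp_all add: y)
  then obtain m' c' x3' where 1: "ec_add f (Affine x1 y1) (Affine x2 y2) = Affine x3' (- (c' + m' * x3'))"
    and l': "line_meets m' c' x1 x2 x3'" and y': "y1 = c' + m' * x1" "y2 = c' + m' * x2"
    using n by (rule add_affineE)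
  have "m = m'"
  proof (cases "x1 = x2")
    case True
    then have "y1 = y2" using y by simp
    then have "y1 \<noteq> 0" using True n by auto
    moreover have "m * y1 = m' * y1"
      using line_meets_double[of m c x1 x3] line_meets_double[of m' c' x1 x3'] l l' True y y' by auto
    ultimately show ?thesis by simp
  next
    case False
    have "(x1 - x2) * m = (x1 - x2) * m'" using y y' by Groebner_Basis.algebra
    with False show ?thesis by simp
  qed
  moreover from this have "c = c'" using y y' by simp
  moreover from calculation have "f3 * x3 = f3 * x3'"
    using line_meets_eqs(1)[OF l] line_meets_eqs(1)[OF l'] by (auto simp: distrib_left)
  ultimately show ?thesis using 1 f3_nz by simp
qed

lemma add_closed:
  assumes "P \<in> ec_points f" "Q \<in> ec_points f"
  shows "ec_add f P Q \<in> ec_points f"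
proof (cases "P = Infinity \<or> Q = Infinity \<or> Q = ec_neg P")
  case True
  then show ?thesis using assms by (cases P) auto
next
  case False
  then obtain x1 y1 x2 y2 where PQ: "P = Affine x1 y1" "Q = Affine x2 y2"
    by (cases P; cases Q) auto
  then have n: "\<not> (x1 = x2 \<and> y1 = - y2)" using False by auto
  have on: "y1 ^ 2 = poly f x1" "y2 ^ 2 = poly f x2" using assms PQ by auto
  obtain m c x3 where "ec_add f P Q = Affine x3 (- (c + m * x3))"
    and "line_meets m c x1 x2 x3"
    unfolding PQ by (rule add_affineE[OF on n])
  then show ?thesis using line_meets_poly[of m c x1 x2 x3 x3] by (simp flip: minus_add_distrib)
qed

lemma add_commute:
  assumes "P \<in> ec_points f" "Q \<in> ec_points f"
  shows "ec_add f P Q = ec_add f Q P"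
proof (cases "P = Infinity \<or> Q = Infinity \<or> Q = ec_neg P")
  case True
  then show ?thesis by (cases P) auto
next
  case False
  then obtain x1 y1 x2 y2 where PQ: "P = Affine x1 y1" "Q = Affine x2 y2"
    by (cases P; cases Q) auto
  then have n: "\<not> (x1 = x2 \<and> y1 = - y2)" using False by auto
  have on: "y1 ^ 2 = poly f x1" "y2 ^ 2 = poly f x2" using assms PQ by auto
  obtain m c x3 where "ec_add f P Q = Affine x3 (- (c + m * x3))"
    "line_meets m c x1 x2 x3" "y1 = c + m * x1" "y2 = c + m * x2"
    unfolding PQ by (rule add_affineE[OF on n])
  moreover from this have "ec_add f Q P = Affine x3 (- (c + m * x3))"
    unfolding PQ by (intro add_affineI[OF line_meets_perm(1)]) (use n in auto)
  ultimately show ?thesis by simp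
qed

text \<open>Reflecting the line through \<open>P\<close>, \<open>Q\<close>, \<open>-(P + Q)\<close>
  in the x-axis gives a line through \<open>-P\<close>, \<open>-Q\<close>,
  \<open>P + Q\<close>.\<close>

lemma neg_add_cancel:
  assumes "P \<in> ec_points f" "Q \<in> ec_points f"
  shows "ec_add f (ec_neg P) (ec_add f P Q) = Q"
proof (cases "P = Infinity \<or> Q = Infinity \<or> Q = ec_neg P")
  case True
  then show ?thesis by (cases P) auto
next
  case False
  then obtain x1 y1 x2 y2 where PQ: "P = Affine x1 y1" "Q = Affine x2 y2"
    by (cases P; cases Q) auto
  then have n: "\<not> (x1 = x2 \<and> y1 = - y2)" using False by auto
  have on: "y1 ^ 2 = poly f x1" "y2 ^ 2 = poly f x2" using assms PQ by auto
  obtain m c x3 where A: "ec_add f P Q = Affine x3 (- (c + m * x3))"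
    and l: "line_meets m c x1 x2 x3" and y: "y1 = c + m * x1" "y2 = c + m * x2"
    unfolding PQ by (rule add_affineE[OF on n])
  \<comment> \<open>Otherwise \<open>P + Q = P\<close>: the line would touch the curve at
    \<open>P\<close> with \<open>y1 = 0\<close>, making \<open>x1\<close> a common root of
    \<open>f\<close> and its derivative.\<close>
  have n': "\<not> (x1 = x3 \<and> - y1 = c + m * x3)"
  proof
    assume *: "x1 = x3 \<and> - y1 = c + m * x3"
    then have "y1 = - y1" using y by metis
    then have "y1 = 0" by (simp add: eq_uminus_iff_zero)
    moreover have "poly (pderiv f) x1 = 2 * m * y1"
      using * line_meets_double[of m c x1 x2] l by (simp add: line_meets_perm(2) y)
    ultimately show False using smooth[of x1] on by simp
  qed
  then have "ec_add f (Affine x1 (- y1)) (Affine x3 (- (c + m * x3))) = Affine x2 (- (- c + - m * x2))"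
    using l y by (intro add_affineI) (auto simp: line_meets_uminus dest: line_meets_perm(2))
  then show ?thesis using A y by (simp add: PQ)
qed

lemma add_left_cancel:
  assumes "P \<in> ec_points f" "Q \<in> ec_points f" "R \<in> ec_points f" "ec_add f P Q = ec_add f P R"
  shows "Q = R"
  using assms by (metis neg_add_cancel)

text \<open>
  The parabola through \<open>P\<^sub>1, P\<^sub>2, P\<^sub>3\<close> meets the curve in a fourth point, which is
  \<open>- ((P\<^sub>1 + P\<^sub>2) + P\<^sub>3)\<close>: if \<open>l\<^sub>1\<close>, \<open>l\<^sub>2\<close> are the two lines used to form this sum,
  then it is \<open>y = l\<^sub>1 + k (X - x\<^sub>1) (X - x\<^sub>2) = l\<^sub>2 + k (X - x\<^sub>3) (X - x\<^sub>4)\<close>. Hence \<open>f - y\<^sup>2 = - k\<^sup>2 (X - x\<^sub>1) (X - x\<^sub>2) (X - x\<^sub>3) (X - x\<^sub>4)\<close>.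
\<close>

lemma parabola:
  assumes l1: "line_meets m1 c1 x1 x2 s" and l2: "line_meets m2 c2 s x3 x4"
    and s: "c1 + m1 * s = - (c2 + m2 * s)" and m: "m1 + m2 \<noteq> 0"
  obtains k r1 r0 where "k \<noteq> 0"
    "\<And>x. r0 + r1 * x + k * x ^ 2 = c1 + m1 * x + k * ((x - x1) * (x - x2))"
    "\<And>x. r0 + r1 * x + k * x ^ 2 = c2 + m2 * x + k * ((x - x3) * (x - x4))"
    "f3 - 2 * k * r1 = k ^ 2 * (x1 + x2 + x3 + x4)"
    "x1 = x2 \<or> x1 = x3 \<Longrightarrow> poly (pderiv f) x1 = 2 * (r0 + r1 * x1 + k * x1 ^ 2) * (r1 + 2 * k * x1)"
proof -
  define k where "k = f3 / (m1 + m2)"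
  have k: "k * (m1 + m2) = f3" using m by (simp add: k_def)
  define r1 where "r1 = m1 - k * (x1 + x2)"
  define r0 where "r0 = c1 + k * x1 * x2"
  have 1: "m2 - m1 = k * (x3 + x4 - x1 - x2)"
  proof -
    have "(m1 + m2) * (m2 - m1) = (m1 + m2) * (k * (x3 + x4 - x1 - x2))"
      using line_meets_eqs(1)[OF l1] line_meets_eqs(1)[OF l2] k by Groebner_Basis.algebra
    with m show ?thesis by simp
  qed
  have 2: "c2 - c1 = k * (x1 * x2 - x3 * x4)"
  proof -
    have "(m1 + m2) * (c2 - c1) = (m1 + m2) * (k * (x1 * x2 - x3 * x4))"
      using line_meets_eqs[OF l1] line_meets_eqs[OF l2] k s 1 by Groebner_Basis.algebra
    with m show ?thesis by simp
  qed
  have 3: "r0 + r1 * x + k * x ^ 2 = c1 + m1 * x + k * ((x - x1) * (x - x2))" for x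
    by (simp add: r0_def r1_def algebra_simps power2_eq_square)
  have 4: "r0 + r1 * x + k * x ^ 2 = c2 + m2 * x + k * ((x - x3) * (x - x4))" for x
    unfolding 3 using 1 2 by Groebner_Basis.algebra
  have 5: "f3 * (x - s) = k * ((c1 + m1 * x) + (c2 + m2 * x))" for x
    using s k by Groebner_Basis.algebra
  have "poly (pderiv f) x1 - 2 * (r0 + r1 * x1 + k * x1 ^ 2) * (r1 + 2 * k * x1)
      = (x1 - x2) * (f3 * (x1 - s) - 2 * k * (c1 + m1 * x1))"
    using line_meets_eqs[OF l1] unfolding r0_def r1_def poly_pderiv_f by Groebner_Basis.algebra
  moreover have "f3 * (x1 - s) - 2 * k * (c1 + m1 * x1) = 0" if "x1 = x3"
    using 3[of x1] 4[of x1] 5[of x1] that by (simp add: algebra_simps)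
  ultimately have 6: "poly (pderiv f) x1 = 2 * (r0 + r1 * x1 + k * x1 ^ 2) * (r1 + 2 * k * x1)"
    if "x1 = x2 \<or> x1 = x3"
    using that by auto
  have 7: "f3 - 2 * k * r1 = k ^ 2 * (x1 + x2 + x3 + x4)"
    using 1 k unfolding r1_def by Groebner_Basis.algebra
  have "k \<noteq> 0" using k f3_nz by auto
  from that[OF this 3 4 7 6] show ?thesis .
qed

text \<open>Each bracketing produces a parabola through the three points. The two parabolas agree,
  with tangency as the third condition when \<open>x1 = x2\<close>, and so have the same fourth
  intersection.\<close>

lemma add_assoc_generic:
  assumes P: "Affine x1 y1 \<in> ec_points f" and Q: "Affine x2 y2 \<in> ec_points f"
    and G: "Affine x3 y3 \<in> ec_points f"
    and PQ: "ec_add f (Affine x1 y1) (Affine x2 y2) = Affine s z" and QG: "ec_add f (Affine x2 y2) (Affine x3 y3) = Affine t u"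
    and ne: "x3 \<noteq> x1" "x3 \<noteq> x2" "x3 \<noteq> s" "x1 \<noteq> t"
  shows "ec_add f (Affine s z) (Affine x3 y3) = ec_add f (Affine x1 y1) (Affine t u)"
proof -
  have on: "y1 ^ 2 = poly f x1" "y2 ^ 2 = poly f x2" "y3 ^ 2 = poly f x3"
    using P Q G by auto
  have onS: "z ^ 2 = poly f s" and onT: "u ^ 2 = poly f t"
    using add_closed[OF P Q, unfolded PQ] add_closed[OF Q G, unfolded QG] by simp_all
  have n12: "\<not> (x1 = x2 \<and> y1 = - y2)" using PQ by auto
  obtain m1 c1 s' where 1: "ec_add f (Affine x1 y1) (Affine x2 y2) = Affine s' (- (c1 + m1 * s'))"
    and l1': "line_meets m1 c1 x1 x2 s'" and p1: "y1 = c1 + m1 * x1" "y2 = c1 + m1 * x2"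
    by (rule add_affineE[OF on(1,2) n12])
  have l1: "line_meets m1 c1 x1 x2 s" and z: "z = - (c1 + m1 * s)" using l1' 1 PQ by auto
  have "\<not> (s = x3 \<and> z = - y3)" using ne by auto
  then obtain m2 c2 x4 where 2: "ec_add f (Affine s z) (Affine x3 y3) = Affine x4 (- (c2 + m2 * x4))"
    and l2: "line_meets m2 c2 s x3 x4" and p2: "z = c2 + m2 * s" "y3 = c2 + m2 * x3"
    by (rule add_affineE[OF onS on(3)])
  have "\<not> (x2 = x3 \<and> y2 = - y3)" using ne by auto
  then obtain n1 d1 t' where 3: "ec_add f (Affine x2 y2) (Affine x3 y3) = Affine t' (- (d1 + n1 * t'))"
    and k1': "line_meets n1 d1 x2 x3 t'" and q1: "y2 = d1 + n1 * x2" "y3 = d1 + n1 * x3"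
    by (rule add_affineE[OF on(2,3)])
  have k1: "line_meets n1 d1 x2 x3 t" and u: "u = - (d1 + n1 * t)" using k1' 3 QG by auto
  have "\<not> (x1 = t \<and> y1 = - u)" using ne by auto
  then obtain n2 d2 x4' where 4: "ec_add f (Affine x1 y1) (Affine t u) = Affine x4' (- (d2 + n2 * x4'))"
    and k2': "line_meets n2 d2 x1 t x4'" and q2: "y1 = d2 + n2 * x1" "u = d2 + n2 * t"
    by (rule add_affineE[OF on(1) onT])
  have k2: "line_meets n2 d2 t x1 x4'" using k2' by (rule line_meets_perm)
  have s: "c1 + m1 * s = - (c2 + m2 * s)" using z p2 by simp
  have t: "d1 + n1 * t = - (d2 + n2 * t)" using u q2 by simp
  \<comment> \<open>If the slopes cancelled, the second line would be the reflection of the first,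
    and \<open>x3\<close> would be one of \<open>x1\<close>, \<open>x2\<close>,
    \<open>s\<close>.\<close>
  have m: "m1 + m2 \<noteq> 0"
  proof
    assume "m1 + m2 = 0"
    then have "(c1 + m1 * x3) ^ 2 = y3 ^ 2"
      using s p2(2) by Groebner_Basis.algebra
    then show False
      using line_meets_poly[OF l1, of x3] on(3) ne f3_nz by simp
  qed
  obtain k r1 r0 where k: "k \<noteq> 0"
    and r: "\<And>x. r0 + r1 * x + k * x ^ 2 = c1 + m1 * x + k * ((x - x1) * (x - x2))"
    "\<And>x. r0 + r1 * x + k * x ^ 2 = c2 + m2 * x + k * ((x - x3) * (x - x4))"
    and rs: "f3 - 2 * k * r1 = k ^ 2 * (x1 + x2 + x3 + x4)"
    and rd: "x1 = x2 \<or> x1 = x3 \<Longrightarrow> poly (pderiv f) x1 = 2 * (r0 + r1 * x1 + k * x1 ^ 2) * (r1 + 2 * k * x1)"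
    by (rule parabola[OF l1 l2 s m], rule that)
  \<comment> \<open>For the other bracketing the same argument leaves only \<open>x1 = x2\<close>,
    and the reflected line then gives \<open>y1 = - y2\<close>.\<close>
  have n: "n1 + n2 \<noteq> 0"
  proof
    assume *: "n1 + n2 = 0"
    then have e: "(d1 + n1 * x1) ^ 2 = y1 ^ 2"
      using t q2(1) by Groebner_Basis.algebra
    then have "x1 = x2"
      using line_meets_poly[OF k1, of x1] on(1) ne f3_nz by auto
    moreover have "n2 = - n1" using * by (simp add: eq_neg_iff_add_eq_0 add.commute)
    moreover from this have "d2 = - d1" using t by (simp add: minus_equation_iff[of d1])
    ultimately have "x1 = x2 \<and> y1 = - y2" using q1(1) q2(1) by simp
    then show False using n12 by simp
  qed
  obtain k' r1' r0' where k': "k' \<noteq> 0"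
    and r': "\<And>x. r0' + r1' * x + k' * x ^ 2 = d1 + n1 * x + k' * ((x - x2) * (x - x3))"
    "\<And>x. r0' + r1' * x + k' * x ^ 2 = d2 + n2 * x + k' * ((x - x1) * (x - x4'))"
    and rs': "f3 - 2 * k' * r1' = k' ^ 2 * (x2 + x3 + x1 + x4')"
    and rd': "x2 = x3 \<or> x2 = x1 \<Longrightarrow> poly (pderiv f) x2 = 2 * (r0' + r1' * x2 + k' * x2 ^ 2) * (r1' + 2 * k' * x2)"
    by (rule parabola[OF k1 k2 t n], rule that)
  have v1: "r0 + r1 * x1 + k * x1 ^ 2 = y1" "r0' + r1' * x1 + k' * x1 ^ 2 = y1"
    using p1 q2 by (simp_all add: r(1) r'(2))
  have v2: "r0 + r1 * x2 + k * x2 ^ 2 = y2" "r0' + r1' * x2 + k' * x2 ^ 2 = y2"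
    using p1 q1 by (simp_all add: r(1) r'(1))
  have v3: "r0 + r1 * x3 + k * x3 ^ 2 = y3" "r0' + r1' * x3 + k' * x3 ^ 2 = y3"
    using p2 q1 by (simp_all add: r(2) r'(1))
  have i13: "r1 - r1' + (k - k') * (x1 + x3) = 0"
  proof -
    have "(x1 - x3) * (r1 - r1' + (k - k') * (x1 + x3)) =
        ((r0 + r1 * x1 + k * x1 ^ 2) - (r0' + r1' * x1 + k' * x1 ^ 2)) -
        ((r0 + r1 * x3 + k * x3 ^ 2) - (r0' + r1' * x3 + k' * x3 ^ 2))"
      by Groebner_Basis.algebra
    also have "\<dots> = 0"
      unfolding v1 v3 by simp
    finally have "(x1 - x3) * (r1 - r1' + (k - k') * (x1 + x3)) = 0" .
    with ne show ?thesis by simp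
  qed
  \<comment> \<open>The difference of the parabolas is quadratic and vanishes at \<open>x1\<close>,
    \<open>x3\<close> and \<open>x2\<close>, or doubly at \<open>x1\<close> when
    \<open>x1 = x2\<close>.\<close>
  have kk: "k = k'"
  proof (cases "x1 = x2")
    case True
    then have "y1 \<noteq> 0" using n12 v1 v2 by auto
    moreover have "y1 = y2" using v1(1) v2(1) True by simp
    moreover have "poly (pderiv f) x1 = 2 * y1 * (r1 + 2 * k * x1)"
      using rd[OF disjI1[OF True]] unfolding v1(1) .
    moreover have "poly (pderiv f) x2 = 2 * y2 * (r1' + 2 * k' * x2)"
      using rd'[OF disjI2[OF True[symmetric]]] unfolding v2(2) .
    ultimately have "r1 + 2 * k * x1 = r1' + 2 * k' * x1" using True by auto
    then have "(k - k') * (x1 - x3) = 0" using i13 by Groebner_Basis.algebra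
    then show ?thesis using ne by simp
  next
    case False
    have "(x1 - x2) * (r1 - r1' + (k - k') * (x1 + x2)) =
        ((r0 + r1 * x1 + k * x1 ^ 2) - (r0' + r1' * x1 + k' * x1 ^ 2)) -
        ((r0 + r1 * x2 + k * x2 ^ 2) - (r0' + r1' * x2 + k' * x2 ^ 2))"
      by Groebner_Basis.algebra
    also have "\<dots> = 0"
      unfolding v1 v2 by simp
    finally have "r1 - r1' + (k - k') * (x1 + x2) = 0" using False by simp
    then have "(k - k') * (x2 - x3) = 0" using i13 by Groebner_Basis.algebra
    then show ?thesis using ne by simp
  qed
  then have r1: "r1 = r1'" using i13 by simp
  then have r0: "r0 = r0'" using kk v1 by (metis add_right_cancel)
  \<comment> \<open>The sum of the four roots is determined by the parabola, hence so is the fourth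
    root.\<close>
  have "k ^ 2 * x4 = k ^ 2 * x4'" using rs rs' kk r1 by Groebner_Basis.algebra
  then have x4: "x4 = x4'" using k by simp
  have "c2 + m2 * x4 = d2 + n2 * x4"
    using r(2)[of x4] r'(2)[of x4] kk r1 r0 x4 by simp
  then show ?thesis using 2 4 x4 by simp
qed

lemma x_coord_neq:
  assumes "Affine x y \<in> ec_points f" "Affine x' y' \<in> ec_points f"
    "Affine x y \<noteq> Affine x' y'" "Affine x y \<noteq> ec_neg (Affine x' y')"
  shows "x \<noteq> x'"
proof
  assume "x = x'"
  then have "y ^ 2 = y' ^ 2" using assms(1,2) by simp
  then show False using assms(3,4) \<open>x = x'\<close> by (auto simp: power2_eq_iff)
qed

lemma add_generic_neq:
  assumes P: "P \<in> ec_points f" and G: "G \<in> ec_points f" and W: "W \<in> ec_points f"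
    and ne: "G \<noteq> ec_add f (ec_neg P) W"
  shows "ec_add f P G \<noteq> W"
  using neg_add_cancel[OF P G] ne by auto

lemma add_eq_Infinity:
  assumes "P \<in> ec_points f" "Q \<in> ec_points f" "ec_add f P Q = Infinity"
  shows "Q = ec_neg P"
  using neg_add_cancel[OF assms(1,2)] assms(3) by simp

lemma add_assoc_special:
  assumes P: "P \<in> ec_points f" and Q: "Q \<in> ec_points f"
  shows "\<exists>B. finite B \<and> (\<forall>G\<in>ec_points f - B. ec_add f (ec_add f P Q) G = ec_add f P (ec_add f Q G))"
proof (cases "P = Infinity \<or> Q = Infinity \<or> Q = ec_neg P")
  case True
  then have "ec_add f (ec_add f P Q) G = ec_add f P (ec_add f Q G)" if "G \<in> ec_points f" for G
    using neg_add_cancel[of "ec_neg P" G] that P by (cases P) auto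
  then show ?thesis by (intro exI[of _ "{}"]) auto
next
  case False
  then obtain x1 y1 x2 y2 where PQ: "P = Affine x1 y1" "Q = Affine x2 y2"
    by (cases P; cases Q) auto
  let ?S = "ec_add f P Q"
  have S: "?S \<in> ec_points f" using P Q by (rule add_closed)
  \<comment> \<open>Plus and minus \<open>P\<close>, \<open>Q\<close>, \<open>P + Q\<close> keep
    \<open>x3\<close> away from \<open>x1\<close>, \<open>x2\<close>, \<open>s\<close>. The points
    \<open>-Q + P\<close> and \<open>-Q - P\<close> keep \<open>Q + G\<close> away from plus and
    minus \<open>P\<close>, that is, \<open>t\<close> away from \<open>x1\<close>.\<close>
  let ?B = "{Infinity, P, ec_neg P, Q, ec_neg Q, ?S, ec_neg ?S,
    ec_add f (ec_neg Q) P, ec_add f (ec_neg Q) (ec_neg P)}"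
  have "ec_add f ?S G = ec_add f P (ec_add f Q G)" if G: "G \<in> ec_points f" "G \<notin> ?B" for G
  proof -
    have QG: "ec_add f Q G \<noteq> P" "ec_add f Q G \<noteq> ec_neg P" "ec_add f Q G \<noteq> Infinity"
      using add_generic_neq[of Q G] add_eq_Infinity[of Q G] G P Q by auto
    then obtain t u where T: "ec_add f Q G = Affine t u" by (cases "ec_add f Q G") auto
    have "?S \<noteq> Infinity" using add_eq_Infinity[of P Q] P Q False by auto
    then obtain s z where s: "?S = Affine s z" by (cases ?S) auto
    obtain x3 y3 where x3: "G = Affine x3 y3" using G by (cases G) auto
    have onT: "Affine t u \<in> ec_points f" using add_closed[of Q G] Q G T by simp
    have "x3 \<noteq> x1" by (rule x_coord_neq[of x3 y3 x1 y1]) (use G P in \<open>simp_all add: PQ x3\<close>)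
    moreover have "x3 \<noteq> x2" by (rule x_coord_neq[of x3 y3 x2 y2]) (use G Q in \<open>simp_all add: PQ x3\<close>)
    moreover have "x3 \<noteq> s" by (rule x_coord_neq[of x3 y3 s z]) (use G S in \<open>simp_all add: s x3\<close>)
    moreover have "t \<noteq> x1"
      by (rule x_coord_neq[of t u x1 y1]) (use onT P QG[unfolded T] in \<open>simp_all add: PQ\<close>)
    ultimately have "ec_add f (Affine s z) (Affine x3 y3) = ec_add f (Affine x1 y1) (Affine t u)"
      using P Q G s T by (intro add_assoc_generic[of x1 y1 x2 y2]) (auto simp: PQ x3 simp del: ec_add.simps)
    then show ?thesis unfolding s T unfolding x3 PQ .
  qed
  then show ?thesis by (intro exI[of _ ?B]) auto
qed

text \<open>
  Both sides of the associative law are compared after adding a further point \<open>G\<close> that avoids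
  the degenerate cases of the chord construction.
\<close>

lemma add_assoc_if_infinite:
  assumes P: "P \<in> ec_points f" and Q: "Q \<in> ec_points f" and R: "R \<in> ec_points f"
    and inf: "infinite (ec_points f)"
  shows "ec_add f (ec_add f P Q) R = ec_add f P (ec_add f Q R)"
proof -
  have PQ: "ec_add f P Q \<in> ec_points f" and QR: "ec_add f Q R \<in> ec_points f"
    using P Q R by (simp_all add: add_closed)
  obtain B1 where B1: "finite B1"
    "\<And>G. G \<in> ec_points f - B1 \<Longrightarrow> ec_add f (ec_add f (ec_add f P Q) R) G = ec_add f (ec_add f P Q) (ec_add f R G)"
    using add_assoc_special[OF PQ R] by blast
  obtain B2 where B2: "finite B2"
    "\<And>G. G \<in> ec_points f - B2 \<Longrightarrow> ec_add f (ec_add f P Q) G = ec_add f P (ec_add f Q G)"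
    using add_assoc_special[OF P Q] by blast
  obtain B3 where B3: "finite B3"
    "\<And>G. G \<in> ec_points f - B3 \<Longrightarrow> ec_add f (ec_add f Q R) G = ec_add f Q (ec_add f R G)"
    using add_assoc_special[OF Q R] by blast
  obtain B4 where B4: "finite B4"
    "\<And>G. G \<in> ec_points f - B4 \<Longrightarrow> ec_add f (ec_add f P (ec_add f Q R)) G = ec_add f P (ec_add f (ec_add f Q R) G)"
    using add_assoc_special[OF P QR] by blast
  \<comment> \<open>\<open>B2\<close> is the exceptional set for the triple
    \<open>P, Q, R + G\<close>, so it is translated by \<open>- R\<close> to become a condition on
    \<open>G\<close>.\<close>
  have "finite (B1 \<union> B3 \<union> B4 \<union> ec_add f (ec_neg R) ` (B2 \<inter> ec_points f))"
    using B1(1) B2(1) B3(1) B4(1) by auto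
  then have "infinite (ec_points f - (B1 \<union> B3 \<union> B4 \<union> ec_add f (ec_neg R) ` (B2 \<inter> ec_points f)))"
    using inf by (rule Diff_infinite_finite)
  then have "ec_points f - (B1 \<union> B3 \<union> B4 \<union> ec_add f (ec_neg R) ` (B2 \<inter> ec_points f)) \<noteq> {}"
    by (metis finite.emptyI)
  then obtain G where "G \<in> ec_points f - (B1 \<union> B3 \<union> B4 \<union> ec_add f (ec_neg R) ` (B2 \<inter> ec_points f))"
    by blast
  then have G: "G \<in> ec_points f"
    "G \<notin> B1" "G \<notin> B3" "G \<notin> B4" "G \<notin> ec_add f (ec_neg R) ` (B2 \<inter> ec_points f)"
    by simp_all
  have RG: "ec_add f R G \<in> ec_points f" using R G by (simp add: add_closed)
  have "ec_add f R G \<notin> B2"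
    using neg_add_cancel[OF R G(1)] G(5) RG by force
  \<comment> \<open>\<open>((P + Q) + R) + G = (P + Q) + (R + G) = P + (Q + (R + G)) = P + ((Q + R)
    + G) = (P + (Q + R)) + G\<close>.\<close>
  then have "ec_add f (ec_add f (ec_add f P Q) R) G = ec_add f (ec_add f P (ec_add f Q R)) G"
    using B1(2)[of G] B2(2)[of "ec_add f R G"] B3(2)[of G] B4(2)[of G] G RG by simp
  then have "ec_add f G (ec_add f (ec_add f P Q) R) = ec_add f G (ec_add f P (ec_add f Q R))"
    using G P Q R by (metis add_commute add_closed)
  then show ?thesis
    using G P Q R by (metis add_left_cancel add_closed)
qed

end

section \<open>Cubics with three rational roots, and associativity by base change\<close>

fun ec_map :: "('a \<Rightarrow> 'b) \<Rightarrow> 'a ec_point \<Rightarrow> 'b ec_point" where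
  "ec_map h Infinity = Infinity"
| "ec_map h (Affine x y) = Affine (h x) (h y)"

locale split_cubic =
  fixes b d e :: "'a::field_char_0" and f
  assumes nz: "b \<noteq> 0" "d \<noteq> 0" "e \<noteq> 0" and distinct: "b \<noteq> d" "b \<noteq> e" "d \<noteq> e"
  defines "f \<equiv> [:1, b:] * [:1, d:] * [:1, e:]"
begin

lemma f_coeffs: "f = [:1, b + d + e, b * d + b * e + d * e, b * d * e:]"
  by (simp add: f_def algebra_simps)

lemma poly_f_split: "poly f x = (1 + b * x) * (1 + d * x) * (1 + e * x)"
  by (simp add: f_def algebra_simps)

lemma smooth_cubic: "smooth_cubic f 1 (b + d + e) (b * d + b * e + d * e) (b * d * e)"
proof
  fix x
  assume "poly f x = 0"
  then consider "1 + b * x = 0" | "1 + d * x = 0" | "1 + e * x = 0"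
    by (auto simp: poly_f_split)
  moreover have df: "poly (pderiv f) x = b * ((1 + d * x) * (1 + e * x)) +
      d * ((1 + b * x) * (1 + e * x)) + e * ((1 + b * x) * (1 + d * x))"
    by (simp add: f_def pderiv_mult pderiv_pCons algebra_simps)
  moreover have "1 + c' * x \<noteq> 0" if "c \<noteq> c'" "1 + c * x = 0" for c c'
  proof
    assume "1 + c' * x = 0"
    with that(2) have "(c - c') * x = 0" "x \<noteq> 0" by (auto simp: left_diff_distrib add_eq_0_iff)
    then show False using that by auto
  qed
  note ne = this
  ultimately show "poly (pderiv f) x \<noteq> 0"
    using nz distinct by cases (auto simp: ne dest: ne)
qed (use nz in \<open>simp_all add: f_coeffs\<close>)

sublocale smooth_cubic f 1 "b + d + e" "b * d + b * e + d * e" "b * d * e"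
  by (rule smooth_cubic)

text \<open>A common divisor \<open>p\<close> of \<open>f\<close> and its derivative does not vanish
  at the roots of \<open>f\<close>, so the linear factors of \<open>f\<close> can be removed from
  \<open>p dvd f\<close> one at a time, leaving \<open>p dvd 1\<close>.\<close>

lemma elliptic_cubic_f: "elliptic_cubic f"
proof -
  have "degree f = 3" using nz by (simp add: f_coeffs)
  moreover have "coprime f (pderiv f)"
  proof (rule ccontr)
    assume "\<not> coprime f (pderiv f)"
    then obtain p where p: "p dvd f" "p dvd pderiv f" "\<not> is_unit p"
      by (blast elim: not_coprimeE)
    have root: "poly p x \<noteq> 0" if "poly f x = 0" for x
      using p(2) smooth[OF that] by (auto simp: dvd_def)
    have cancel: "p dvd q" if pq: "p dvd q * [:1, c:]" and c: "c \<noteq> 0" "poly f (- 1 / c) = 0" for q c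
    proof -
      obtain r where r: "q * [:1, c:] = p * r" using pq by (rule dvdE)
      have "poly (p * r) (- 1 / c) = 0" using c(1) by (simp flip: r)
      then have "poly r (- 1 / c) = 0" using root[OF c(2)] by simp
      then have "[:1 / c, 1:] dvd r" by (simp add: poly_eq_0_iff_dvd)
      then obtain r' where "r = [:1 / c, 1:] * r'" by auto
      moreover have "[:1, c:] = smult c [:1 / c, 1:]" using c(1) by simp
      ultimately have "[:1 / c, 1:] * smult c q = [:1 / c, 1:] * (p * r')"
        using r by (metis mult.commute mult.left_commute mult_smult_left)
      then have "smult c q = p * r'" by (metis mult_left_cancel one_neq_zero pCons_eq_0_iff)
      then have "q = p * smult (1 / c) r'"
        using c(1) by (metis divide_self_if dvd_div_mult_self mult_smult_right smult_1_left smult_smult times_divide_eq_left mult_1)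
      then show ?thesis by (metis dvd_triv_left)
    qed
    have roots: "poly f (- 1 / b) = 0" "poly f (- 1 / d) = 0" "poly f (- 1 / e) = 0"
      using nz by (simp_all add: poly_f_split)
    have "p dvd [:1, b:] * [:1, d:]"
      by (rule cancel[OF p(1)[unfolded f_def] nz(3) roots(3)])
    from cancel[OF this nz(2) roots(2)] have "p dvd 1 * [:1, b:]"
      by (simp only: mult_1)
    from cancel[OF this nz(1) roots(1)] have "p dvd 1" .
    then show False using p(3) by simp
  qed
  ultimately show ?thesis by (simp add: elliptic_cubic_def)
qed

text \<open>The curve may have finitely many points over the given field. Over the algebraic closure
  every abscissa carries a point, and the embedding is injective and commutes with
  \<open>ec_add\<close>.\<close>

lemma add_assoc:
  assumes P: "P \<in> ec_points f" and Q: "Q \<in> ec_points f" and R: "R \<in> ec_points f"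
  shows "ec_add f (ec_add f P Q) R = ec_add f P (ec_add f Q R)"
proof -
  interpret L: split_cubic "to_ac b" "to_ac d" "to_ac e" "[:1, to_ac b:] * [:1, to_ac d:] * [:1, to_ac e:]"
    by unfold_locales (use nz distinct in simp_all)
  define g where "g = [:1, to_ac b:] * [:1, to_ac d:] * [:1, to_ac e:]"
  have poly: "poly g (to_ac x) = to_ac (poly f x)" for x
    by (simp add: g_def poly_f_split mult.commute del: mult_pCons_left mult_pCons_right)
  have g_coeffs: "g = [:1, to_ac (b + d + e), to_ac (b * d + b * e + d * e), to_ac (b * d * e):]"
    by (simp add: g_def algebra_simps)
  have pderiv: "poly (pderiv g) (to_ac x) = to_ac (poly (pderiv f) x)" for x
    by (simp add: g_coeffs f_coeffs pderiv_pCons)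
  have coeffs: "coeff g 2 = to_ac (coeff f 2)" "coeff g 3 = to_ac (coeff f 3)"
    by (simp_all add: g_coeffs f_coeffs numeral_eq_Suc)
  have neg: "to_ac x = - to_ac y \<longleftrightarrow> x = - y" for x y :: 'a
    by (metis to_ac_eq_iff to_ac_minus)
  have map_add: "ec_map to_ac (ec_add f A B) = ec_add g (ec_map to_ac A) (ec_map to_ac B)" for A B
    by (cases A; cases B) (simp_all add: Let_def pderiv coeffs neg)
  have closed: "ec_map to_ac A \<in> ec_points g" if "A \<in> ec_points f" for A
    using that by (cases A) (auto simp: poly simp flip: to_ac_power)
  have inj: "A = B" if "ec_map to_ac A = ec_map to_ac B" for A B
    using that by (cases A; cases B) auto
  have "infinite (ec_points g)"
  proof -
    have "\<exists>y. y ^ 2 = poly g x" for x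
      using nth_root_exists[of 2] by auto
    then obtain y where y: "y x ^ 2 = poly g x" for x by metis
    have "infinite (range (\<lambda>x. Affine x (y x)))"
      using infinite_UNIV_char_0 by (subst finite_image_iff) (auto simp: inj_on_def)
    then show ?thesis
      by (rule infinite_super[rotated]) (use y in auto)
  qed
  then have "ec_map to_ac (ec_add f (ec_add f P Q) R) = ec_map to_ac (ec_add f P (ec_add f Q R))"
    unfolding map_add using closed P Q R L.add_assoc_if_infinite by (simp add: g_def)
  then show ?thesis by (rule inj)
qed

lemma comm_group_ec_group: "comm_group (ec_group f)"
proof (rule comm_groupI)
  fix P
  assume "P \<in> carrier (ec_group f)"
  then show "\<exists>Q\<in>carrier (ec_group f). Q \<otimes>\<^bsub>ec_group f\<^esub> P = \<one>\<^bsub>ec_group f\<^esub>"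
    by (intro bexI[of _ "ec_neg P"]) (cases P; auto simp: ec_group_def)+
qed (auto simp: ec_group_def add_closed add_assoc intro: add_commute)

end

section \<open>Square classes and 2-descent\<close>

text \<open>Triviality in the multiplicative group modulo squares; excluding 0 makes cancellation
  valid.\<close>

definition nz_square :: "'a::field \<Rightarrow> bool" where
  "nz_square x \<longleftrightarrow> (\<exists>s. s \<noteq> 0 \<and> x = s ^ 2)"

lemma nz_squareI: "s \<noteq> 0 \<Longrightarrow> x = s ^ 2 \<Longrightarrow> nz_square x"
  by (auto simp: nz_square_def)

lemma nz_square_1 [simp]: "nz_square 1"
  by (rule nz_squareI[of 1]) simp_all

lemma nz_square_power2 [simp]: "nz_square (x ^ 2) \<longleftrightarrow> x \<noteq> 0"
  by (auto simp: nz_square_def)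

lemma nz_square_mult_self [simp]: "nz_square (x * x) \<longleftrightarrow> x \<noteq> 0"
  by (simp flip: power2_eq_square)

lemma nz_square_mult: "nz_square x \<Longrightarrow> nz_square y \<Longrightarrow> nz_square (x * y)"
  unfolding nz_square_def by (metis mult_eq_0_iff power_mult_distrib)

lemma nz_square_cancel_right: "nz_square (x * y) \<Longrightarrow> nz_square y \<Longrightarrow> nz_square x"
  unfolding nz_square_def by (metis divide_eq_0_iff nonzero_mult_div_cancel_right power_divide power_eq_0_iff)

lemma nz_square_prod: "(\<And>i. i \<in> I \<Longrightarrow> nz_square (g i)) \<Longrightarrow> nz_square (\<Prod>i\<in>I. g i)"
  by (induction I rule: infinite_finite_induct) (auto intro: nz_square_mult)

text \<open>A homomorphism into the group of square classes, without forming the quotient: every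
  class is its own inverse, so the law becomes a product of three values.\<close>

locale square_class_map = comm_group G for G (structure) +
  fixes \<delta> :: "'a \<Rightarrow> 'k::field"
  assumes \<delta>_nz: "x \<in> carrier G \<Longrightarrow> \<delta> x \<noteq> 0"
    and \<delta>_mult: "x \<in> carrier G \<Longrightarrow> y \<in> carrier G \<Longrightarrow> nz_square (\<delta> x * \<delta> y * \<delta> (x \<otimes> y))"
begin

lemma \<delta>_one: "nz_square (\<delta> \<one>)"
proof -
  have "nz_square (\<delta> \<one> * (\<delta> \<one> * \<delta> \<one>))"
    using \<delta>_mult[of \<one> \<one>] by (simp add: mult.assoc)
  then show ?thesis
    by (rule nz_square_cancel_right) (simp add: \<delta>_nz)
qed

lemma \<delta>_square: "x \<in> carrier G \<Longrightarrow> nz_square (\<delta> (x \<otimes> x))"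
  using \<delta>_mult[of x x] \<delta>_nz[of x]
  by (intro nz_square_cancel_right[of "\<delta> (x \<otimes> x)" "\<delta> x * \<delta> x"]) (auto simp: mult_ac)

text \<open>Modulo squares the image of a combination depends only on the parities of its
  coefficients. The induction over the free group runs through differences, which is harmless
  because signs do not affect parity.\<close>

lemma \<delta>_hom_free_Abelian_group:
  fixes p :: "'i \<Rightarrow> 'a"
  assumes I: "finite I" and p: "p ` I \<subseteq> carrier G"
    and h: "h \<in> hom (free_Abelian_group I) G" and hp: "\<And>i. i \<in> I \<Longrightarrow> h (frag_of i) = p i"
    and c: "c \<in> carrier (free_Abelian_group I)"
  shows "nz_square (\<delta> (h c) * (\<Prod>i\<in>I. if odd (poly_mapping.lookup c i) then \<delta> (p i) else 1))"
proof -
  interpret h: group_hom "free_Abelian_group I" G h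
    using h by (simp add: group_hom_def group_hom_axioms_def)
  let ?\<phi> = "\<lambda>c i. if odd (poly_mapping.lookup c i) then \<delta> (p i) else (1::'k)"
  have keys: "Poly_Mapping.keys c \<subseteq> I" using c by simp
  have nz: "i \<in> I \<Longrightarrow> \<delta> (p i) \<noteq> 0" for i using p by (intro \<delta>_nz) auto
  have "nz_square (\<delta> (h c) * prod (?\<phi> c) I)"
  proof (rule free_Abelian_group_induct[OF keys])
    show "nz_square (\<delta> (h 0) * prod (?\<phi> 0) I)"
      using h.hom_one \<delta>_one by simp
  next
    fix x y
    assume 2: "Poly_Mapping.keys x \<subseteq> I" "Poly_Mapping.keys y \<subseteq> I"
      "nz_square (\<delta> (h x) * prod (?\<phi> x) I)" "nz_square (\<delta> (h y) * prod (?\<phi> y) I)"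
    have mem: "x \<in> carrier (free_Abelian_group I)" "y \<in> carrier (free_Abelian_group I)"
      "x - y \<in> carrier (free_Abelian_group I)"
      using 2 keys_diff[of x y] by auto
    define dx dy dz where "dx = \<delta> (h x)" and "dy = \<delta> (h y)" and "dz = \<delta> (h (x - y))"
    define x' y' z' where "x' = prod (?\<phi> x) I" and "y' = prod (?\<phi> y) I" and "z' = prod (?\<phi> (x - y)) I"
    have "h (x - y) \<otimes> h y = h x"
      using h.hom_mult[OF mem(3,2)] by simp
    then have "nz_square (dz * dy * dx)"
      using \<delta>_mult[OF h.hom_closed[OF mem(3)] h.hom_closed[OF mem(2)]] by (simp add: dx_def dy_def dz_def)
    \<comment> \<open>Among the coefficients of \<open>i\<close> in \<open>x - y\<close>,
      \<open>x\<close> and \<open>y\<close> an even number are odd, so each factor is 1 or a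
      square.\<close>
    moreover have "nz_square (\<Prod>i\<in>I. ?\<phi> (x - y) i * ?\<phi> x i * ?\<phi> y i)"
      by (rule nz_square_prod) (auto simp: lookup_minus nz)
    then have "nz_square (z' * x' * y')" by (simp add: prod.distrib x'_def y'_def z'_def)
    moreover have IH: "nz_square (dx * x')" "nz_square (dy * y')"
      using 2 by (simp_all add: dx_def dy_def x'_def y'_def)
    ultimately have "nz_square ((dz * dy * dx) * (z' * x' * y') * (dx * x') * (dy * y'))"
      using nz_square_mult by blast
    also have "(dz * dy * dx) * (z' * x' * y') * (dx * x') * (dy * y') = (dz * z') * (dx * x' * (dy * y')) ^ 2"
      by (simp add: power2_eq_square mult_ac)
    finally have "nz_square ((dz * z') * (dx * x' * (dy * y')) ^ 2)" .
    moreover have "dx * x' * (dy * y') \<noteq> 0" using IH by (auto simp: nz_square_def)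
    ultimately have "nz_square (dz * z')"
      using nz_square_cancel_right nz_square_power2 by blast
    then show "nz_square (\<delta> (h (x - y)) * prod (?\<phi> (x - y)) I)"
      by (simp add: dz_def z'_def)
  next
    fix i
    assume 3: "i \<in> I"
    have "prod (?\<phi> (frag_of i)) I = (\<Prod>j\<in>I. if j = i then \<delta> (p j) else 1)"
      by (rule prod.cong) (auto simp: lookup_frag_of)
    also have "\<dots> = \<delta> (p i)" using I 3 by simp
    finally show "nz_square (\<delta> (h (frag_of i)) * prod (?\<phi> (frag_of i)) I)"
      using hp nz 3 by simp
  qed
  then show ?thesis .
qed

text \<open>
  Descent: a relation modulo 2-torsion has even coefficients by the hypothesis on square classes,
  and halving them gives a smaller relation.
\<close>

lemma abelian_rank_ge:
  fixes p :: "nat \<Rightarrow> 'a"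
  assumes p: "p ` {..<r} \<subseteq> carrier G"
    and indep: "\<And>u \<epsilon>. u \<in> carrier G \<Longrightarrow> u \<otimes> u = \<one> \<Longrightarrow>
      nz_square (\<delta> u * (\<Prod>i<r. if \<epsilon> i then \<delta> (p i) else 1)) \<Longrightarrow> u = \<one> \<and> (\<forall>i<r. \<not> \<epsilon> i)"
  shows "enat r \<le> abelian_rank G"
proof -
  let ?F = "free_Abelian_group {..<r}"
  obtain h where h: "h \<in> hom ?F G" and hp: "\<And>i. i \<in> {..<r} \<Longrightarrow> h (frag_of i) = p i"
    using free_Abelian_group_universal[OF p] by metis
  interpret h: group_hom ?F G h
    using h by (simp add: group_hom_def group_hom_axioms_def)
  \<comment> \<open>Assuming only that 2 kills \<open>h c\<close> makes the induction go through:
    halving a relation \<open>h c = \<one>\<close> gives a \<open>c'\<close> whose image is known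
    only to be 2-torsion.\<close>
  have zero: "c = 0" if "c \<in> carrier ?F" "h c \<otimes> h c = \<one>" for c
    using that
  proof (induction "\<Sum>i<r. nat \<bar>poly_mapping.lookup c i\<bar>" arbitrary: c rule: less_induct)
    case less
    have "nz_square (\<delta> (h c) * (\<Prod>i<r. if odd (poly_mapping.lookup c i) then \<delta> (p i) else 1))"
      by (rule \<delta>_hom_free_Abelian_group[OF _ p h hp less.prems(1)]) simp_all
    then have "h c = \<one> \<and> (\<forall>i<r. \<not> odd (poly_mapping.lookup c i))"
      by (rule indep[OF h.hom_closed[OF less.prems(1)] less.prems(2)])
    then have hc: "h c = \<one>" and even: "\<And>i. i < r \<Longrightarrow> even (poly_mapping.lookup c i)"
      by auto
    have supp: "poly_mapping.lookup c i = 0" if "i \<ge> r" for i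
      using less.prems(1) that by (auto simp: in_keys_iff subset_iff)
    define c' where "c' = Poly_Mapping.map (\<lambda>n. n div 2) c"
    have lookup: "poly_mapping.lookup c' i = poly_mapping.lookup c i div 2" for i
      by (simp add: c'_def map.rep_eq when_def)
    have c: "c = c' + c'"
    proof (rule poly_mapping_eqI)
      fix i
      show "poly_mapping.lookup c i = poly_mapping.lookup (c' + c') i"
        unfolding lookup_add lookup using even[of i] supp[of i] by (cases "i < r") auto
    qed
    have c': "c' \<in> carrier ?F"
      using less.prems(1) by (auto simp: in_keys_iff lookup subset_iff)
    have sq: "h c' \<otimes> h c' = \<one>"
      using h.hom_mult[OF c' c'] hc c by simp
    show "c = 0"
    proof (rule ccontr)
      assume "c \<noteq> 0"
      then obtain j where j: "poly_mapping.lookup c j \<noteq> 0" by (metis lookup_zero poly_mapping_eqI)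
      with supp have "j < r" by (metis not_le)
      have "(\<Sum>i<r. nat \<bar>poly_mapping.lookup c' i\<bar>) < (\<Sum>i<r. nat \<bar>poly_mapping.lookup c i\<bar>)"
      proof (rule sum_strict_mono_ex1)
        show "\<forall>i\<in>{..<r}. nat \<bar>poly_mapping.lookup c' i\<bar> \<le> nat \<bar>poly_mapping.lookup c i\<bar>"
          unfolding lookup by auto
        show "\<exists>i\<in>{..<r}. nat \<bar>poly_mapping.lookup c' i\<bar> < nat \<bar>poly_mapping.lookup c i\<bar>"
          using even[of j] \<open>j < r\<close> j unfolding lookup by (intro bexI[of _ j]) auto
      qed simp
      from less.hyps[OF this c' sq] show False using c \<open>c \<noteq> 0\<close> by simp
    qed
  qed
  have inj: "inj_on h (carrier ?F)"
  proof (rule inj_onI)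
    fix x y
    assume xy: "x \<in> carrier ?F" "y \<in> carrier ?F" "h x = h y"
    have mem: "x - y \<in> carrier ?F" using xy keys_diff[of x y] by auto
    have "h (x - y) \<otimes> h y = h x" using h.hom_mult[OF mem xy(2)] by simp
    then have "h (x - y) = \<one>"
      using xy(3) l_cancel_one[OF h.hom_closed[OF xy(2)] h.hom_closed[OF mem]] r_cancel_one'
        h.hom_closed[OF xy(2)] h.hom_closed[OF mem] by auto
    then have "x - y = 0" using zero[OF mem] by simp
    then show "x = y" by simp
  qed
  have "subgroup (h ` carrier ?F) G" by (rule h.img_is_subgroup)
  moreover have "h \<in> iso ?F (G\<lparr>carrier := h ` carrier ?F\<rparr>)"
    using h inj by (auto simp: iso_def hom_def bij_betw_def)
  ultimately show ?thesis
    unfolding abelian_rank_def by (intro SUP_upper) (auto simp: is_iso_def)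
qed

end

section \<open>Reduction of the torsion subgroup to a Klein four-group\<close>

lemma (in comm_group) torsion_eq_two_torsion:
  assumes odd: "\<And>x m. x \<in> carrier G \<Longrightarrow> odd (m::nat) \<Longrightarrow> x [^] m = \<one> \<Longrightarrow> x = \<one>"
    and four: "\<And>x. x \<in> carrier G \<Longrightarrow> (x \<otimes> x) \<otimes> (x \<otimes> x) = \<one> \<Longrightarrow> x \<otimes> x = \<one>"
  shows "{x \<in> carrier G. \<exists>n::nat. n > 0 \<and> x [^] n = \<one>} = {x \<in> carrier G. x \<otimes> x = \<one>}"
proof (intro equalityI subsetI CollectI conjI; elim CollectE conjE exE)
  fix x and n :: nat
  assume x: "x \<in> carrier G" and n: "n > 0" "x [^] n = \<one>"
  have "n \<noteq> 0" "\<not> is_unit (2::nat)" using n(1) by auto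
  then obtain m where "n = 2 ^ multiplicity 2 n * m" and m: "odd m"
    by (rule multiplicity_decompose')
  then obtain s where nm: "n = 2 ^ s * m" by blast
  have "(x [^] (2 ^ s :: nat)) [^] m = \<one>" using n x nm by (simp add: nat_pow_pow)
  then have "x [^] (2 ^ s :: nat) = \<one>" by (rule odd[OF nat_pow_closed[OF x] m])
  then show "x \<otimes> x = \<one>" using x
  proof (induction s arbitrary: x)
    case (Suc s)
    have "x \<otimes> x = x [^] (2 :: nat)" using Suc.prems(2) by (simp add: numeral_2_eq_2)
    then have "(x \<otimes> x) [^] (2 ^ s :: nat) = x [^] (2 ^ Suc s :: nat)"
      using Suc.prems(2) by (simp only: nat_pow_pow power_Suc)
    then have "(x \<otimes> x) [^] (2 ^ s :: nat) = \<one>"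
      by (simp only: Suc.prems(1))
    from Suc.IH[OF this] have "(x \<otimes> x) \<otimes> (x \<otimes> x) = \<one>" using Suc.prems(2) by simp
    from four[OF Suc.prems(2) this] show ?case .
  qed simp
next
  fix x
  assume "x \<in> carrier G" "x \<otimes> x = \<one>"
  then show "\<exists>n::nat. n > 0 \<and> x [^] n = \<one>"
    by (intro exI[of _ 2]) (simp add: numeral_2_eq_2)
qed

text \<open>Two of the \<open>m + 1\<close> powers \<open>2^0, ..., 2^m\<close> agree modulo
  \<open>m\<close>. Hence doubling is periodic on an element killed by an odd number.\<close>

lemma odd_dvd_two_power_diff:
  assumes "odd (m::nat)"
  shows "\<exists>k>0. m dvd 2 ^ k - 1"
proof -
  have "\<not> inj_on (\<lambda>i. 2 ^ i mod m) {0..m}"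
  proof (rule pigeonhole)
    have "(\<lambda>i. 2 ^ i mod m) ` {0..m} \<subseteq> {..<m}" using assms by (auto simp: odd_pos)
    then have "card ((\<lambda>i. 2 ^ i mod m) ` {0..m}) \<le> card {..<m}" by (intro card_mono) simp_all
    then show "card ((\<lambda>i. 2 ^ i mod m) ` {0..m}) < card {0..m}" by simp
  qed
  then obtain i j where ij: "i < j" "2 ^ i mod m = 2 ^ j mod m"
    unfolding inj_on_def by (metis linorder_neqE_nat)
  then have "m dvd 2 ^ j - 2 ^ i" using mod_eq_dvd_iff_nat[of "2 ^ i" "2 ^ j" m]
    by (simp add: power_increasing)
  also have "(2::nat) ^ j - 2 ^ i = 2 ^ i * (2 ^ (j - i) - 1)"
    using ij(1) by (simp add: diff_mult_distrib2 flip: power_add)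
  finally have "m dvd 2 ^ (j - i) - 1"
    using assms by (simp add: coprime_dvd_mult_right_iff)
  with ij(1) show ?thesis by (intro exI[of _ "j - i"]) simp
qed

lemma (in comm_group) klein_four_iso:
  assumes t: "t1 \<in> carrier G" "t2 \<in> carrier G" "t1 \<otimes> t1 = \<one>" "t2 \<otimes> t2 = \<one>"
    and ne: "t1 \<noteq> \<one>" "t2 \<noteq> \<one>" "t1 \<noteq> t2"
  shows "G\<lparr>carrier := {\<one>, t1, t2, t1 \<otimes> t2}\<rparr> \<cong> integer_mod_group 2 \<times>\<times> integer_mod_group 2"
proof -
  define g where "g = (\<lambda>(i::int, j::int). (if i = 0 then \<one> else t1) \<otimes> (if j = 0 then \<one> else t2))"
  have car: "carrier (integer_mod_group 2 \<times>\<times> integer_mod_group 2) = {0, 1} \<times> {0, 1}"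
    by (auto simp: DirProd_def carrier_integer_mod_group)
  have ne3: "t1 \<otimes> t2 \<noteq> \<one>" "t1 \<otimes> t2 \<noteq> t1" "t1 \<otimes> t2 \<noteq> t2"
    using t ne by (metis l_cancel, simp_all)
  have t12: "t1 \<otimes> (t1 \<otimes> t2) = t2" "t2 \<otimes> (t1 \<otimes> t2) = t1" "t2 \<otimes> t1 = t1 \<otimes> t2"
    using t by (metis m_assoc l_one, metis m_lcomm r_one, metis m_comm)
  have "g \<in> iso (integer_mod_group 2 \<times>\<times> integer_mod_group 2) (G\<lparr>carrier := {\<one>, t1, t2, t1 \<otimes> t2}\<rparr>)"
    unfolding iso_def hom_def bij_betw_def car
    using t ne ne3 by (auto simp: g_def inj_on_def DirProd_def m_assoc t12)
  then show ?thesis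
    by (metis iso_sym is_isoI group.iso_sym DirProd_group group_integer_mod_group)
qed

section \<open>The descent map on a split cubic\<close>

context split_cubic
begin

text \<open>In the coordinate \<open>X = b d e x\<close> the curve reads
  \<open>Y^2 = (X + d e) (X + b e) (X + b d)\<close>, and this is the factor \<open>X + d e\<close>.
  At its zero the product of the other two factors takes its place.\<close>

definition delta_x :: "'a \<Rightarrow> 'a" where
  "delta_x x = (if 1 + b * x = 0 then d * e * (b - d) * (b - e) else d * e * (1 + b * x))"

fun delta :: "'a ec_point \<Rightarrow> 'a" where
  "delta Infinity = 1"
| "delta (Affine x y) = delta_x x"

lemma delta_x_nz: "delta_x x \<noteq> 0"
  using nz distinct by (simp add: delta_x_def)

lemma delta_nz: "delta P \<noteq> 0"
  by (cases P) (simp_all add: delta_x_nz)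

text \<open>If the line meets the curve in the point with \<open>1 + b x = 0\<close>, that factor can be cancelled from
  \<open>f - (m X + c)\<^sup>2 = b d e (X - x\<^sub>1) (X - x\<^sub>2) (X - x\<^sub>3)\<close> before evaluating at \<open>X = - 1 / b\<close>.\<close>

lemma delta_x_tangent:
  assumes l: "line_meets m c x1 x2 x3" and x1: "1 + b * x1 = 0"
  shows "nz_square (delta_x x1 * delta_x x2 * delta_x x3)"
proof -
  note eqs = line_meets_eqs[OF l]
  have bx: "b * x1 = - 1" using x1 by (simp add: eq_neg_iff_add_eq_0 add.commute)
  have "(b * c - m) ^ 2 = d * e * ((1 + b * x1) * (1 + b * x2) * (1 + b * x3))"
    using eqs by Groebner_Basis.algebra
  then have m: "m = b * c" by (simp add: x1)
  have "b * (b - b * d * e * x2 * x3) = b * (d + e + d * e * (x2 + x3))"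
    using eqs(1,3) bx unfolding m by Groebner_Basis.algebra
  then have "b - b * d * e * x2 * x3 = d + e + d * e * (x2 + x3)"
    using nz by simp
  then have key: "d * e * ((1 + b * x2) * (1 + b * x3)) = (b - d) * (b - e)"
    by Groebner_Basis.algebra
  then have ne: "1 + b * x2 \<noteq> 0" "1 + b * x3 \<noteq> 0"
    using nz distinct by auto
  have "delta_x x1 * delta_x x2 * delta_x x3 = (d * e * (b - d) * (b - e)) * (d * e) * (d * e * ((1 + b * x2) * (1 + b * x3)))"
    using ne x1 by (simp add: delta_x_def)
  also have "\<dots> = (d * e * ((b - d) * (b - e))) ^ 2"
    unfolding key by (simp add: power2_eq_square)
  finally show ?thesis using nz distinct by simp
qed

text \<open>At \<open>X = - 1 / b\<close> the polynomial \<open>f - (m X + c)^2\<close> is minus a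
  square. So the values \<open>1 + b x\<close> at three collinear points multiply to
  \<open>d e\<close> up to squares, and the factor \<open>d e\<close>, taken three times,
  compensates.\<close>

lemma delta_x_line:
  assumes l: "line_meets m c x1 x2 x3"
  shows "nz_square (delta_x x1 * delta_x x2 * delta_x x3)"
proof -
  consider "1 + b * x1 = 0" | "1 + b * x2 = 0" | "1 + b * x3 = 0"
    | "1 + b * x1 \<noteq> 0" "1 + b * x2 \<noteq> 0" "1 + b * x3 \<noteq> 0" by blast
  then show ?thesis
  proof cases
    case 1
    then show ?thesis by (rule delta_x_tangent[OF l])
  next
    case 2
    from delta_x_tangent[OF line_meets_perm(1)[OF l] this] show ?thesis by (simp add: mult_ac)
  next
    case 3
    from delta_x_tangent[OF line_meets_perm(1)[OF line_meets_perm(2)[OF l]] this]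
    show ?thesis by (simp add: mult_ac)
  next
    case 4
    have *: "(b * c - m) ^ 2 = d * e * ((1 + b * x1) * (1 + b * x2) * (1 + b * x3))"
      using line_meets_eqs[OF l] by Groebner_Basis.algebra
    then have "b * c - m \<noteq> 0" using 4 nz by auto
    moreover have "delta_x x1 * delta_x x2 * delta_x x3 =
        (d * e) ^ 2 * (d * e * ((1 + b * x1) * (1 + b * x2) * (1 + b * x3)))"
      using 4 by (simp add: delta_x_def power2_eq_square)
    then have "delta_x x1 * delta_x x2 * delta_x x3 = (d * e * (b * c - m)) ^ 2"
      by (simp only: *[symmetric] power_mult_distrib)
    ultimately show ?thesis using nz by simp
  qed
qed

lemma delta_add:
  assumes "P \<in> ec_points f" "Q \<in> ec_points f"
  shows "nz_square (delta P * delta Q * delta (ec_add f P Q))"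
proof (cases "P = Infinity \<or> Q = Infinity \<or> Q = ec_neg P")
  case True
  then show ?thesis by (cases P) (auto simp: delta_nz delta_x_nz)
next
  case False
  then obtain x1 y1 x2 y2 where PQ: "P = Affine x1 y1" "Q = Affine x2 y2"
    by (cases P; cases Q) auto
  then have n: "\<not> (x1 = x2 \<and> y1 = - y2)" using False by auto
  have on: "y1 ^ 2 = poly f x1" "y2 ^ 2 = poly f x2" using assms PQ by auto
  obtain m c x3 where "ec_add f P Q = Affine x3 (- (c + m * x3))" "line_meets m c x1 x2 x3"
    unfolding PQ by (rule add_affineE[OF on n])
  then show ?thesis using delta_x_line[of m c x1 x2 x3] by (simp add: PQ)
qed

sublocale E: comm_group "ec_group f"
  rewrites "carrier (ec_group f) = ec_points f" and "monoid.mult (ec_group f) = ec_add f"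
    and "one (ec_group f) = Infinity"
  by (rule comm_group_ec_group) (simp_all add: ec_group_def)

lemma square_class_map_delta: "square_class_map (ec_group f) delta"
  by unfold_locales (simp_all add: ec_group_def delta_nz delta_add)

lemma two_torsion:
  "{P \<in> ec_points f. ec_add f P P = Infinity}
    = {Infinity, Affine (- 1 / b) 0, Affine (- 1 / d) 0, Affine (- 1 / e) 0}"
proof -
  have dbl: "ec_add f (Affine x y) (Affine x y) = Infinity \<longleftrightarrow> y = 0" for x y
    by (auto simp: eq_uminus_iff_zero Let_def)
  have root: "1 + c * x = 0 \<longleftrightarrow> x = - 1 / c" if "c \<noteq> 0" for c x :: 'a
  proof -
    have "1 + c * x = 0 \<longleftrightarrow> x * c = - 1" by (metis add_eq_0_iff mult.commute)
    with that show ?thesis using nonzero_eq_divide_eq[of c x "- 1"] by simp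
  qed
  show ?thesis
  proof (rule Set.set_eqI)
    fix P
    show "P \<in> {P \<in> ec_points f. ec_add f P P = Infinity} \<longleftrightarrow>
        P \<in> {Infinity, Affine (- 1 / b) 0, Affine (- 1 / d) 0, Affine (- 1 / e) 0}"
    proof (cases P)
      case (Affine x y)
      have "poly f x = 0 \<longleftrightarrow> x = - 1 / b \<or> x = - 1 / d \<or> x = - 1 / e"
        by (simp only: poly_f_split mult_eq_0_iff root nz not_False_eq_True disj_assoc)
      then show ?thesis unfolding Affine mem_Collect_eq dbl by auto
    qed simp
  qed
qed

lemma add_two_torsion:
  "ec_add f (Affine (- 1 / b) 0) (Affine (- 1 / d) 0) = Affine (- 1 / e) 0"
  using nz distinct by (simp add: Let_def coeff_f) (simp add: field_simps)

text \<open>The double of a point of order 4 is a nonzero 2-torsion point and, being a double, has a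
  square value of \<open>delta\<close>; the hypotheses forbid this.\<close>

lemma torsion_part_iso:
  assumes odd: "\<And>P m. P \<in> ec_points f \<Longrightarrow> odd (m::nat) \<Longrightarrow> P [^]\<^bsub>ec_group f\<^esub> m = Infinity \<Longrightarrow> P = Infinity"
    and nsq: "\<not> nz_square (delta_x (- 1 / b))" "\<not> nz_square (delta_x (- 1 / d))" "\<not> nz_square (delta_x (- 1 / e))"
  shows "torsion_part (ec_group f) \<cong> integer_mod_group 2 \<times>\<times> integer_mod_group 2"
proof -
  interpret S: square_class_map "ec_group f" delta
    rewrites "carrier (ec_group f) = ec_points f" and "monoid.mult (ec_group f) = ec_add f"
      and "one (ec_group f) = Infinity"
    by (rule square_class_map_delta) (simp_all add: ec_group_def)
  let ?t1 = "Affine (- 1 / b) 0" and ?t2 = "Affine (- 1 / d) 0"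
  have "ec_add f P P = Infinity"
    if P: "P \<in> ec_points f" and 4: "ec_add f (ec_add f P P) (ec_add f P P) = Infinity" for P
  proof -
    have "ec_add f P P \<in> {P \<in> ec_points f. ec_add f P P = Infinity}"
      using P 4 by (simp add: add_closed)
    then show ?thesis
      using S.\<delta>_square[OF P] nsq unfolding two_torsion by auto
  qed
  with odd have "{P \<in> ec_points f. \<exists>n::nat. n > 0 \<and> P [^]\<^bsub>ec_group f\<^esub> n = Infinity}
      = {P \<in> ec_points f. ec_add f P P = Infinity}"
    by (rule E.torsion_eq_two_torsion)
  also have "\<dots> = {Infinity, ?t1, ?t2, ec_add f ?t1 ?t2}"
    by (simp only: two_torsion add_two_torsion)
  finally have "torsion_part (ec_group f) = ec_group f \<lparr>carrier := {Infinity, ?t1, ?t2, ec_add f ?t1 ?t2}\<rparr>"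
    by (simp add: torsion_part_def ec_group_def)
  moreover have "?t1 \<in> ec_points f" "?t2 \<in> ec_points f" "?t1 \<noteq> ?t2"
    using nz distinct by (simp_all add: poly_f_split)
  ultimately show ?thesis
    using E.klein_four_iso[of ?t1 ?t2] by simp
qed

text \<open>At a double all three components of the descent map are squares. The last equation
  becomes the squared recursion for \<open>A\<close> once the factors are expressed by
  \<open>A^2\<close>, \<open>B^2\<close>, \<open>C^2\<close>.\<close>

lemma double_delta:
  assumes P: "Affine x y \<in> ec_points f" and y: "y \<noteq> 0"
    and PP: "ec_add f (Affine x y) (Affine x y) = Affine x' y'"
  shows "1 + b * x \<noteq> 0" "\<exists>s. d * e * (1 + b * x') = s ^ 2" "\<exists>s. b * e * (1 + d * x') = s ^ 2"
    "\<exists>s. b * d * (1 + e * x') = s ^ 2"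
    "d * e * (1 + b * x') * (4 * ((1 + b * x) * (1 + d * x) * (1 + e * x))) =
      (b * ((1 + d * x) * (1 + e * x)) - d * ((1 + b * x) * (1 + e * x)) - e * ((1 + b * x) * (1 + d * x))) ^ 2"
proof -
  define u v w where "u = 1 + b * x" and "v = 1 + d * x" and "w = 1 + e * x"
  have on: "y ^ 2 = poly f x" using P by simp
  have yy: "y ^ 2 = u * v * w" using on by (simp add: poly_f_split u_def v_def w_def)
  have ne: "u \<noteq> 0" "v \<noteq> 0" "w \<noteq> 0" using yy y by auto
  then show "1 + b * x \<noteq> 0" by (simp add: u_def)
  have "\<not> (x = x \<and> y = - y)" using y by (simp add: eq_uminus_iff_zero)
  then obtain m c x3 where 3: "ec_add f (Affine x y) (Affine x y) = Affine x3 (- (c + m * x3))"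
    and l3: "line_meets m c x x x3" and yl: "y = c + m * x"
    by (rule add_affineE[OF on on])
  have l: "line_meets m c x x x'" using 3 PP l3 by auto
  \<comment> \<open>The tangent identity evaluated at the three roots of \<open>f\<close>.\<close>
  have B: "(b * c - m) ^ 2 = d * e * (1 + b * x') * u ^ 2"
    and D: "(d * c - m) ^ 2 = b * e * (1 + d * x') * v ^ 2"
    and F: "(e * c - m) ^ 2 = b * d * (1 + e * x') * w ^ 2"
    unfolding u_def v_def w_def using line_meets_eqs[OF l] by Groebner_Basis.algebra+
  from B ne have "d * e * (1 + b * x') = ((b * c - m) / u) ^ 2" by (simp add: power_divide)
  then show "\<exists>s. d * e * (1 + b * x') = s ^ 2" ..
  from D ne have "b * e * (1 + d * x') = ((d * c - m) / v) ^ 2" by (simp add: power_divide)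
  then show "\<exists>s. b * e * (1 + d * x') = s ^ 2" ..
  from F ne have "b * d * (1 + e * x') = ((e * c - m) / w) ^ 2" by (simp add: power_divide)
  then show "\<exists>s. b * d * (1 + e * x') = s ^ 2" ..
  have "poly (pderiv f) x = 2 * m * y"
    using line_meets_double[OF l] yl by simp
  then have m: "2 * m * y = b * (v * w) + d * (u * w) + e * (u * v)"
    unfolding poly_pderiv_f u_def v_def w_def by Groebner_Basis.algebra
  \<comment> \<open>The slope is known through \<open>2 m y\<close>, hence the factor
    \<open>2 y\<close>.\<close>
  have "(b * c - m) * (2 * y) = 2 * b * y ^ 2 - u * (2 * m * y)"
    unfolding u_def yl by Groebner_Basis.algebra
  also have "\<dots> = u * (b * (v * w) - d * (u * w) - e * (u * v))"
    unfolding yy m by Groebner_Basis.algebra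
  finally have "((b * c - m) * (2 * y)) ^ 2 = (u * (b * (v * w) - d * (u * w) - e * (u * v))) ^ 2"
    by simp
  moreover have "((b * c - m) * (2 * y)) ^ 2 = u ^ 2 * (d * e * (1 + b * x') * (4 * y ^ 2))"
    unfolding power_mult_distrib B by simp
  ultimately have "u ^ 2 * (d * e * (1 + b * x') * (4 * y ^ 2)) = u ^ 2 * (b * (v * w) - d * (u * w) - e * (u * v)) ^ 2"
    by (simp only: power_mult_distrib)
  then have "d * e * (1 + b * x') * (4 * y ^ 2) = (b * (v * w) - d * (u * w) - e * (u * v)) ^ 2"
    using ne by simp
  then show "d * e * (1 + b * x') * (4 * ((1 + b * x) * (1 + d * x) * (1 + e * x))) =
      (b * ((1 + d * x) * (1 + e * x)) - d * ((1 + b * x) * (1 + e * x)) - e * ((1 + b * x) * (1 + d * x))) ^ 2"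
    unfolding yy unfolding u_def v_def w_def .
qed

end

section \<open>Points of odd order\<close>

lemma to_fract_power [simp]: "to_fract (x ^ n) = to_fract x ^ n"
  by (induction n) simp_all

lemma to_fract_numeral [simp]: "to_fract (numeral n) = numeral n"
  using of_nat_fract[of "numeral n"] by (simp add: to_fract_def)

text \<open>\<rat>[t] is integrally closed: in lowest terms, the square of the denominator would
  divide that of the numerator.\<close>

lemma to_fract_eq_square_imp_range:
  fixes x :: "rat poly fract"
  assumes "x ^ 2 = to_fract p"
  obtains a where "x = to_fract a"
proof -
  obtain a w where q: "quot_of_fract x = (a, w)" by (cases "quot_of_fract x")
  have x: "x = to_fract a / to_fract w" and w: "w \<noteq> 0" "coprime a w" "normalize w = w"
    using Fract_quot_of_fract[of x] coprime_quot_of_fract[of x] snd_quot_of_fract_nonzero[of x]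
      normalize_snd_quot_of_fract[of x] by (simp_all add: q Fract_conv_to_fract)
  have "to_fract (a ^ 2) = to_fract (p * w ^ 2)"
    using assms w by (simp add: x power_divide field_simps)
  then have "a ^ 2 = p * w ^ 2" by (simp only: to_fract_eq_iff)
  then have "w ^ 2 dvd a ^ 2" by simp
  then have "is_unit w" using w(2) by (meson coprime_common_divisor coprime_power_right_iff coprime_power_left_iff
        dvd_refl pow_divides_pow_iff zero_less_numeral)
  then have "w = 1" using w(3) by (simp add: is_unit_normalize)
  then show ?thesis using that x by simp
qed

text \<open>The remaining \<open>k - 1\<close> steps of the period lead from \<open>Suc n\<close>
  back to \<open>n\<close>.\<close>

lemma periodic_dvd_chain:
  fixes w :: "nat \<Rightarrow> 'a::comm_monoid_mult"
  assumes "\<And>n. w n dvd w (Suc n)" "\<And>n. w (n + k) = w n" "k > 0"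
  shows "w (Suc n) dvd w n"
proof -
  have "w (Suc n) dvd w (Suc n + j)" for j
    by (induction j) (auto intro: dvd_trans assms(1))
  from this[of "k - 1"] show ?thesis using assms(2)[of n] assms(3) by simp
qed

text \<open>
  The sequences are square roots of \<open>de (1 + b x)\<close>, \<open>be (1 + d x)\<close>, \<open>bd (1 + e x)\<close> along the
  orbit of a point under doubling. Doubling a point of the formal group at a zero of the denominator
  \<open>w\<close> of \<open>A\<close> multiplies the local parameter by 2, that is, \<open>A\<close> by \<open>1/2\<close> modulo \<open>w\<close>.
\<close>

lemma periodic_orbit_integral:
  fixes A :: "nat \<Rightarrow> rat poly fract" and \<delta>1 \<delta>2 :: "rat poly"
  assumes nz: "\<And>n. A n \<noteq> 0"
    and rec: "\<And>n. A (Suc n) ^ 2 * (4 * (A n ^ 2 * (A n ^ 2 + to_fract \<delta>1) * (A n ^ 2 + to_fract \<delta>2)))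
      = (to_fract (\<delta>1 * \<delta>2) - A n ^ 4) ^ 2"
    and per: "\<And>n. A (n + k) ^ 2 = A n ^ 2" and k: "k > 0"
  obtains a where "A = to_fract \<circ> a"
proof -
  define a w where "a n = fst (quot_of_fract (A n))" and "w n = snd (quot_of_fract (A n))" for n
  have A: "A n = to_fract (a n) / to_fract (w n)" and w0: "w n \<noteq> 0"
    and cop: "coprime (a n) (w n)" and norm: "normalize (w n) = w n" for n
    using Fract_quot_of_fract[of "A n"] coprime_quot_of_fract[of "A n"]
      normalize_snd_quot_of_fract[of "A n"]
    by (simp_all add: a_def w_def Fract_conv_to_fract)
  define N where "N n = w n ^ 4 * (\<delta>1 * \<delta>2) - a n ^ 4" for n
  define M where "M n = a n ^ 2 * (a n ^ 2 + w n ^ 2 * \<delta>1) * (a n ^ 2 + w n ^ 2 * \<delta>2)" for n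
  have recR: "a (Suc n) ^ 2 * 4 * M n * w n ^ 2 = w (Suc n) ^ 2 * N n ^ 2" for n
  proof -
    define \<alpha> \<beta> \<omega> \<omega>' d1 d2 where "\<alpha> = to_fract (a n)" and "\<beta> = to_fract (a (Suc n))"
      and "\<omega> = to_fract (w n)" and "\<omega>' = to_fract (w (Suc n))" and "d1 = to_fract \<delta>1" and "d2 = to_fract \<delta>2"
    have ne: "\<omega> \<noteq> 0" "\<omega>' \<noteq> 0" using w0 by (simp_all add: \<omega>_def \<omega>'_def)
    have 1: "A n = \<alpha> / \<omega>" "A (Suc n) = \<beta> / \<omega>'" by (simp_all add: A \<alpha>_def \<beta>_def \<omega>_def \<omega>'_def)
    have 2: "(\<alpha> / \<omega>) ^ 2 + u = (\<alpha> ^ 2 + \<omega> ^ 2 * u) / \<omega> ^ 2" for u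
      using ne by (simp add: field_simps)
    have 3: "d1 * d2 - (\<alpha> / \<omega>) ^ 4 = (\<omega> ^ 4 * (d1 * d2) - \<alpha> ^ 4) / \<omega> ^ 4"
      using ne by (simp add: field_simps)
    have "(\<beta> / \<omega>') ^ 2 * (4 * ((\<alpha> / \<omega>) ^ 2 * ((\<alpha> / \<omega>) ^ 2 + d1) * ((\<alpha> / \<omega>) ^ 2 + d2))) = (d1 * d2 - (\<alpha> / \<omega>) ^ 4) ^ 2"
      using rec[of n] unfolding 1 by (simp add: d1_def d2_def)
    then have "(\<beta> ^ 2 * (4 * (\<alpha> ^ 2 * (\<alpha> ^ 2 + \<omega> ^ 2 * d1) * (\<alpha> ^ 2 + \<omega> ^ 2 * d2)))) / (\<omega>' ^ 2 * \<omega> ^ 6)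
        = (\<omega> ^ 4 * (d1 * d2) - \<alpha> ^ 4) ^ 2 / \<omega> ^ 8"
      unfolding 2 3 by (simp add: power_divide mult_ac flip: power_mult power_add)
    moreover have "x * \<omega> ^ 2 = \<omega>' ^ 2 * y" if "x / (\<omega>' ^ 2 * \<omega> ^ 6) = y / \<omega> ^ 8" for x y
    proof -
      have "\<omega> ^ 8 = \<omega> ^ 2 * \<omega> ^ 6" by (simp flip: power_add)
      with that have "(x * \<omega> ^ 2) * \<omega> ^ 6 = (\<omega>' ^ 2 * y) * \<omega> ^ 6"
        using ne by (simp only: frac_eq_eq mult_eq_0_iff power_eq_0_iff simp_thms mult_ac)
      then show ?thesis using ne by simp
    qed
    ultimately have "\<beta> ^ 2 * (4 * (\<alpha> ^ 2 * (\<alpha> ^ 2 + \<omega> ^ 2 * d1) * (\<alpha> ^ 2 + \<omega> ^ 2 * d2))) * \<omega> ^ 2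
        = \<omega>' ^ 2 * (\<omega> ^ 4 * (d1 * d2) - \<alpha> ^ 4) ^ 2"
      by blast
    then have "to_fract (a (Suc n) ^ 2 * 4 * M n * w n ^ 2) = to_fract (w (Suc n) ^ 2 * N n ^ 2)"
      by (simp add: M_def N_def \<alpha>_def \<beta>_def \<omega>_def \<omega>'_def d1_def d2_def)
    then show ?thesis by (simp only: to_fract_eq_iff)
  qed
  have "coprime (w n ^ 2) (N n ^ 2)" for n
  proof -
    have "coprime (w n) (N n)"
    proof (rule coprimeI)
      fix c
      assume c: "c dvd w n" "c dvd N n"
      then have "c dvd w n ^ 4 * (\<delta>1 * \<delta>2) - N n" by (simp add: dvd_diff power_eq_if)
      then have "c dvd a n ^ 4" by (simp add: N_def)
      then show "is_unit c"
        using c(1) cop[of n] by (meson coprime_common_divisor coprime_power_left_iff dvd_refl)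
    qed
    then show ?thesis by simp
  qed
  \<comment> \<open>\<open>N n\<close> is prime to \<open>w n\<close>, so the recursion forces each
    denominator into the next one; around a period they are all equal.\<close>
  then have "w n ^ 2 dvd w (Suc n) ^ 2" for n
    using recR[of n] by (metis coprime_dvd_mult_left_iff dvd_triv_right)
  then have dvd: "w n dvd w (Suc n)" for n by simp
  have perA: "A (n + k) = A n \<or> A (n + k) = - A n" for n
    using per[of n] by (simp add: power2_eq_iff)
  have perw: "w (n + k) = w n" and pera: "a (n + k) ^ 2 = a n ^ 2" for n
    using perA[of n] by (auto simp: w_def a_def quot_of_fract_uminus split: prod.splits)
  have "w (Suc n) = w n" for n
    using periodic_dvd_chain[of w, OF dvd perw k] dvd norm norm by (rule associated_eqI)
  then have wn: "w n = w 0" for n by (induction n) auto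
  define v where "v = w 0"
  have rec': "a (Suc n) ^ 2 * 4 * M n = N n ^ 2" for n
    using recR[of n] w0[of 0] by (simp add: wn[of n] wn[of "Suc n"])
  \<comment> \<open>Modulo \<open>v\<close> the terms with \<delta>1 and \<delta>2 disappear and the
    recursion reads \<open>4 a'^2 a^6 = a^8\<close>; moreover \<open>a\<close> is prime to
    \<open>v\<close>.\<close>
  have step: "v dvd 4 * a (Suc n) ^ 2 - a n ^ 2" for n
  proof -
    have "a n ^ 6 * (4 * a (Suc n) ^ 2 - a n ^ 2) = (a (Suc n) ^ 2 * 4 * M n - N n ^ 2) +
        v * (v ^ 3 * (\<delta>1 * \<delta>2) * (N n - a n ^ 4)
          - 4 * a (Suc n) ^ 2 * a n ^ 2 * (a n ^ 2 * v * (\<delta>1 + \<delta>2) + v ^ 3 * \<delta>1 * \<delta>2))"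
      unfolding M_def N_def wn[of n] v_def[symmetric] by Groebner_Basis.algebra
    then have "v dvd a n ^ 6 * (4 * a (Suc n) ^ 2 - a n ^ 2)"
      by (simp add: rec')
    moreover have "coprime v (a n ^ 6)"
      using cop[of n] by (simp add: wn[of n] v_def[symmetric] coprime_commute)
    ultimately show ?thesis by (simp add: coprime_dvd_mult_right_iff)
  qed
  have "v dvd 4 ^ j * a j ^ 2 - a 0 ^ 2" for j
  proof (induction j)
    case (Suc j)
    have "4 ^ j * (4 * a (Suc j) ^ 2 - a j ^ 2) + (4 ^ j * a j ^ 2 - a 0 ^ 2)
        = 4 ^ Suc j * a (Suc j) ^ 2 - a 0 ^ 2"
      by (simp add: algebra_simps)
    then show ?case
      using dvd_add[OF dvd_mult[OF step[of j], of "4 ^ j"] Suc] by (simp only:)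
  qed simp
  note chain = this
  \<comment> \<open>After a full period \<open>v\<close> divides \<open>4^k - 1\<close>, which is a
    nonzero constant because \<open>k > 0\<close>.\<close>
  have ne: "(4 :: rat) ^ k \<noteq> 1"
    by (metis k less_irrefl one_less_numeral_iff one_less_power semiring_norm(76))
  from chain[of k] have "v dvd (4 ^ k - 1) * a 0 ^ 2"
    using pera[of 0] by (simp add: algebra_simps)
  moreover have "coprime v (a 0 ^ 2)"
    using cop[of 0] by (simp add: v_def coprime_commute)
  ultimately have "v dvd 4 ^ k - 1" by (simp add: coprime_dvd_mult_left_iff)
  also have "(4 ^ k - 1 :: rat poly) = [:4 ^ k - 1:]"
    by (simp add: poly_const_pow numeral_poly one_pCons)
  also have "is_unit \<dots>"
    using ne by (simp add: is_unit_pCons_iff)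
  finally have "is_unit v" by (metis dvd_trans dvd_unit_imp_unit)
  then have "w n = 1" for n
    using norm[of 0] by (simp add: wn[of n] v_def is_unit_normalize)
  then have "A = to_fract \<circ> a" by (auto simp: A)
  then show ?thesis by (rule that)
qed

text \<open>
  A prime dividing \<open>A\<close> divides \<open>B\<close> or \<open>C\<close> because \<open>A\<close> is integral at the next step, and then
  its square divides \<open>\<delta>1\<close> or \<open>\<delta>2\<close>.
\<close>

lemma periodic_orbit_unit:
  fixes A B C :: "nat \<Rightarrow> rat poly fract" and \<delta>1 \<delta>2 :: "rat poly"
  assumes nz: "\<And>n. A n \<noteq> 0"
    and B: "\<And>n. B n ^ 2 = A n ^ 2 + to_fract \<delta>1" and C: "\<And>n. C n ^ 2 = A n ^ 2 + to_fract \<delta>2"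
    and rec: "\<And>n. A (Suc n) ^ 2 * (4 * (A n ^ 2 * B n ^ 2 * C n ^ 2))
      = (B n ^ 2 * C n ^ 2 - A n ^ 2 * C n ^ 2 - A n ^ 2 * B n ^ 2) ^ 2"
    and per: "\<And>n. A (n + k) ^ 2 = A n ^ 2" and k: "k > 0"
    and sf: "squarefree \<delta>1" "squarefree \<delta>2"
  obtains a b c where "is_unit a" "b ^ 2 = a ^ 2 + \<delta>1" "c ^ 2 = a ^ 2 + \<delta>2"
proof -
  have rec': "A (Suc n) ^ 2 * (4 * (A n ^ 2 * (A n ^ 2 + to_fract \<delta>1) * (A n ^ 2 + to_fract \<delta>2)))
      = (to_fract (\<delta>1 * \<delta>2) - A n ^ 4) ^ 2" for n
  proof -
    have "B n ^ 2 * C n ^ 2 - A n ^ 2 * C n ^ 2 - A n ^ 2 * B n ^ 2 = to_fract (\<delta>1 * \<delta>2) - A n ^ 4"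
      unfolding B C by (simp add: algebra_simps flip: power_add)
    then show ?thesis using rec[of n] unfolding B C by simp
  qed
  obtain a where a: "A = to_fract \<circ> a"
    by (rule periodic_orbit_integral[of A \<delta>1 \<delta>2 k, OF nz rec' per k])
  have "B n ^ 2 = to_fract (a n ^ 2 + \<delta>1)" "C n ^ 2 = to_fract (a n ^ 2 + \<delta>2)" for n
    by (simp_all add: B C a)
  note range = this[THEN to_fract_eq_square_imp_range]
  have "\<exists>b. B n = to_fract b" for n
    by (rule range(1)) blast
  then obtain b where b: "B n = to_fract (b n)" for n by metis
  have "\<exists>c. C n = to_fract c" for n
    by (rule range(2)) blast
  then obtain c where c: "C n = to_fract (c n)" for n by metis
  have "to_fract (b n ^ 2) = to_fract (a n ^ 2 + \<delta>1)" "to_fract (c n ^ 2) = to_fract (a n ^ 2 + \<delta>2)" for n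
    using B[of n] C[of n] by (simp_all add: a b c)
  then have bc: "b n ^ 2 = a n ^ 2 + \<delta>1" "c n ^ 2 = a n ^ 2 + \<delta>2" for n
    by (simp_all only: to_fract_eq_iff)
  have "to_fract (a (Suc n) ^ 2 * (4 * (a n ^ 2 * b n ^ 2 * c n ^ 2)))
      = to_fract ((b n ^ 2 * c n ^ 2 - a n ^ 2 * c n ^ 2 - a n ^ 2 * b n ^ 2) ^ 2)" for n
    using rec[of n] by (simp add: a b c)
  then have recR: "a (Suc n) ^ 2 * (4 * (a n ^ 2 * b n ^ 2 * c n ^ 2))
      = (b n ^ 2 * c n ^ 2 - a n ^ 2 * c n ^ 2 - a n ^ 2 * b n ^ 2) ^ 2" for n
    by (simp only: to_fract_eq_iff)
  have "is_unit (a 0)"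
  proof (rule ccontr)
    assume "\<not> is_unit (a 0)"
    moreover have "a 0 \<noteq> 0" using nz[of 0] by (auto simp: a)
    ultimately obtain p where p: "prime p" "p dvd a 0" by (metis prime_divisor_exists)
    have pe: "prime_elem p" using p(1) by simp
    have pa: "p dvd a 0 ^ 2" using p(2) by (simp add: power2_eq_square)
    then have "p dvd (b 0 ^ 2 * c 0 ^ 2 - a 0 ^ 2 * c 0 ^ 2 - a 0 ^ 2 * b 0 ^ 2) ^ 2"
      unfolding recR[of 0, symmetric] by (intro dvd_mult dvd_mult2)
    then have "p dvd b 0 ^ 2 * c 0 ^ 2 - a 0 ^ 2 * c 0 ^ 2 - a 0 ^ 2 * b 0 ^ 2"
      using pe by (rule prime_elem_dvd_power[rotated])
    then have "p dvd (b 0 ^ 2 * c 0 ^ 2 - a 0 ^ 2 * c 0 ^ 2 - a 0 ^ 2 * b 0 ^ 2) + a 0 ^ 2 * c 0 ^ 2 + a 0 ^ 2 * b 0 ^ 2"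
      using pa by (intro dvd_add dvd_mult2)
    then have "p dvd b 0 ^ 2 * c 0 ^ 2" by simp
    then have "p dvd b 0 \<or> p dvd c 0"
      using pe by (metis prime_elem_dvd_mult_iff prime_elem_dvd_power)
    then show False
    proof
      assume "p dvd b 0"
      then have "p ^ 2 dvd b 0 ^ 2 - a 0 ^ 2" using p(2) by (intro dvd_diff dvd_power_same)
      then show False using sf(1) pe unfolding bc squarefree_def prime_elem_def by simp
    next
      assume "p dvd c 0"
      then have "p ^ 2 dvd c 0 ^ 2 - a 0 ^ 2" using p(2) by (intro dvd_diff dvd_power_same)
      then show False using sf(2) pe unfolding bc squarefree_def prime_elem_def by simp
    qed
  qed
  then show ?thesis using that bc by blast
qed

section \<open>Halving points and signs at rational arguments\<close>

text \<open>The classical halving formula: if the factors of the monic model take the values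
  \<open>A^2\<close>, \<open>B^2\<close>, \<open>C^2\<close> at a point with coordinate
  \<open>X = b d e x\<close>, then a half of it has coordinate \<open>X + A B + A C + B C\<close>.
  The hypotheses say that the three squares come from one \<open>X\<close>.\<close>

lemma (in split_cubic) half_point:
  assumes AB: "A ^ 2 - B ^ 2 = d * e - b * e" and AC: "A ^ 2 - C ^ 2 = d * e - b * d"
    and x: "x = ((A + B) * (A + C) - d * e) / (b * d * e)"
    and y: "y = (A + B) * (A + C) * (B + C) / (b * d * e)"
  shows "Affine x y \<in> ec_points f" "d * e * (1 + b * x) = (A + B) * (A + C)"
proof -
  have K: "b * d * e \<noteq> 0" using nz by simp
  then have X: "b * d * e * x = (A + B) * (A + C) - d * e" and Y: "b * d * e * y = (A + B) * (A + C) * (B + C)"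
    by (simp_all add: x y)
  show 1: "d * e * (1 + b * x) = (A + B) * (A + C)" using X by Groebner_Basis.algebra
  have 2: "b * e * (1 + d * x) = (A + B) * (B + C)" using X AB by Groebner_Basis.algebra
  have 3: "b * d * (1 + e * x) = (A + C) * (B + C)" using X AC by Groebner_Basis.algebra
  have "(b * d * e) ^ 2 * y ^ 2 = (b * d * e * y) ^ 2" by (simp add: power_mult_distrib)
  also have "\<dots> = ((A + B) * (A + C)) * ((A + B) * (B + C)) * ((A + C) * (B + C))"
    unfolding Y by (simp add: power2_eq_square mult_ac)
  also have "\<dots> = (b * d * e) ^ 2 * ((1 + b * x) * (1 + d * x) * (1 + e * x))"
    unfolding 1[symmetric] 2[symmetric] 3[symmetric] by (simp add: power2_eq_square mult_ac)
  finally show "Affine x y \<in> ec_points f" using K by (simp add: poly_f_split)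
qed

lemma (in split_cubic) half_point_delta:
  assumes "A ^ 2 - B ^ 2 = d * e - b * e" "A ^ 2 - C ^ 2 = d * e - b * d" "(A + B) * (A + C) \<noteq> 0"
  shows "\<exists>P\<in>ec_points f. delta P = (A + B) * (A + C)"
proof -
  note h = half_point[OF assms(1,2) refl refl]
  have "delta (Affine (((A + B) * (A + C) - d * e) / (b * d * e)) ((A + B) * (A + C) * (B + C) / (b * d * e)))
      = (A + B) * (A + C)"
    using h(2) assms(3) nz by (auto simp: delta_x_def)
  with h(1) show ?thesis by blast
qed

text \<open>
  Here \<open>A, B, C\<close> are square roots of \<open>de (1 + b x')\<close>, \<open>be (1 + d x')\<close>, \<open>bd (1 + e x')\<close> for the abscissa
  \<open>x'\<close> of the difference of \<open>(x, B\<^sub>1 D\<^sub>1 E\<^sub>1)\<close> and \<open>(0, 1)\<close>.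
\<close>

lemma chord_roots:
  fixes b d e x B1 D1 E1 m :: "'a::field"
  assumes x: "x \<noteq> 0" and B1: "1 + b * x = B1 ^ 2" "B1 \<noteq> 0" and D1: "1 + d * x = D1 ^ 2" "D1 \<noteq> 0"
    and E1: "1 + e * x = E1 ^ 2" "E1 \<noteq> 0" and m: "m = (B1 * D1 * E1 + 1) / x"
  shows "((b + m) / B1) ^ 2 - ((d + m) / D1) ^ 2 = d * e - b * e"
    and "((b + m) / B1) ^ 2 - ((e + m) / E1) ^ 2 = d * e - b * d"
proof -
  \<comment> \<open>The line \<open>y = m X - 1\<close> joins \<open>(x, B1 D1 E1)\<close> to
    \<open>(0, -1)\<close>, the negative of \<open>(0, 1)\<close>.\<close>
  have mx: "(m * x - 1) ^ 2 = (1 + b * x) * (1 + d * x) * (1 + e * x)"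
    using x by (simp add: m B1 D1 E1 power_mult_distrib)
  have root: "((u + m) / U) ^ 2 = m ^ 2 - u * v - u * w - u * v * w * x"
    if U: "1 + u * x = U ^ 2" "U \<noteq> 0" and uvw: "(m * x - 1) ^ 2 = (1 + u * x) * (1 + v * x) * (1 + w * x)"
    for u v w U
  proof -
    have "x * (u + m) ^ 2 = x * ((1 + u * x) * (m ^ 2 - u * v - u * w - u * v * w * x))"
      using uvw by Groebner_Basis.algebra
    then have "(u + m) ^ 2 = (1 + u * x) * (m ^ 2 - u * v - u * w - u * v * w * x)"
      using x by simp
    then show ?thesis unfolding U(1) using U(2) by (simp add: power_divide divide_eq_eq mult.commute)
  qed
  have B: "((b + m) / B1) ^ 2 = m ^ 2 - b * d - b * e - b * d * e * x"
    by (rule root) (use B1 mx in simp_all)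
  have D: "((d + m) / D1) ^ 2 = m ^ 2 - d * b - d * e - d * b * e * x"
    by (rule root) (use D1 mx in \<open>simp_all add: mult_ac\<close>)
  have E: "((e + m) / E1) ^ 2 = m ^ 2 - e * b - e * d - e * b * d * x"
    by (rule root) (use E1 mx in \<open>simp_all add: mult_ac\<close>)
  show "((b + m) / B1) ^ 2 - ((d + m) / D1) ^ 2 = d * e - b * e"
    and "((b + m) / B1) ^ 2 - ((e + m) / E1) ^ 2 = d * e - b * d"
    unfolding B D E by (simp_all add: algebra_simps)
qed

section \<open>Values of rational functions at rational arguments\<close>

definition eval_at :: "rat \<Rightarrow> rat poly fract \<Rightarrow> rat \<Rightarrow> bool" where
  "eval_at t0 r v \<longleftrightarrow> (\<exists>p q. poly q t0 \<noteq> 0 \<and> r = to_fract p / to_fract q \<and> v = poly p t0 / poly q t0)"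

lemma eval_at_to_fract: "eval_at t0 (to_fract p) (poly p t0)"
  unfolding eval_at_def by (rule exI[of _ p], rule exI[of _ 1]) simp

lemma eval_at_numeral: "eval_at t0 (numeral n) (numeral n)"
  using eval_at_to_fract[of t0 "numeral n"] by simp

lemma eval_at_1: "eval_at t0 1 1"
  using eval_at_to_fract[of t0 1] by simp

lemma eval_at_add: "eval_at t0 r v \<Longrightarrow> eval_at t0 r' v' \<Longrightarrow> eval_at t0 (r + r') (v + v')"
  unfolding eval_at_def
proof (elim exE conjE)
  fix p q p' q'
  assume *: "poly q t0 \<noteq> 0" "poly q' t0 \<noteq> 0" "r = to_fract p / to_fract q" "r' = to_fract p' / to_fract q'"
    "v = poly p t0 / poly q t0" "v' = poly p' t0 / poly q' t0"
  then have "q \<noteq> 0" "q' \<noteq> 0" by auto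
  with * show "\<exists>p q. poly q t0 \<noteq> 0 \<and> r + r' = to_fract p / to_fract q \<and> v + v' = poly p t0 / poly q t0"
    by (intro exI[of _ "p * q' + p' * q"] exI[of _ "q * q'"]) (simp add: add_frac_eq)
qed

lemma eval_at_mult: "eval_at t0 r v \<Longrightarrow> eval_at t0 r' v' \<Longrightarrow> eval_at t0 (r * r') (v * v')"
  unfolding eval_at_def
proof (elim exE conjE)
  fix p q p' q'
  assume *: "poly q t0 \<noteq> 0" "poly q' t0 \<noteq> 0" "r = to_fract p / to_fract q" "r' = to_fract p' / to_fract q'"
    "v = poly p t0 / poly q t0" "v' = poly p' t0 / poly q' t0"
  then show "\<exists>p q. poly q t0 \<noteq> 0 \<and> r * r' = to_fract p / to_fract q \<and> v * v' = poly p t0 / poly q t0"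
    by (intro exI[of _ "p * p'"] exI[of _ "q * q'"]) simp
qed

lemma eval_at_inverse: "eval_at t0 r v \<Longrightarrow> v \<noteq> 0 \<Longrightarrow> eval_at t0 (1 / r) (1 / v)"
  unfolding eval_at_def
proof (elim exE conjE)
  fix p q
  assume *: "poly q t0 \<noteq> 0" "r = to_fract p / to_fract q" "v = poly p t0 / poly q t0" "v \<noteq> 0"
  then show "\<exists>p q. poly q t0 \<noteq> 0 \<and> 1 / r = to_fract p / to_fract q \<and> 1 / v = poly p t0 / poly q t0"
    by (intro exI[of _ q] exI[of _ p]) auto
qed

lemma eval_at_divide: "eval_at t0 r v \<Longrightarrow> eval_at t0 r' v' \<Longrightarrow> v' \<noteq> 0 \<Longrightarrow> eval_at t0 (r / r') (v / v')"
  using eval_at_mult[OF _ eval_at_inverse] by fastforce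

lemma eval_at_uminus: "eval_at t0 r v \<Longrightarrow> eval_at t0 (- r) (- v)"
  using eval_at_mult[of t0 "- 1" "- 1" r v] eval_at_to_fract[of t0 "- 1"] by simp

lemma eval_at_diff: "eval_at t0 r v \<Longrightarrow> eval_at t0 r' v' \<Longrightarrow> eval_at t0 (r - r') (v - v')"
  using eval_at_add[OF _ eval_at_uminus] by fastforce

lemma eval_at_power: "eval_at t0 r v \<Longrightarrow> eval_at t0 (r ^ n) (v ^ n)"
  by (induction n) (auto intro: eval_at_mult eval_at_1)

lemmas eval_at_intros = eval_at_add eval_at_mult eval_at_divide eval_at_diff eval_at_uminus eval_at_power
  eval_at_numeral eval_at_1

lemma eval_at_nonzero: "eval_at t0 r v \<Longrightarrow> v \<noteq> 0 \<Longrightarrow> r \<noteq> 0"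
  by (auto simp: eval_at_def)

text \<open>The root has a value wherever its square has one: a zero \<open>t0\<close> of the
  denominator of the root would also be a zero of its numerator, as \<open>q\<close> does not vanish
  there.\<close>

lemma eval_at_nz_square:
  assumes "eval_at t0 r v" "nz_square r"
  shows "v \<ge> 0"
proof -
  obtain p q where pq: "poly q t0 \<noteq> 0" "r = to_fract p / to_fract q" "v = poly p t0 / poly q t0"
    using assms(1) by (auto simp: eval_at_def)
  obtain s where s: "r = s ^ 2" using assms(2) by (auto simp: nz_square_def)
  define a w where "a = fst (quot_of_fract s)" and "w = snd (quot_of_fract s)"
  have sa: "s = to_fract a / to_fract w" and w: "w \<noteq> 0" "coprime a w"
    using Fract_quot_of_fract[of s] coprime_quot_of_fract[of s] by (simp_all add: a_def w_def Fract_conv_to_fract)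
  have q: "q \<noteq> 0" using pq(1) by auto
  have "to_fract (p * w ^ 2) = to_fract (a ^ 2 * q)"
    using pq(2) w q unfolding s sa by (simp add: power_divide frac_eq_eq)
  then have eq: "p * w ^ 2 = a ^ 2 * q" by (simp only: to_fract_eq_iff)
  have "poly w t0 \<noteq> 0"
  proof
    assume w0: "poly w t0 = 0"
    have "poly a t0 ^ 2 * poly q t0 = 0"
      using arg_cong[OF eq, of "\<lambda>p. poly p t0"] w0 by simp
    then have "poly a t0 = 0" using pq(1) by simp
    then have "[:- t0, 1:] dvd a" "[:- t0, 1:] dvd w" using w0 by (simp_all add: poly_eq_0_iff_dvd)
    then have "is_unit [:- t0, 1:]" using w(2) by (rule coprime_common_divisor[rotated])
    then show False by (simp add: is_unit_pCons_iff)
  qed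
  moreover have "poly p t0 * poly w t0 ^ 2 = poly a t0 ^ 2 * poly q t0"
    using arg_cong[OF eq, of "\<lambda>p. poly p t0"] by simp
  ultimately have "v = (poly a t0 / poly w t0) ^ 2"
    using pq(1,3) by (simp add: power_divide frac_eq_eq)
  then show ?thesis by simp
qed

text \<open>Substituting \<open>(t + 1)^2\<close> ramifies only over 0, and \<open>p\<close> does
  not vanish there. A repeated factor \<open>x\<close> divides \<open>2 c (t + 1)\<close> by the
  Bezout identity, hence \<open>t + 1\<close>, hence the constant coefficient of
  \<open>p\<close>.\<close>

lemma squarefree_pcompose_square:
  fixes p u v :: "rat poly"
  assumes bezout: "u * p + v * pderiv p = [:c:]" and c: "c \<noteq> 0" and p0: "coeff p 0 \<noteq> 0"
  shows "squarefree (pcompose p ([:1, 1:] ^ 2))"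
  unfolding squarefree_def
proof (intro allI impI)
  fix x :: "rat poly"
  let ?W = "[:1, 1:] :: rat poly"
  assume "x ^ 2 dvd pcompose p (?W ^ 2)"
  then obtain r where "pcompose p (?W ^ 2) = x ^ 2 * r" by (rule dvdE)
  moreover have "x ^ 2 * r = x * (x * r)" by (simp add: power2_eq_square mult.assoc)
  ultimately have r: "pcompose p (?W ^ 2) = x * (x * r)" by simp
  have xp: "x dvd pcompose p (?W ^ 2)" by (simp add: r)
  have "x dvd pderiv (pcompose p (?W ^ 2))"
    unfolding r pderiv_mult[of x] by (simp add: dvd_add)
  also have "pderiv (pcompose p (?W ^ 2)) = pcompose (pderiv p) (?W ^ 2) * smult 2 ?W"
  proof -
    have "pderiv (?W ^ 2) = smult 2 ?W" by (simp add: power2_eq_square pderiv_mult pderiv_pCons)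
    then show ?thesis by (simp only: pderiv_pcompose)
  qed
  finally have "x dvd pcompose v (?W ^ 2) * (pcompose (pderiv p) (?W ^ 2) * smult 2 ?W)" by (rule dvd_mult)
  moreover have "x dvd pcompose u (?W ^ 2) * pcompose p (?W ^ 2) * smult 2 ?W" using xp by (intro dvd_mult2 dvd_mult)
  ultimately have "x dvd pcompose u (?W ^ 2) * pcompose p (?W ^ 2) * smult 2 ?W
      + pcompose v (?W ^ 2) * (pcompose (pderiv p) (?W ^ 2) * smult 2 ?W)" by (rule dvd_add[rotated])
  also have "\<dots> = pcompose (u * p + v * pderiv p) (?W ^ 2) * smult 2 ?W"
    by (simp only: pcompose_add pcompose_mult distrib_right mult.assoc)
  also have "\<dots> = smult (2 * c) ?W" unfolding bezout by (simp add: mult.commute)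
  finally have xW: "x dvd ?W" by (rule dvd_smult_cancel) (use c in simp)
  obtain a p' where p: "p = pCons a p'" by (cases p)
  have "pcompose p (?W ^ 2) = [:a:] + ?W ^ 2 * pcompose p' (?W ^ 2)" by (simp add: p pcompose_pCons)
  moreover have "x dvd ?W ^ 2 * pcompose p' (?W ^ 2)" unfolding power2_eq_square using xW by (intro dvd_mult2)
  ultimately have "x dvd [:a:]" using xp by (metis dvd_add_left_iff)
  moreover have "is_unit [:a:]" using p0 by (simp add: p is_unit_pCons_iff)
  ultimately show "is_unit x" by (rule dvd_unit_imp_unit)
qed

text \<open>\<open>s\<close> clears denominators, and \<delta>1, \<delta>2 are the differences
  \<open>B^2 - A^2\<close>, \<open>C^2 - A^2\<close> of the scaled roots, which do not depend on the
  point.\<close>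

lemma no_odd_torsion:
  fixes b d e s :: "rat poly fract"
  assumes "split_cubic b d e" and f: "f = [:1, b:] * [:1, d:] * [:1, e:]"
    and s: "s \<noteq> 0" and \<delta>1: "s ^ 2 * (e * (b - d)) = to_fract \<delta>1" "squarefree \<delta>1"
    and \<delta>2: "s ^ 2 * (d * (b - e)) = to_fract \<delta>2" "squarefree \<delta>2" "degree \<delta>2 > 0" "lead_coeff \<delta>2 < 0"
    and P: "P \<in> ec_points f" and m: "odd m" "P [^]\<^bsub>ec_group f\<^esub> (m :: nat) = Infinity"
  shows "P = Infinity"
proof (rule ccontr)
  assume "P \<noteq> Infinity"
  interpret split_cubic b d e f
    using assms(1) by (simp_all add: split_cubic_def f)
  obtain k where k: "k > 0" "m dvd 2 ^ k - 1" using odd_dvd_two_power_diff[OF m(1)] by blast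
  define p where "p n = P [^]\<^bsub>ec_group f\<^esub> ((2::nat) ^ n)" for n
  have p: "p n \<in> ec_points f" for n using P by (simp add: p_def)
  have p_Suc: "p (Suc n) = ec_add f (p n) (p n)" for n
    using P E.nat_pow_mult[of P "2 ^ n" "2 ^ n"] by (simp add: p_def mult_2)
  have p_per: "p (n + k) = p n" for n
  proof -
    obtain j where j: "2 ^ k - 1 = m * j" using k(2) by (rule dvdE)
    have "1 \<le> (2::nat) ^ k" by simp
    then have "(2::nat) ^ k = 1 + m * j" using j by linarith
    then have "(2::nat) ^ (n + k) = 2 ^ n + m * (j * 2 ^ n)"
      by (simp add: power_add algebra_simps)
    then show ?thesis
      using P m(2) E.nat_pow_mult[of P "2 ^ n" "m * (j * 2 ^ n)"] E.nat_pow_pow[of P m "j * 2 ^ n"]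
      by (simp add: p_def)
  qed
  \<comment> \<open>The orbit returns to \<open>P\<close> at every multiple of \<open>k\<close>, so
    it never reaches infinity, where doubling would keep it.\<close>
  have p_mult: "p (i * k) = P" for i
  proof (induction i)
    case 0
    show ?case
      unfolding p_def mult_0 power_0 using P by (rule E.nat_pow_eone)
  next
    case (Suc i)
    then show ?case using p_per[of "i * k"] by (simp add: add.commute)
  qed
  have p_ne: "p n \<noteq> Infinity" for n
  proof
    assume "p n = Infinity"
    then have "p (n + j) = Infinity" for j by (induction j) (simp_all add: p_Suc)
    from this[of "n * k - n"] have "p (n * k) = Infinity" using k(1) by simp
    then show False using p_mult \<open>P \<noteq> Infinity\<close> by simp
  qed
  then have "\<exists>x y. p n = Affine x y" for n by (cases "p n") auto
  then obtain x y where pxy: "p n = Affine (x n) (y n)" for n by metis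
  have on: "Affine (x n) (y n) \<in> ec_points f" for n using p[of n] by (simp only: pxy)
  have y: "y n \<noteq> 0" for n using p_Suc[of n] p_ne[of "Suc n"] by (auto simp: pxy)
  have PP: "ec_add f (Affine (x n) (y n)) (Affine (x n) (y n)) = Affine (x (Suc n)) (y (Suc n))" for n
    using p_Suc[of n] by (simp only: pxy)
  note dbl = double_delta[OF on y PP]
  have x_per: "x (n + k) = x n" for n using p_per[of n] by (simp add: pxy)
  \<comment> \<open>The index \<open>n + k - 1\<close> supplies a predecessor even for
    \<open>n = 0\<close>: every point of the orbit is a double.\<close>
  have "x n = x (Suc (n + k - 1))" for n using x_per[of n] k(1) by simp
  then have "\<exists>A. d * e * (1 + b * x n) = A ^ 2" "\<exists>A. b * e * (1 + d * x n) = A ^ 2"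
    "\<exists>A. b * d * (1 + e * x n) = A ^ 2" for n
    using dbl(2-4)[of "n + k - 1"] by simp_all
  then obtain A B C where ABC: "d * e * (1 + b * x n) = A n ^ 2" "b * e * (1 + d * x n) = B n ^ 2"
    "b * d * (1 + e * x n) = C n ^ 2" for n by metis
  have sA: "(s * A n) ^ 2 = s ^ 2 * (d * e * (1 + b * x n))" and sB: "(s * B n) ^ 2 = s ^ 2 * (b * e * (1 + d * x n))"
    and sC: "(s * C n) ^ 2 = s ^ 2 * (b * d * (1 + e * x n))" for n
    by (simp_all add: ABC power_mult_distrib)
  obtain a c where a: "is_unit a" and c: "c ^ 2 = a ^ 2 + \<delta>2"
  proof (rule periodic_orbit_unit[of "\<lambda>n. s * A n" "\<lambda>n. s * B n" \<delta>1 "\<lambda>n. s * C n" \<delta>2 k])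
    fix n
    show "s * A n \<noteq> 0" using ABC(1)[of n] dbl(1)[of n] nz s by auto
    show "(s * B n) ^ 2 = (s * A n) ^ 2 + to_fract \<delta>1"
      unfolding sA sB \<delta>1(1)[symmetric] by Groebner_Basis.algebra
    show "(s * C n) ^ 2 = (s * A n) ^ 2 + to_fract \<delta>2"
      unfolding sA sC \<delta>2(1)[symmetric] by Groebner_Basis.algebra
    show "(s * A (Suc n)) ^ 2 * (4 * ((s * A n) ^ 2 * (s * B n) ^ 2 * (s * C n) ^ 2)) =
        ((s * B n) ^ 2 * (s * C n) ^ 2 - (s * A n) ^ 2 * (s * C n) ^ 2 - (s * A n) ^ 2 * (s * B n) ^ 2) ^ 2"
      unfolding sA sB sC using dbl(5)[of n] by Groebner_Basis.algebra
    show "(s * A (n + k)) ^ 2 = (s * A n) ^ 2" by (simp add: sA x_per)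
  qed (use k \<delta>1 \<delta>2 in auto)
  have "degree a = 0" using a by (auto simp: is_unit_poly_iff)
  then have "degree (a ^ 2) < degree \<delta>2" using \<delta>2(3) degree_power_le[of a 2] by simp
  then have "lead_coeff (a ^ 2 + \<delta>2) = lead_coeff \<delta>2" by (rule lead_coeff_add_le)
  then have "lead_coeff c ^ 2 = lead_coeff \<delta>2" by (metis c lead_coeff_power)
  then show False using \<delta>2(4) by (metis not_less zero_le_power2)
qed

section \<open>The curve over the rational function field\<close>

text \<open>With \<open>w = t + 1\<close> and \<open>s = 16 q v w\<close>, the coefficients are \<open>b = bw / s\<close>, \<open>d = dw / s\<close>, \<open>e = ew / s\<close>.\<close>

definition qw :: "'a::field \<Rightarrow> 'a" where "qw w = 16 * w ^ 4 - 20 * w ^ 2 + 3"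
definition vw :: "'a::field \<Rightarrow> 'a" where "vw w = 2 * w ^ 2 - 1"
definition sw :: "'a::field \<Rightarrow> 'a" where "sw w = 16 * qw w * vw w * w"
definition bw :: "'a::field \<Rightarrow> 'a" where "bw w = 256 * w ^ 2 * (w ^ 2 - 1) * vw w ^ 2"
definition dw :: "'a::field \<Rightarrow> 'a" where
  "dw w = 256 * w ^ 8 - 896 * w ^ 6 + 944 * w ^ 4 - 280 * w ^ 2 + 9"
definition ew :: "'a::field \<Rightarrow> 'a" where
  "ew w = 4096 * w ^ 12 - 8192 * w ^ 10 + 6144 * w ^ 8 - 2688 * w ^ 6 + 896 * w ^ 4 - 160 * w ^ 2 + 9"

text \<open>\<open>h / s\<close>, \<open>g / s\<close> and \<open>k / s\<close> are square roots of \<open>de + 1\<close>, \<open>be + 1\<close> and \<open>bd + 1\<close>.\<close>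

definition hw :: "'a::field \<Rightarrow> 'a" where
  "hw w = 1024 * w ^ 10 - 2816 * w ^ 8 + 2368 * w ^ 6 - 720 * w ^ 4 + 92 * w ^ 2 - 9"
definition gw :: "'a::field \<Rightarrow> 'a" where
  "gw w = 16 * vw w * w ^ 2 * (64 * w ^ 6 - 96 * w ^ 4 + 40 * w ^ 2 - 7)"
definition kw :: "'a::field \<Rightarrow> 'a" where
  "kw w = 16 * vw w * w ^ 2 * (16 * w ^ 4 - 28 * w ^ 2 + 13)"

text \<open>
  The quotients by \<open>s\<close> of these functions are an abscissa \<open>x\<close> and square roots of \<open>1 + b x\<close>,
  \<open>1 + d x\<close>, \<open>1 + e x\<close>, for \<open>x = q / (16 v w)\<close> in the first case and
  \<open>x = w (16 w\<^sup>4 - 28 w\<^sup>2 + 13) (16 w\<^sup>4 + 4 w\<^sup>2 - 3) / (4 v q)\<close> in the second.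
\<close>

definition x1w :: "'a::field \<Rightarrow> 'a" where "x1w w = qw w ^ 2"
definition b1w :: "'a::field \<Rightarrow> 'a" where "b1w w = w * sw w"
definition d1w :: "'a::field \<Rightarrow> 'a" where "d1w w = qw w * (16 * w ^ 4 + 4 * w ^ 2 - 3)"
definition e1w :: "'a::field \<Rightarrow> 'a" where "e1w w = qw w * (64 * w ^ 6 - 64 * w ^ 4 + 16 * w ^ 2 + 3)"
definition x2w :: "'a::field \<Rightarrow> 'a" where
  "x2w w = 4 * w ^ 2 * (16 * w ^ 4 - 28 * w ^ 2 + 13) * (16 * w ^ 4 + 4 * w ^ 2 - 3)"
definition b2w :: "'a::field \<Rightarrow> 'a" where "b2w w = 16 * vw w ^ 2 * w * (16 * w ^ 4 - 12 * w ^ 2 - 3)"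
definition d2w :: "'a::field \<Rightarrow> 'a" where
  "d2w w = 2 * w * (256 * w ^ 8 - 640 * w ^ 6 + 496 * w ^ 4 - 72 * w ^ 2 - 15)"
definition e2w :: "'a::field \<Rightarrow> 'a" where
  "e2w w = 2 * w * (1024 * w ^ 10 - 1792 * w ^ 8 + 832 * w ^ 6 + 48 * w ^ 4 - 84 * w ^ 2 + 15)"

lemmas base_defs = qw_def vw_def sw_def bw_def dw_def ew_def
lemmas root_defs = hw_def gw_def kw_def x1w_def b1w_def d1w_def e1w_def x2w_def b2w_def d2w_def e2w_def

text \<open>After division by \<open>s^2\<close>, the triple property and the extension by a fourth
  element, \<open>x1w w / sw w\<close> or \<open>x2w w / sw w\<close>.\<close>

lemma square_identities:
  "dw w * ew w + sw w ^ 2 = hw w ^ 2"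
  "bw w * ew w + sw w ^ 2 = gw w ^ 2"
  "bw w * dw w + sw w ^ 2 = kw w ^ 2"
  "sw w ^ 2 + bw w * x1w w = b1w w ^ 2"
  "sw w ^ 2 + dw w * x1w w = d1w w ^ 2"
  "sw w ^ 2 + ew w * x1w w = e1w w ^ 2"
  "sw w ^ 2 + bw w * x2w w = b2w w ^ 2"
  "sw w ^ 2 + dw w * x2w w = d2w w ^ 2"
  "sw w ^ 2 + ew w * x2w w = e2w w ^ 2"
  for w :: "'a::field"
  unfolding root_defs base_defs by Groebner_Basis.algebra+

definition half_delta :: "'a::field \<Rightarrow> 'a \<Rightarrow> 'a \<Rightarrow> 'a" where
  "half_delta A B C = (A + B) * (A + C)"

definition chord_delta :: "'a::field \<Rightarrow> 'a \<Rightarrow> 'a \<Rightarrow> 'a \<Rightarrow> 'a \<Rightarrow> 'a \<Rightarrow> 'a \<Rightarrow> 'a" where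
  "chord_delta b d e x r1 r2 r3 =
    (let m = (r1 * r2 * r3 + 1) / x in half_delta ((b + m) / r1) ((d + m) / r2) ((e + m) / r3))"

text \<open>Polymorphic, so that the same expression is read in \<rat>(t) and at rational arguments.
  The indices follow the order of the points in the overview.\<close>

definition point_delta :: "nat \<Rightarrow> 'a::field \<Rightarrow> 'a" where
  "point_delta i w = (let s = sw w; b = bw w / s; d = dw w / s; e = ew w / s in
    if i = 0 then d * e
    else if i = 1 then half_delta (hw w / s) (gw w / s) (kw w / s)
    else if i = 2 then chord_delta b d e (x1w w / s) (b1w w / s) (d1w w / s) (e1w w / s)
    else chord_delta b d e (x2w w / s) (b2w w / s) (d2w w / s) (e2w w / s))"

text \<open>Index 0 is the neutral element; 1, 2, 3 are the points with abscissae
  \<open>- 1 / b\<close>, \<open>- 1 / d\<close>, \<open>- 1 / e\<close>.\<close>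

definition torsion_delta :: "nat \<Rightarrow> 'a::field \<Rightarrow> 'a" where
  "torsion_delta j w = (let s = sw w; b = bw w / s; d = dw w / s; e = ew w / s in
    if j = 0 then 1 else if j = 1 then d * e * (b - d) * (b - e)
    else if j = 2 then e * (d - b) else d * (e - b))"

text \<open>The quantities by which \<open>point_delta\<close> and \<open>torsion_delta\<close>
  divide.\<close>

definition regular_at :: "rat \<Rightarrow> bool" where
  "regular_at w \<longleftrightarrow> sw w \<noteq> 0 \<and> x1w w \<noteq> 0 \<and> b1w w \<noteq> 0 \<and> d1w w \<noteq> 0 \<and> e1w w \<noteq> 0
    \<and> x2w w \<noteq> 0 \<and> b2w w \<noteq> 0 \<and> d2w w \<noteq> 0 \<and> e2w w \<noteq> 0"

lemma eval_at_base:
  assumes w: "eval_at t0 w w0"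
  shows "eval_at t0 (sw w) (sw w0)" "eval_at t0 (bw w) (bw w0)" "eval_at t0 (dw w) (dw w0)" "eval_at t0 (ew w) (ew w0)"
  unfolding base_defs by (intro eval_at_intros w)+

lemma eval_at_roots:
  assumes w: "eval_at t0 w w0"
  shows "eval_at t0 (hw w) (hw w0)" "eval_at t0 (gw w) (gw w0)" "eval_at t0 (kw w) (kw w0)"
    "eval_at t0 (x1w w) (x1w w0)" "eval_at t0 (b1w w) (b1w w0)" "eval_at t0 (d1w w) (d1w w0)" "eval_at t0 (e1w w) (e1w w0)"
    "eval_at t0 (x2w w) (x2w w0)" "eval_at t0 (b2w w) (b2w w0)" "eval_at t0 (d2w w) (d2w w0)" "eval_at t0 (e2w w) (e2w w0)"
  unfolding root_defs base_defs by (intro eval_at_intros w)+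

lemma eval_at_if:
  "(c \<Longrightarrow> eval_at t0 r v) \<Longrightarrow> (\<not> c \<Longrightarrow> eval_at t0 r' v') \<Longrightarrow>
    eval_at t0 (if c then r else r') (if c then v else v')"
  by simp

lemma eval_at_half_delta:
  assumes "eval_at t0 A A0" "eval_at t0 B B0" "eval_at t0 C C0"
  shows "eval_at t0 (half_delta A B C) (half_delta A0 B0 C0)"
  unfolding half_delta_def by (intro eval_at_intros assms)

lemma eval_at_chord_delta:
  assumes "eval_at t0 b b0" "eval_at t0 d d0" "eval_at t0 e e0" "eval_at t0 x x0"
    "eval_at t0 r1 u1" "eval_at t0 r2 u2" "eval_at t0 r3 u3"
    and "x0 \<noteq> 0" "u1 \<noteq> 0" "u2 \<noteq> 0" "u3 \<noteq> 0"
  shows "eval_at t0 (chord_delta b d e x r1 r2 r3) (chord_delta b0 d0 e0 x0 u1 u2 u3)"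
  unfolding chord_delta_def Let_def by (intro eval_at_half_delta eval_at_intros assms)

lemma eval_at_point_delta:
  assumes "eval_at t0 w w0" "regular_at w0"
  shows "eval_at t0 (point_delta i w) (point_delta i w0)"
proof -
  have nz: "sw w0 \<noteq> 0" "x1w w0 / sw w0 \<noteq> 0" "b1w w0 / sw w0 \<noteq> 0" "d1w w0 / sw w0 \<noteq> 0" "e1w w0 / sw w0 \<noteq> 0"
    "x2w w0 / sw w0 \<noteq> 0" "b2w w0 / sw w0 \<noteq> 0" "d2w w0 / sw w0 \<noteq> 0" "e2w w0 / sw w0 \<noteq> 0"
    using assms(2) by (simp_all add: regular_at_def)
  note ev = eval_at_base[OF assms(1)] eval_at_roots[OF assms(1)]
  show ?thesis
    unfolding point_delta_def Let_def
    by (intro eval_at_if eval_at_half_delta eval_at_chord_delta eval_at_mult eval_at_divide ev nz)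
qed

lemma eval_at_torsion_delta:
  assumes "eval_at t0 w w0" "regular_at w0"
  shows "eval_at t0 (torsion_delta j w) (torsion_delta j w0)"
proof -
  have nz: "sw w0 \<noteq> 0" using assms(2) by (simp_all add: regular_at_def)
  note ev = eval_at_base[OF assms(1)]
  show ?thesis
    unfolding torsion_delta_def Let_def by (intro eval_at_if eval_at_intros ev nz)
qed

section \<open>Signs at \<open>w = 2, -8/7, 5/4, 15/16, -3/7, 3/5\<close>\<close>

lemma signs_at_1:
  fixes w :: rat
  assumes w: "w = 2"
  shows "regular_at w"
    "sgn (point_delta 0 w) = 1"
    "sgn (point_delta 1 w) = 1"
    "sgn (point_delta 2 w) = 1"
    "sgn (point_delta 3 w) = 1"
    "sgn (torsion_delta 1 w) = - 1"
    "sgn (torsion_delta 2 w) = - 1"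
    "sgn (torsion_delta 3 w) = 1"
proof -
  have p: "w ^ 2 = 4" "w ^ 4 = 16" "w ^ 6 = 64" "w ^ 8 = 256" "w ^ 10 = 1024" "w ^ 12 = 4096"
    unfolding w by (simp_all add: power_divide)
  have qv: "qw w = 179" "vw w = 7"
    by (simp_all add: qw_def vw_def p)
  have sw: "sw w = 40096"
    unfolding sw_def qv unfolding w by simp
  have vals: "bw w = 150528"
    "dw w = 22185"
    "ew w = 9803145"
    "hw w = 468071"
    "gw w = 1215424"
    "kw w = 70336"
    "x1w w = 32041"
    "b1w w = 80192"
    "d1w w = 48151"
    "e1w w = 561881"
    "x2w w = 675728"
    "b2w w = 321440"
    "d2w w = 128836"
    "e2w w = 2574076"
    unfolding root_defs bw_def dw_def ew_def p qv sw unfolding w by (simp_all add: power2_eq_square)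
  show "regular_at w" by (simp add: regular_at_def sw vals)
  have bde: "bw w / sw w = 672 / 179" "dw w / sw w = 22185 / 40096" "ew w / sw w = 9803145 / 40096"
    by (simp_all add: sw vals)
  show "sgn (point_delta 0 w) = 1" unfolding point_delta_def Let_def bde by simp
  have h: "hw w / sw w = 468071 / 40096" "gw w / sw w = 5426 / 179" "kw w / sw w = 314 / 179"
    by (simp_all add: sw vals)
  show "sgn (point_delta 1 w) = 1" unfolding point_delta_def Let_def half_delta_def h by simp
  have r: "x1w w / sw w = 179 / 224" "b1w w / sw w = 2" "d1w w / sw w = 269 / 224" "e1w w / sw w = 3139 / 224"
    by (simp_all add: sw vals)
  \<comment> \<open>The slope of the chord to \<open>(0, -1)\<close> at this argument.\<close>
  have m: "((2) * (269 / 224) * (3139 / 224) + 1) / (179 / 224) = (869479 / 20048 :: rat)" by simp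
  show "sgn (point_delta 2 w) = 1"
    unfolding point_delta_def chord_delta_def half_delta_def Let_def bde r m by simp
  have r: "x2w w / sw w = 42233 / 2506" "b2w w / sw w = 1435 / 179" "d2w w / sw w = 32209 / 10024" "e2w w / sw w = 643519 / 10024"
    by (simp_all add: sw vals)
  have m: "((1435 / 179) * (32209 / 10024) * (643519 / 10024) + 1) / (42233 / 2506) = (27080418111 / 275808928 :: rat)" by simp
  show "sgn (point_delta 3 w) = 1"
    unfolding point_delta_def chord_delta_def half_delta_def Let_def bde r m by simp
  show "sgn (torsion_delta 1 w) = - 1" "sgn (torsion_delta 2 w) = - 1" "sgn (torsion_delta 3 w) = 1"
    unfolding torsion_delta_def Let_def bde by simp_all
qed

text \<open>This row differs from that of \<open>w = 2\<close> in point 1 alone.\<close>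

lemma signs_at_2:
  fixes w :: rat
  assumes w: "w = - 8 / 7"
  shows "regular_at w"
    "sgn (point_delta 0 w) = 1"
    "sgn (point_delta 1 w) = - 1"
    "sgn (point_delta 2 w) = 1"
    "sgn (point_delta 3 w) = 1"
    "sgn (torsion_delta 1 w) = - 1"
    "sgn (torsion_delta 2 w) = - 1"
    "sgn (torsion_delta 3 w) = 1"
proof -
  have p: "w ^ 2 = 64 / 49" "w ^ 4 = 4096 / 2401" "w ^ 6 = 262144 / 117649" "w ^ 8 = 16777216 / 5764801" "w ^ 10 = 1073741824 / 282475249" "w ^ 12 = 68719476736 / 13841287201"
    unfolding w by (simp_all add: power_divide)
  have qv: "qw w = 10019 / 2401" "vw w = 79 / 49"
    by (simp_all add: qw_def vw_def p)
  have sw: "sw w = - 101312128 / 823543"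
    unfolding sw_def qv unfolding w by simp
  have vals: "bw w = 1533788160 / 5764801"
    "dw w = 13174473 / 5764801"
    "ew w = 33447998251305 / 13841287201"
    "hw w = - 40598354809 / 282475249"
    "gw w = 229149973504 / 282475249"
    "kw w = 723291136 / 5764801"
    "x1w w = 100380361 / 5764801"
    "b1w w = 810497024 / 5764801"
    "d1w w = 710116663 / 5764801"
    "e1w w = 67565440889 / 282475249"
    "x2w w = 162230081792 / 282475249"
    "b2w w = - 16536952448 / 40353607"
    "d2w w = - 5175085840 / 40353607"
    "e2w w = - 2342102102512 / 1977326743"
    unfolding root_defs bw_def dw_def ew_def p qv sw unfolding w by (simp_all add: power2_eq_square)
  show "regular_at w" by (simp add: regular_at_def sw vals)
  have bde: "bw w / sw w = - 151680 / 70133" "dw w / sw w = - 13174473 / 709184896" "ew w / sw w = - 33447998251305 / 1702752935296"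
    by (simp_all add: sw vals)
  show "sgn (point_delta 0 w) = 1" unfolding point_delta_def Let_def bde by simp
  have h: "hw w / sw w = 40598354809 / 34750059904" "gw w / sw w = - 22661192 / 3436517" "kw w / sw w = - 71528 / 70133"
    by (simp_all add: sw vals)
  show "sgn (point_delta 1 w) = - 1" unfolding point_delta_def Let_def half_delta_def h by simp
  have r: "x1w w / sw w = - 10019 / 70784" "b1w w / sw w = - 8 / 7" "d1w w / sw w = - 70877 / 70784" "e1w w / sw w = - 6743731 / 3468416"
    by (simp_all add: sw vals)
  have m: "((- 8 / 7) * (- 70877 / 70784) * (- 6743731 / 3468416) + 1) / (- 10019 / 70784) = (6119897877 / 707123312 :: rat)" by simp
  show "sgn (point_delta 2 w) = 1"
    unfolding point_delta_def chord_delta_def half_delta_def Let_def bde r m by simp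
  have r: "x2w w / sw w = - 1267422514 / 271484843" "b2w w / sw w = 1635379 / 490931" "d2w w / sw w = 323442865 / 310268392" "e2w w / sw w = 146381381407 / 15203151208"
    by (simp_all add: sw vals)
  have m: "((1635379 / 490931) * (323442865 / 310268392) * (146381381407 / 15203151208) + 1) / (- 1267422514 / 271484843) = (- 112898233950420044799 / 15305737118048739712 :: rat)" by simp
  show "sgn (point_delta 3 w) = 1"
    unfolding point_delta_def chord_delta_def half_delta_def Let_def bde r m by simp
  show "sgn (torsion_delta 1 w) = - 1" "sgn (torsion_delta 2 w) = - 1" "sgn (torsion_delta 3 w) = 1"
    unfolding torsion_delta_def Let_def bde by simp_all
qed

lemma signs_at_3:
  fixes w :: rat
  assumes w: "w = 5 / 4"
  shows "regular_at w"
    "sgn (point_delta 0 w) = - 1"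
    "sgn (point_delta 1 w) = 1"
    "sgn (point_delta 2 w) = 1"
    "sgn (point_delta 3 w) = 1"
    "sgn (torsion_delta 1 w) = 1"
    "sgn (torsion_delta 2 w) = - 1"
    "sgn (torsion_delta 3 w) = - 1"
proof -
  have p: "w ^ 2 = 25 / 16" "w ^ 4 = 625 / 256" "w ^ 6 = 15625 / 4096" "w ^ 8 = 390625 / 65536" "w ^ 10 = 9765625 / 1048576" "w ^ 12 = 244140625 / 16777216"
    unfolding w by (simp_all add: power_divide)
  have qv: "qw w = 173 / 16" "vw w = 17 / 8"
    by (simp_all add: qw_def vw_def p)
  have sw: "sw w = 14705 / 32"
    unfolding sw_def qv unfolding w by simp
  have vals: "bw w = 65025 / 64"
    "dw w = - 4071 / 256"
    "ew w = 47613489 / 4096"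
    "hw w = 166109 / 1024"
    "gw w = 1775225 / 512"
    "kw w = 56525 / 128"
    "x1w w = 29929 / 256"
    "b1w w = 73525 / 128"
    "d1w w = 117121 / 256"
    "e1w w = 1283141 / 1024"
    "x2w w = 2251025 / 1024"
    "b2w w = 400265 / 256"
    "d2w w = 214925 / 512"
    "e2w w = 10395425 / 2048"
    unfolding root_defs bw_def dw_def ew_def p qv sw unfolding w by (simp_all add: power2_eq_square)
  show "regular_at w" by (simp add: regular_at_def sw vals)
  have bde: "bw w / sw w = 765 / 346" "dw w / sw w = - 4071 / 117640" "ew w / sw w = 47613489 / 1882240"
    by (simp_all add: sw vals)
  show "sgn (point_delta 0 w) = - 1" unfolding point_delta_def Let_def bde by simp
  have h: "hw w / sw w = 166109 / 470560" "gw w / sw w = 20885 / 2768" "kw w / sw w = 665 / 692"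
    by (simp_all add: sw vals)
  show "sgn (point_delta 1 w) = 1" unfolding point_delta_def Let_def half_delta_def h by simp
  have r: "x1w w / sw w = 173 / 680" "b1w w / sw w = 5 / 4" "d1w w / sw w = 677 / 680" "e1w w / sw w = 7417 / 2720"
    by (simp_all add: sw vals)
  have m: "((5 / 4) * (677 / 680) * (7417 / 2720) + 1) / (173 / 680) = (6500989 / 376448 :: rat)" by simp
  show "sgn (point_delta 2 w) = 1"
    unfolding point_delta_def chord_delta_def half_delta_def Let_def bde r m by simp
  have r: "x2w w / sw w = 450205 / 94112" "b2w w / sw w = 4709 / 1384" "d2w w / sw w = 42985 / 47056" "e2w w / sw w = 2079085 / 188224"
    by (simp_all add: sw vals)
  have m: "((4709 / 1384) * (42985 / 47056) * (2079085 / 188224) + 1) / (450205 / 94112) = (191551973061 / 25935274240 :: rat)" by simp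
  show "sgn (point_delta 3 w) = 1"
    unfolding point_delta_def chord_delta_def half_delta_def Let_def bde r m by simp
  show "sgn (torsion_delta 1 w) = 1" "sgn (torsion_delta 2 w) = - 1" "sgn (torsion_delta 3 w) = - 1"
    unfolding torsion_delta_def Let_def bde by simp_all
qed

text \<open>This row differs from that of \<open>w = 2\<close> in points 0 and 3 alone.\<close>

lemma signs_at_4:
  fixes w :: rat
  assumes w: "w = 15 / 16"
  shows "regular_at w"
    "sgn (point_delta 0 w) = - 1"
    "sgn (point_delta 1 w) = 1"
    "sgn (point_delta 2 w) = 1"
    "sgn (point_delta 3 w) = - 1"
    "sgn (torsion_delta 1 w) = - 1"
    "sgn (torsion_delta 2 w) = - 1"
    "sgn (torsion_delta 3 w) = 1"
proof -
  have p: "w ^ 2 = 225 / 256" "w ^ 4 = 50625 / 65536" "w ^ 6 = 11390625 / 16777216" "w ^ 8 = 2562890625 / 4294967296" "w ^ 10 = 576650390625 / 1099511627776" "w ^ 12 = 129746337890625 / 281474976710656"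
    unfolding w by (simp_all add: power_divide)
  have qv: "qw w = - 9087 / 4096" "vw w = 97 / 128"
    by (simp_all add: qw_def vw_def p)
  have sw: "sw w = - 13221585 / 524288"
    unfolding sw_def qv unfolding w by simp
  have vals: "bw w = - 65627775 / 4194304"
    "dw w = 613357569 / 16777216"
    "ew w = - 449383874751 / 68719476736"
    "hw w = - 21390992991 / 1073741824"
    "gw w = - 14587458975 / 536870912"
    "kw w = 67068225 / 8388608"
    "x1w w = 82573569 / 16777216"
    "b1w w = - 198323775 / 8388608"
    "d1w w = - 479221119 / 16777216"
    "e1w w = - 26383713759 / 1073741824"
    "x2w w = 36463680225 / 1073741824"
    "b2w w = - 686339505 / 67108864"
    "d2w w = 5815637775 / 134217728"
    "e2w w = 174754385775 / 8589934592"
    unfolding root_defs bw_def dw_def ew_def p qv sw unfolding w by (simp_all add: power2_eq_square)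
  show "regular_at w" by (simp add: regular_at_def sw vals)
  have bde: "bw w / sw w = 15035 / 24232" "dw w / sw w = - 68150841 / 47010080" "ew w / sw w = 49931541639 / 192553287680"
    by (simp_all add: sw vals)
  show "sgn (point_delta 0 w) = - 1" unfolding point_delta_def Let_def bde by simp
  have h: "hw w / sw w = 2376776999 / 3008645120" "gw w / sw w = 3341915 / 3101696" "kw w / sw w = - 15365 / 48464"
    by (simp_all add: sw vals)
  show "sgn (point_delta 1 w) = 1" unfolding point_delta_def Let_def half_delta_def h by simp
  have r: "x1w w / sw w = - 3029 / 15520" "b1w w / sw w = 15 / 16" "d1w w / sw w = 17579 / 15520" "e1w w / sw w = 967819 / 993280"
    by (simp_all add: sw vals)
  have m: "((15 / 16) * (17579 / 15520) * (967819 / 993280) + 1) / (- 3029 / 15520) = (- 100370128523 / 9627664384 :: rat)" by simp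
  show "sgn (point_delta 2 w) = 1"
    unfolding point_delta_def chord_delta_def half_delta_def Let_def bde r m by simp
  have r: "x2w w / sw w = - 810304005 / 601729024" "b2w w / sw w = 157237 / 387712" "d2w w / sw w = - 129236395 / 75216128" "e2w w / sw w = - 3883430795 / 4813832192"
    by (simp_all add: sw vals)
  have m: "((157237 / 387712) * (- 129236395 / 75216128) * (- 3883430795 / 4813832192) + 1) / (- 810304005 / 601729024) = (- 245231010362102959 / 211398859081646080 :: rat)" by simp
  show "sgn (point_delta 3 w) = - 1"
    unfolding point_delta_def chord_delta_def half_delta_def Let_def bde r m by simp
  show "sgn (torsion_delta 1 w) = - 1" "sgn (torsion_delta 2 w) = - 1" "sgn (torsion_delta 3 w) = 1"
    unfolding torsion_delta_def Let_def bde by simp_all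
qed

text \<open>The only row that is negative at point 2.\<close>

lemma signs_at_5:
  fixes w :: rat
  assumes w: "w = - 3 / 7"
  shows "regular_at w"
    "sgn (point_delta 0 w) = 1"
    "sgn (point_delta 1 w) = 1"
    "sgn (point_delta 2 w) = - 1"
    "sgn (point_delta 3 w) = - 1"
    "sgn (torsion_delta 1 w) = - 1"
    "sgn (torsion_delta 2 w) = 1"
    "sgn (torsion_delta 3 w) = - 1"
proof -
  have p: "w ^ 2 = 9 / 49" "w ^ 4 = 81 / 2401" "w ^ 6 = 729 / 117649" "w ^ 8 = 6561 / 5764801" "w ^ 10 = 59049 / 282475249" "w ^ 12 = 531441 / 13841287201"
    unfolding w by (simp_all add: power_divide)
  have qv: "qw w = - 321 / 2401" "vw w = - 31 / 49"
    by (simp_all add: qw_def vw_def p)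
  have sw: "sw w = - 477648 / 823543"
    unfolding sw_def qv unfolding w by simp
  have vals: "bw w = - 88565760 / 5764801"
    "dw w = - 91328607 / 5764801"
    "ew w = - 19085675895 / 13841287201"
    "hw w = - 1330379469 / 282475249"
    "gw w = 1310411664 / 282475249"
    "kw w = - 89998704 / 5764801"
    "x1w w = 103041 / 5764801"
    "b1w w = 1432944 / 5764801"
    "d1w w = 1329903 / 5764801"
    "e1w w = - 157717251 / 282475249"
    "x2w w = - 3006972828 / 282475249"
    "b2w w = 516587472 / 40353607"
    "d2w w = 524566890 / 40353607"
    "e2w w = - 7661940642 / 1977326743"
    unfolding root_defs bw_def dw_def ew_def p qv sw unfolding w by (simp_all add: power2_eq_square)
  show "regular_at w" by (simp add: regular_at_def sw vals)
  have bde: "bw w / sw w = 19840 / 749" "dw w / sw w = 10147623 / 371504" "ew w / sw w = 2120630655 / 891981104"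
    by (simp_all add: sw vals)
  show "sgn (point_delta 0 w) = 1" unfolding point_delta_def Let_def bde by simp
  have h: "hw w / sw w = 147819941 / 18203696" "gw w / sw w = - 293551 / 36701" "kw w / sw w = 20161 / 749"
    by (simp_all add: sw vals)
  show "sgn (point_delta 1 w) = 1" unfolding point_delta_def Let_def half_delta_def h by simp
  have r: "x1w w / sw w = - 107 / 3472" "b1w w / sw w = - 3 / 7" "d1w w / sw w = - 1381 / 3472" "e1w w / sw w = 163777 / 170128"
    by (simp_all add: sw vals)
  have m: "((- 3 / 7) * (- 1381 / 3472) * (163777 / 170128) + 1) / (- 107 / 3472) = (- 4813319023 / 127425872 :: rat)" by simp
  show "sgn (point_delta 2 w) = - 1"
    unfolding point_delta_def chord_delta_def half_delta_def Let_def bde r m by simp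
  have r: "x2w w / sw w = 83527023 / 4550924" "b2w w / sw w = - 115723 / 5243" "d2w w / sw w = - 29142605 / 1300264" "e2w w / sw w = 425663369 / 63712936"
    by (simp_all add: sw vals)
  have m: "((- 115723 / 5243) * (- 29142605 / 1300264) * (425663369 / 63712936) + 1) / (83527023 / 4550924) = (765862310739059 / 4251786186928 :: rat)" by simp
  show "sgn (point_delta 3 w) = - 1"
    unfolding point_delta_def chord_delta_def half_delta_def Let_def bde r m by simp
  show "sgn (torsion_delta 1 w) = - 1" "sgn (torsion_delta 2 w) = 1" "sgn (torsion_delta 3 w) = - 1"
    unfolding torsion_delta_def Let_def bde by simp_all
qed

text \<open>This row differs from that of \<open>w = 15/16\<close> in point 1 and in the first and
  third torsion values.\<close>

lemma signs_at_6:
  fixes w :: rat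
  assumes w: "w = 3 / 5"
  shows "regular_at w"
    "sgn (point_delta 0 w) = - 1"
    "sgn (point_delta 1 w) = - 1"
    "sgn (point_delta 2 w) = 1"
    "sgn (point_delta 3 w) = - 1"
    "sgn (torsion_delta 1 w) = 1"
    "sgn (torsion_delta 2 w) = - 1"
    "sgn (torsion_delta 3 w) = - 1"
proof -
  have p: "w ^ 2 = 9 / 25" "w ^ 4 = 81 / 625" "w ^ 6 = 729 / 15625" "w ^ 8 = 6561 / 390625" "w ^ 10 = 59049 / 9765625" "w ^ 12 = 531441 / 244140625"
    unfolding w by (simp_all add: power_divide)
  have qv: "qw w = - 1329 / 625" "vw w = - 7 / 25"
    by (simp_all add: qw_def vw_def p)
  have sw: "sw w = 446544 / 78125"
    unfolding sw_def qv unfolding w by simp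
  have vals: "bw w = - 1806336 / 390625"
    "dw w = - 2719359 / 390625"
    "ew w = 1144552761 / 244140625"
    "hw w = 1788651 / 9765625"
    "gw w = 32375952 / 9765625"
    "kw w = - 3145968 / 390625"
    "x1w w = 1766241 / 390625"
    "b1w w = 1339632 / 390625"
    "d1w w = - 426609 / 390625"
    "e1w w = - 71674299 / 9765625"
    "x2w w = 36066276 / 9765625"
    "b2w w = - 7712208 / 1953125"
    "d2w w = - 5152554 / 1953125"
    "e2w w = 345211506 / 48828125"
    unfolding root_defs bw_def dw_def ew_def p qv sw unfolding w by (simp_all add: power2_eq_square)
  show "regular_at w" by (simp add: regular_at_def sw vals)
  have bde: "bw w / sw w = - 1792 / 2215" "dw w / sw w = - 302151 / 248080" "ew w / sw w = 127172529 / 155050000"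
    by (simp_all add: sw vals)
  show "sgn (point_delta 0 w) = - 1" unfolding point_delta_def Let_def bde by simp
  have h: "hw w / sw w = 198739 / 6202000" "gw w / sw w = 32119 / 55375" "kw w / sw w = - 3121 / 2215"
    by (simp_all add: sw vals)
  show "sgn (point_delta 1 w) = - 1" unfolding point_delta_def Let_def half_delta_def h by simp
  have r: "x1w w / sw w = 443 / 560" "b1w w / sw w = 3 / 5" "d1w w / sw w = - 107 / 560" "e1w w / sw w = - 17977 / 14000"
    by (simp_all add: sw vals)
  have m: "((3 / 5) * (- 107 / 560) * (- 17977 / 14000) + 1) / (443 / 560) = (44970617 / 31010000 :: rat)" by simp
  show "sgn (point_delta 2 w) = 1"
    unfolding point_delta_def chord_delta_def half_delta_def Let_def bde r m by simp
  have r: "x2w w / sw w = 1001841 / 1550500" "b2w w / sw w = - 7651 / 11075" "d2w w / sw w = - 286253 / 620200" "e2w w / sw w = 19178417 / 15505000"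
    by (simp_all add: sw vals)
  have m: "((- 7651 / 11075) * (- 286253 / 620200) * (19178417 / 15505000) + 1) / (1001841 / 1550500) = (2265795355211 / 1049932150000 :: rat)" by simp
  show "sgn (point_delta 3 w) = - 1"
    unfolding point_delta_def chord_delta_def half_delta_def Let_def bde r m by simp
  show "sgn (torsion_delta 1 w) = 1" "sgn (torsion_delta 2 w) = - 1" "sgn (torsion_delta 3 w) = - 1"
    unfolding torsion_delta_def Let_def bde by simp_all
qed

section \<open>Squarefreeness of \<open>s^2 e (b - d)\<close> and
  \<open>s^2 d (b - e)\<close>\<close>

lemma squarefree_root_difference_1:
  "squarefree (pcompose [:- 81, 1656, - 8880, - 18432, 372480, - 1837056, 5615616, - 11796480, 15532032, - 11010048, 3145728:] ([:1, 1:] ^ 2 :: rat poly))"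
  \<comment> \<open>Bezout cofactors of degrees 8 and 9, one below the degrees of the derivative and
    of the polynomial, as the extended Euclidean algorithm gives them; the final number is the
    constant they produce.\<close>
  by (rule squarefree_pcompose_square[of "[:16267493332104, - 79021322355200, - 963982861568896, 9063196553933312, - 39252942606157824, 111906173896138752, - 191769270545350656, 168074338686337024, - 56937337779650560:]" _ "[:799158921039, - 11561976830364, 21788419089808, 293210161110272, - 1983697299813888, 6939466237700096, - 16566105577050112, 24404749524090880, - 18800240690921472, 5693733777965056:]" 5740213340160]) (simp_all add: pderiv_pCons)

text \<open>The leading coefficient \<open>- 2^20\<close> is that of \<open>- dw w * ew w\<close>,
  because \<open>ew\<close> has larger degree than \<open>bw\<close>. Its sign is what excludes
  \<open>C\<close>.\<close>

lemma squarefree_root_difference_2: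
  "squarefree (pcompose [:- 81, 1656, 21840, - 184320, 220928, 1742848, - 7639040, 13631488, - 12517376, 5767168, - 1048576:] ([:1, 1:] ^ 2 :: rat poly))"
  by (rule squarefree_pcompose_square[of "[:- 38238180057144, 7539554864709744, - 47446011643041024, - 51226929797391104, 1072097349422214144, - 3223943538369490944, 4213713987222978560, - 2532030572129026048, 567139687526563840:]" _ "[:16254194701671, - 21713076300042, - 3355773714719688, 13839964162907808, 14153440312573184, - 197806381283279872, 486665894914015232, - 541633900657254400, 284395740026863616, - 56713968752656384:]" 30014239010595840]) (simp_all add: pderiv_pCons)

lemma to_fract_const:
  "to_fract [:numeral n :: rat:] = numeral n" "to_fract [:- numeral n :: rat:] = - numeral n"
proof -
  show *: "to_fract [:numeral n :: rat:] = numeral n"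
    using to_fract_numeral[of n, where ?'a = "rat poly"] by (simp only: numeral_poly)
  have "[:- numeral n :: rat:] = - [:numeral n:]" by simp
  then show "to_fract [:- numeral n :: rat:] = - numeral n" by (simp only: to_fract_uminus *)
qed

lemma to_fract_pcompose_pCons:
  "to_fract (pcompose (pCons a p) q) = to_fract [:a:] + to_fract q * to_fract (pcompose p q)"
  by (simp add: pcompose_pCons)

text \<open>The Horner form in \<open>w^2\<close> follows the recursion of \<open>pcompose\<close>,
  so the embedding of \<rat>[t] can be carried out coefficient by coefficient.\<close>

lemma root_difference_1:
  fixes w :: "rat poly fract"
  assumes "w = to_fract [:1, 1:]"
  shows "ew w * (bw w - dw w) = to_fract (pcompose [:- 81, 1656, - 8880, - 18432, 372480, - 1837056, 5615616, - 11796480, 15532032, - 11010048, 3145728:] ([:1, 1:] ^ 2))"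
proof -
  have "ew w * (bw w - dw w) = (- 81 + w ^ 2 * (1656 + w ^ 2 * (- 8880 + w ^ 2 * (- 18432 + w ^ 2 * (372480 + w ^ 2 * (- 1837056 + w ^ 2 * (5615616 + w ^ 2 * (- 11796480 + w ^ 2 * (15532032 + w ^ 2 * (- 11010048 + w ^ 2 * (3145728)))))))))))"
    unfolding base_defs by Groebner_Basis.algebra
  then show ?thesis
    by (simp only: to_fract_pcompose_pCons to_fract_const to_fract_power pcompose_0 to_fract_0 mult_zero_right add_0_right flip: assms)
qed

lemma root_difference_2:
  fixes w :: "rat poly fract"
  assumes "w = to_fract [:1, 1:]"
  shows "dw w * (bw w - ew w) = to_fract (pcompose [:- 81, 1656, 21840, - 184320, 220928, 1742848, - 7639040, 13631488, - 12517376, 5767168, - 1048576:] ([:1, 1:] ^ 2))"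
proof -
  have "dw w * (bw w - ew w) = (- 81 + w ^ 2 * (1656 + w ^ 2 * (21840 + w ^ 2 * (- 184320 + w ^ 2 * (220928 + w ^ 2 * (1742848 + w ^ 2 * (- 7639040 + w ^ 2 * (13631488 + w ^ 2 * (- 12517376 + w ^ 2 * (5767168 + w ^ 2 * (- 1048576)))))))))))"
    unfolding base_defs by Groebner_Basis.algebra
  then show ?thesis
    by (simp only: to_fract_pcompose_pCons to_fract_const to_fract_power pcompose_0 to_fract_0 mult_zero_right add_0_right flip: assms)
qed

lemma degree_lead_coeff_pcompose_square:
  fixes p :: "rat poly"
  assumes "degree p > 0"
  shows "degree (pcompose p ([:1, 1:] ^ 2)) > 0" "lead_coeff (pcompose p ([:1, 1:] ^ 2)) = lead_coeff p"
proof -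
  let ?q = "[:1, 1:] ^ 2 :: rat poly"
  have q: "degree ?q = 2" "coeff ?q 2 = 1"
    by (simp_all add: degree_power_eq power2_eq_square numeral_2_eq_2)
  show "degree (pcompose p ?q) > 0" using assms by (simp add: q degree_pcompose)
  show "lead_coeff (pcompose p ?q) = lead_coeff p"
    using lead_coeff_comp[of ?q p] unfolding q by simp
qed

lemma sign_condition:
  assumes ev: "eval_at t0 w w0" and reg: "regular_at w0"
    and sq: "nz_square (torsion_delta j w * (\<Prod>i<4. if \<epsilon> i then point_delta i w else 1))"
  shows "0 \<le> sgn (torsion_delta j w0) * (if \<epsilon> 0 then sgn (point_delta 0 w0) else 1) *
    (if \<epsilon> 1 then sgn (point_delta 1 w0) else 1) * (if \<epsilon> 2 then sgn (point_delta 2 w0) else 1) *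
    (if \<epsilon> 3 then sgn (point_delta 3 w0) else 1)"
proof -
  have sgn_nonneg: "0 \<le> sgn x" if "0 \<le> x" for x :: rat
    using that by (simp add: sgn_if)
  have prod: "(\<Prod>i<4. g i) = g 0 * g 1 * g 2 * g 3" for g :: "nat \<Rightarrow> rat poly fract"
    by (simp add: numeral_eq_Suc lessThan_Suc mult_ac)
  have "eval_at t0 (torsion_delta j w * ((if \<epsilon> 0 then point_delta 0 w else 1) * (if \<epsilon> 1 then point_delta 1 w else 1)
      * (if \<epsilon> 2 then point_delta 2 w else 1) * (if \<epsilon> 3 then point_delta 3 w else 1)))
    (torsion_delta j w0 * ((if \<epsilon> 0 then point_delta 0 w0 else 1) * (if \<epsilon> 1 then point_delta 1 w0 else 1)
      * (if \<epsilon> 2 then point_delta 2 w0 else 1) * (if \<epsilon> 3 then point_delta 3 w0 else 1)))"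
    by (intro eval_at_mult eval_at_if eval_at_1 eval_at_torsion_delta[OF ev reg] eval_at_point_delta[OF ev reg])
  from eval_at_nz_square[OF this] sq
  have "0 \<le> torsion_delta j w0 * ((if \<epsilon> 0 then point_delta 0 w0 else 1) * (if \<epsilon> 1 then point_delta 1 w0 else 1)
      * (if \<epsilon> 2 then point_delta 2 w0 else 1) * (if \<epsilon> 3 then point_delta 3 w0 else 1))"
    unfolding prod by blast
  then have "0 \<le> sgn (torsion_delta j w0 * ((if \<epsilon> 0 then point_delta 0 w0 else 1) * (if \<epsilon> 1 then point_delta 1 w0 else 1)
      * (if \<epsilon> 2 then point_delta 2 w0 else 1) * (if \<epsilon> 3 then point_delta 3 w0 else 1)))"
    by (rule sgn_nonneg)
  then show ?thesis
    by (simp only: sgn_mult if_distrib[of sgn] sgn_1 mult.assoc)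
qed

text \<open>Each inequality asks for an even number of negative signs, a linear equation over the
  field with two elements. The three torsion values multiply to a square, so there are six unknowns.
  Rows 1 and 2 remove point 1; rows 1 and 4 equate the exponents of points 0 and 3; row 6 then
  removes the torsion value at \<open>- 1 / d\<close>, row 1 the one at \<open>- 1 / b\<close>, row
  3 points 0 and 3, and row 5 point 2.\<close>

lemma square_classes_independent:
  fixes w :: "rat poly fract"
  assumes w: "w = to_fract [:1, 1:]" and j: "j \<le> 3"
    and sq: "nz_square (torsion_delta j w * (\<Prod>i<4. if \<epsilon> i then point_delta i w else 1))"
  shows "j = 0 \<and> (\<forall>i<4. \<not> \<epsilon> i)"
proof -
  have ev: "eval_at (w0 - 1) w w0" for w0
    using eval_at_to_fract[of "w0 - 1" "[:1, 1:]"] by (simp add: w)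
  note c = sign_condition[OF ev _ sq]
  note c1 = c[OF signs_at_1(1)[OF refl]] and c2 = c[OF signs_at_2(1)[OF refl]] and c3 = c[OF signs_at_3(1)[OF refl]]
    and c4 = c[OF signs_at_4(1)[OF refl]] and c5 = c[OF signs_at_5(1)[OF refl]] and c6 = c[OF signs_at_6(1)[OF refl]]
  note sgns = signs_at_1(2-)[OF refl] signs_at_2(2-)[OF refl] signs_at_3(2-)[OF refl] signs_at_4(2-)[OF refl]
    signs_at_5(2-)[OF refl] signs_at_6(2-)[OF refl]
  have 0: "torsion_delta 0 x = 1" for x :: rat by (simp add: torsion_delta_def Let_def)
  have "j = 0 \<or> j = 1 \<or> j = 2 \<or> j = 3" using j by linarith
  then have "j = 0 \<and> \<not> \<epsilon> 0 \<and> \<not> \<epsilon> 1 \<and> \<not> \<epsilon> 2 \<and> \<not> \<epsilon> 3"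
    using c1 c2 c3 c4 c5 c6
    by (elim disjE; cases "\<epsilon> 0"; cases "\<epsilon> 1"; cases "\<epsilon> 2"; cases "\<epsilon> 3")
      (simp_all only: sgns 0 if_True if_False sgn_1 mult_1 mult_1_right mult_minus1 mult_minus1_right minus_minus
        neg_0_le_iff_le not_one_le_zero simp_thms)
  moreover have "(\<forall>i<4. \<not> \<epsilon> i) \<longleftrightarrow> \<not> \<epsilon> 0 \<and> \<not> \<epsilon> 1 \<and> \<not> \<epsilon> 2 \<and> \<not> \<epsilon> 3"
    by (auto simp: numeral_eq_Suc less_Suc_eq)
  ultimately show ?thesis by blast
qed

text \<open>Everything is visible at \<open>t = 1\<close>, where \<open>w = 2\<close>: a function
  with a nonzero value there is not zero.\<close>

lemma coeffs_nonzero_distinct: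
  fixes w :: "rat poly fract"
  assumes w: "w = to_fract [:1, 1:]"
  shows "qw w \<noteq> 0" "vw w \<noteq> 0" "w \<noteq> 0" "sw w \<noteq> 0" "x1w w \<noteq> 0" "x2w w \<noteq> 0"
    "b1w w \<noteq> 0" "d1w w \<noteq> 0" "e1w w \<noteq> 0" "b2w w \<noteq> 0" "d2w w \<noteq> 0" "e2w w \<noteq> 0"
    and "split_cubic (bw w / sw w) (dw w / sw w) (ew w / sw w)"
    and "i < 4 \<Longrightarrow> point_delta i w \<noteq> 0"
proof -
  have ev: "eval_at 1 w 2"
    using eval_at_to_fract[of 1 "[:1, 1:]"] by (simp add: w)
  note eb = eval_at_base[OF ev] and er = eval_at_roots[OF ev]
  note reg = signs_at_1(1)[OF refl]
  note nz = eval_at_nonzero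
  show s: "sw w \<noteq> 0" and "x1w w \<noteq> 0" "x2w w \<noteq> 0"
    "b1w w \<noteq> 0" "d1w w \<noteq> 0" "e1w w \<noteq> 0" "b2w w \<noteq> 0" "d2w w \<noteq> 0" "e2w w \<noteq> 0"
    using eb[THEN nz] er[THEN nz] reg by (simp_all add: regular_at_def)
  then show "qw w \<noteq> 0" "vw w \<noteq> 0" "w \<noteq> 0" by (auto simp: sw_def)
  have "bw w \<noteq> 0" "dw w \<noteq> 0" "ew w \<noteq> 0" "bw w - dw w \<noteq> 0" "bw w - ew w \<noteq> 0" "dw w - ew w \<noteq> 0"
    by (rule eb[THEN nz] eval_at_diff[OF eb(2,3), THEN nz] eval_at_diff[OF eb(2,4), THEN nz]
        eval_at_diff[OF eb(3,4), THEN nz], simp add: base_defs)+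
  with s show "split_cubic (bw w / sw w) (dw w / sw w) (ew w / sw w)"
    by (simp add: split_cubic_def)
  assume "i < 4"
  then consider "i = 0" | "i = 1" | "i = 2" | "i = 3" by linarith
  then have "sgn (point_delta i (2 :: rat)) \<noteq> 0"
    using signs_at_1(2-5)[OF refl] by cases simp_all
  then have "point_delta i (2 :: rat) \<noteq> 0" by auto
  then show "point_delta i w \<noteq> 0"
    by (rule nz[OF eval_at_point_delta[OF ev reg]])
qed

section \<open>Torsion and rank of \<open>E\<close> over \<rat>(t)\<close>

lemma torsion_and_rank:
  fixes w b d e :: "rat poly fract" and f :: "rat poly fract poly"
  assumes w: "w = to_fract [:1, 1:]"
    and b: "b = bw w / sw w" and d: "d = dw w / sw w" and e: "e = ew w / sw w"
    and f: "f = [:1, b:] * [:1, d:] * [:1, e:]"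
  shows "elliptic_cubic f
       \<and> torsion_part (ec_group f) \<cong> integer_mod_group 2 \<times>\<times> integer_mod_group 2
       \<and> abelian_rank (ec_group f) \<ge> 4"
proof -
  note nonzero = coeffs_nonzero_distinct(1-12)[OF w]
  have split: "split_cubic b d e" unfolding b d e by (rule coeffs_nonzero_distinct(13)[OF w])
  interpret split_cubic b d e f
    using split by (simp_all add: split_cubic_def f)
  have sq: "d * e + 1 = (hw w / sw w) ^ 2" "b * e + 1 = (gw w / sw w) ^ 2" "b * d + 1 = (kw w / sw w) ^ 2"
    "1 + b * (x1w w / sw w) = (b1w w / sw w) ^ 2" "1 + d * (x1w w / sw w) = (d1w w / sw w) ^ 2"
    "1 + e * (x1w w / sw w) = (e1w w / sw w) ^ 2" "1 + b * (x2w w / sw w) = (b2w w / sw w) ^ 2"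
    "1 + d * (x2w w / sw w) = (d2w w / sw w) ^ 2" "1 + e * (x2w w / sw w) = (e2w w / sw w) ^ 2"
    unfolding power_divide square_identities[symmetric] b d e
    using nonzero(4) by (simp_all add: add_divide_distrib power2_eq_square)
  have pd: "point_delta 0 w = d * e"
    "point_delta 1 w = half_delta (hw w / sw w) (gw w / sw w) (kw w / sw w)"
    "point_delta 2 w = chord_delta b d e (x1w w / sw w) (b1w w / sw w) (d1w w / sw w) (e1w w / sw w)"
    "point_delta 3 w = chord_delta b d e (x2w w / sw w) (b2w w / sw w) (d2w w / sw w) (e2w w / sw w)"
    by (simp_all add: point_delta_def Let_def b d e)
  have half: "\<exists>P\<in>ec_points f. delta P = half_delta A B C"
    if "A ^ 2 - B ^ 2 = d * e - b * e" "A ^ 2 - C ^ 2 = d * e - b * d" "half_delta A B C \<noteq> 0" for A B C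
    using half_point_delta[OF that(1,2)] that(3) by (simp add: half_delta_def)
  have chord: "\<exists>P\<in>ec_points f. delta P = chord_delta b d e x r1 r2 r3"
    if "x \<noteq> 0" "1 + b * x = r1 ^ 2" "r1 \<noteq> 0" "1 + d * x = r2 ^ 2" "r2 \<noteq> 0" "1 + e * x = r3 ^ 2" "r3 \<noteq> 0"
      "chord_delta b d e x r1 r2 r3 \<noteq> 0" for x r1 r2 r3
    using half[OF chord_roots[OF that(1-7) refl]] that(8) by (simp add: chord_delta_def Let_def)
  have "\<exists>P\<in>ec_points f. delta P = point_delta i w" if i: "i < 4" for i
  proof -
    note ne = coeffs_nonzero_distinct(14)[OF w]
    consider "i = 0" | "i = 1" | "i = 2" | "i = 3" using i by linarith
    then show ?thesis
    proof cases
      case 1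
      show ?thesis
        by (rule bexI[of _ "Affine 0 1"]) (simp_all add: 1 pd poly_f_split delta_x_def)
    next
      case 2
      show ?thesis unfolding 2 pd
      proof (rule half)
        \<comment> \<open>The squares \<open>d e + 1\<close>, \<open>b e + 1\<close>,
          \<open>b d + 1\<close> belong to the abscissa \<open>1 / (b d e)\<close>.\<close>
        show "(hw w / sw w) ^ 2 - (gw w / sw w) ^ 2 = d * e - b * e"
          "(hw w / sw w) ^ 2 - (kw w / sw w) ^ 2 = d * e - b * d"
          unfolding sq[symmetric] by simp_all
      qed (use ne[of 1, unfolded pd] in simp)
    next
      case 3
      show ?thesis unfolding 3 pd
        by (rule chord[OF _ sq(4) _ sq(5) _ sq(6)]) (use nonzero ne[of 2] in \<open>simp_all add: pd\<close>)
    next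
      case 4
      show ?thesis unfolding 4 pd
        by (rule chord[OF _ sq(7) _ sq(8) _ sq(9)]) (use nonzero ne[of 3] in \<open>simp_all add: pd\<close>)
    qed
  qed
  then obtain p where p: "\<And>i. i < 4 \<Longrightarrow> p i \<in> ec_points f" "\<And>i. i < 4 \<Longrightarrow> delta (p i) = point_delta i w"
    by metis
  have td: "delta Infinity = torsion_delta 0 w" "delta_x (- 1 / b) = torsion_delta 1 w"
    "delta_x (- 1 / d) = torsion_delta 2 w" "delta_x (- 1 / e) = torsion_delta 3 w"
  proof -
    have "1 + b * (- 1 / c) \<noteq> 0" if "c \<noteq> 0" "c \<noteq> b" for c using that by (simp add: field_simps)
    note ne = this[OF nz(2)] this[OF nz(3)]
    show "delta_x (- 1 / b) = torsion_delta 1 w"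
      unfolding delta_x_def torsion_delta_def Let_def b[symmetric] d[symmetric] e[symmetric]
      using nz by simp
    show "delta_x (- 1 / d) = torsion_delta 2 w" "delta_x (- 1 / e) = torsion_delta 3 w"
      unfolding delta_x_def torsion_delta_def Let_def b[symmetric] d[symmetric] e[symmetric]
      using ne nz distinct by (simp_all add: field_simps)
    show "delta Infinity = torsion_delta 0 w" by (simp add: torsion_delta_def Let_def)
  qed
  \<comment> \<open>Independence with no point chosen; this is what excludes points of order
    4.\<close>
  have nsq: "\<not> nz_square (torsion_delta j w)" if "j \<in> {1, 2, 3}" for j
  proof
    assume "nz_square (torsion_delta j w)"
    then have "nz_square (torsion_delta j w * (\<Prod>i<4. if False then point_delta i w else 1))" by simp
    from square_classes_independent[OF w _ this] that show False by auto
  qed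
  interpret S: square_class_map "ec_group f" delta
    rewrites "carrier (ec_group f) = ec_points f" and "monoid.mult (ec_group f) = ec_add f"
      and "one (ec_group f) = Infinity"
    by (rule square_class_map_delta) (simp_all add: ec_group_def)
  have "enat 4 \<le> abelian_rank (ec_group f)"
  proof (rule S.abelian_rank_ge[of p])
    show "p ` {..<4} \<subseteq> ec_points f" using p by auto
    fix u \<epsilon>
    assume u: "u \<in> ec_points f" "ec_add f u u = Infinity"
      and *: "nz_square (delta u * (\<Prod>i<4. if \<epsilon> i then delta (p i) else 1))"
    have "(\<Prod>i<4. if \<epsilon> i then delta (p i) else 1) = (\<Prod>i<4. if \<epsilon> i then point_delta i w else 1)"
      by (rule prod.cong) (auto simp: p)
    with * have sq': "nz_square (delta u * (\<Prod>i<4. if \<epsilon> i then point_delta i w else 1))" by simp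
    have "u \<in> {Infinity, Affine (- 1 / b) 0, Affine (- 1 / d) 0, Affine (- 1 / e) 0}"
      using u two_torsion by blast
    then obtain j where j: "j \<le> 3" "delta u = torsion_delta j w" "j = 0 \<Longrightarrow> u = Infinity"
      using td by (auto 4 3 intro: that[of 0] that[of 1] that[of 2] that[of 3])
    from square_classes_independent[OF w j(1), of \<epsilon>] sq' j(2,3)
    show "u = Infinity \<and> (\<forall>i<4. \<not> \<epsilon> i)" by simp
  qed
  then have rank: "abelian_rank (ec_group f) \<ge> 4" by (simp add: numeral_eq_enat)
  have tors: "torsion_part (ec_group f) \<cong> integer_mod_group 2 \<times>\<times> integer_mod_group 2"
  proof (rule torsion_part_iso)
    fix P and m :: nat
    assume "P \<in> ec_points f" "odd m" "P [^]\<^bsub>ec_group f\<^esub> m = Infinity"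
    then show "P = Infinity"
    proof (rule no_odd_torsion[OF split f nonzero(4) _ squarefree_root_difference_1 _ squarefree_root_difference_2, rotated 4])
      show "sw w ^ 2 * (e * (b - d)) = to_fract (pcompose [:- 81, 1656, - 8880, - 18432, 372480, - 1837056, 5615616, - 11796480, 15532032, - 11010048, 3145728:] ([:1, 1:] ^ 2))"
        unfolding root_difference_1[OF w, symmetric] b d e using nonzero(4) by (simp add: field_simps power2_eq_square)
      show "sw w ^ 2 * (d * (b - e)) = to_fract (pcompose [:- 81, 1656, 21840, - 184320, 220928, 1742848, - 7639040, 13631488, - 12517376, 5767168, - 1048576:] ([:1, 1:] ^ 2))"
        unfolding root_difference_2[OF w, symmetric] b d e using nonzero(4) by (simp add: field_simps power2_eq_square)
    qed (simp_all add: degree_lead_coeff_pcompose_square)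
  next
    show "\<not> nz_square (delta_x (- 1 / b))" "\<not> nz_square (delta_x (- 1 / d))" "\<not> nz_square (delta_x (- 1 / e))"
      unfolding td by (rule nsq; simp)+
  qed
  show ?thesis using elliptic_cubic_f tors rank by blast
qed

theorem theorem1:
  fixes t b d e N :: "rat poly fract" and f :: "rat poly fract poly"
  assumes t: "t = to_fract [:0, 1:]"
    and b: "b = 16 * t * (t + 1) * (t + 2) * (2 * t ^ 2 + 4 * t + 1)
                / (16 * t ^ 4 + 64 * t ^ 3 + 76 * t ^ 2 + 24 * t - 1)"
    and d: "d = (256 * t ^ 8 + 2048 * t ^ 7 + 6272 * t ^ 6 + 8960 * t ^ 5 + 5424 * t ^ 4
                   + 192 * t ^ 3 - 888 * t ^ 2 - 112 * t + 33)
                / (16 * (16 * t ^ 4 + 64 * t ^ 3 + 76 * t ^ 2 + 24 * t - 1)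
                   * (2 * t ^ 2 + 4 * t + 1) * (t + 1))"
    and N: "N = 4096 * t ^ 12 + 49152 * t ^ 11 + 262144 * t ^ 10 + 819200 * t ^ 9
                + 1665024 * t ^ 8 + 2310144 * t ^ 7 + 2233728 * t ^ 6 + 1507584 * t ^ 5
                + 697856 * t ^ 4 + 211968 * t ^ 3 + 38624 * t ^ 2 + 3520 * t + 105"
    and e: "e = N / (16 * (16 * t ^ 4 + 64 * t ^ 3 + 76 * t ^ 2 + 24 * t - 1)
                     * (2 * t ^ 2 + 4 * t + 1) * (t + 1))"
    and f: "f = [:1, b:] * [:1, d:] * [:1, e:]"
  shows "elliptic_cubic f
       \<and> torsion_part (ec_group f) \<cong> integer_mod_group 2 \<times>\<times> integer_mod_group 2
       \<and> abelian_rank (ec_group f) \<ge> 4"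
proof -
  \<comment> \<open>Centred at \<open>t = - 1\<close>, the quartic, the quadratic and both long
    numerators become even polynomials.\<close>
  define w where "w = to_fract [:1, 1 :: rat:]"
  have "w = to_fract ([:0, 1:] + 1)" by (simp add: w_def one_pCons)
  then have tw: "t = w - 1" by (simp add: t)
  note nonzero = coeffs_nonzero_distinct(1-4)[OF w_def]
  have q: "16 * t ^ 4 + 64 * t ^ 3 + 76 * t ^ 2 + 24 * t - 1 = qw w"
    and v: "2 * t ^ 2 + 4 * t + 1 = vw w"
    unfolding tw qw_def vw_def by Groebner_Basis.algebra+
  have t1: "t + 1 = w" by (simp add: tw)
  have s: "16 * qw w * vw w * w = sw w" by (simp add: sw_def)
  have "b = 16 * t * w * (t + 2) * vw w / qw w"
    unfolding b q v t1 ..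
  moreover have "16 * t * w * (t + 2) * vw w * sw w = bw w * qw w"
    unfolding tw sw_def bw_def by Groebner_Basis.algebra
  ultimately have b': "b = bw w / sw w"
    using nonzero by (simp add: frac_eq_eq)
  have d': "d = dw w / sw w"
    unfolding d q v t1 s unfolding dw_def tw by (rule arg_cong[of _ _ "\<lambda>x. x / sw w"]) Groebner_Basis.algebra
  have e': "e = ew w / sw w"
    unfolding e N q v t1 s unfolding ew_def tw by (rule arg_cong[of _ _ "\<lambda>x. x / sw w"]) Groebner_Basis.algebra
  show ?thesis by (rule torsion_and_rank[OF w_def b' d' e' f])
qed

end
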